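(* Let $\chi$ be a character of $T$ of minimal depth $r\in\mathbb{Z}_{\ge0}$ whose central character $\theta=\chi|_Z$ is trivial on $Z\cap\mathcal{K}_1$, and let $\pi_\chi$ be the associated principal series representation. Then $$\mathrm{Res}_{\mathcal{K}_{2r+1}}\pi_\chi\cong(q+1)\,\mathbbm{1}\oplus\mathrm{Res}_{\mathcal{K}_{2r+1}}\tau_{\mathcal{N}_1}(\theta)\oplus\mathrm{Res}_{\mathcal{K}_{2r+1}}\tau_{\mathcal{N}_\varpi}(\theta),$$ where $(q+1)\mathbbm{1}$ denotes the direct sum of $q+1$ copies of the trivial representation of $\mathcal{K}_{2r+1}$.
   Context: Let $F$ be a non-archimedean local field with odd residual characteristic, ring of integers $\mathcal{O}_F$, maximal ideal $\mathfrak{p}_F$, uniformizer $\varpi$, residue field of cardinality $q$. Fix a non-square $\epsilon\in\mathcal{O}_F^\times$, $E=F[\sqrt\epsilon]$ with ring of integers $\mathcal{O}_E$ and maximal ideal $\mathfrak{p}_E$; $\overline{x}$ is Galois conjugation. $G=\{g\in\mathrm{GL}_2(E):\overline{g}^{\top}\mathrm{w}g=\mathrm{w}\}$, $\mathrm{w}=\begin{pmatrix}0&1\\1&0\end{pmatrix}$. $\mathcal{K}=G\cap M_2(\mathcal{O}_E)$, $\mathcal{K}_n=\{g\in\mathcal{K}:g\equiv I\bmod\mathfrak{p}_E^n\}$. $B$ upper triangular matrices in $G$, $T=\{t(a)=\mathrm{diag}(a,\overline a^{-1}):a\in E^\times\}$, $U=\{\begin{pmatrix}1&\sqrt\epsilon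 b\\0&1\end{pmatrix}:b\in F\}$, $\mathcal{U}=U\cap\mathcal{K}$, $Z$ scalar matrices of $G$. $T_0=\{t(a):a\in\mathcal{O}_E^\times\}$, $T_n=\{t(a):a\in1+\mathfrak{p}_E^n\}$; $S=\{\mathrm{diag}(a,a^{-1}):a\in F^\times\}$ with $S_0,S_n$ analogous. A character $\chi$ of $T$ has depth $r$ if $\chi|_{T_r}\ne\mathbbm{1}$, $\chi|_{T_{r+1}}=\mathbbm{1}$ (trivial on $T_0$ also counts as depth $0$); true depth = depth of $\chi|_S$; minimal depth $r$ = both equal $r$. $\pi_\chi=\mathrm{Ind}_B^G\chi$ ($\chi$ trivial on $U$). Fix an additive character $\psi'$ of $F$ trivial on $\mathfrak{p}_F$, nontrivial on $\mathcal{O}_F$; $\psi(x)=\psi'((x+\overline x)/2)$. For $d\ge1$, $\mathcal{J}_d$ = set of $g\in G$ with $g_{11}-1,g_{22}-1,g_{12}\in\mathfrak{p}_E^{\lceil d/2\rceil}$, $g_{21}\in\mathfrak{p}_E^{\lceil(d+1)/2\rceil}$; $X_{\varpi^{-d}}=\begin{pmatrix}0&\varpi^{-d}\sqrt\epsilon\\0&0\end{pmatrix}$; $\Psi(g)=\psi(\mathrm{Tr}(X_{\varpi^{-d}}(g-I)))$ is a character of $\mathcal{J}_d$; for a character $\theta$ of $Z$ trivial on $Z\cap\mathcal{K}_1$, let $\Psi_{\theta}$ be the character of $Z\mathcal{U}\mathcal{J}_d$ which is $\theta$ on $Z$, trivial on $\mathcal{U}$ and $\Psi$ on $\mathcal{J}_d$,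 and $\mathcal{S}_d(X_{\varpi^{-d}},\theta)=\mathrm{Ind}_{Z\mathcal{U}\mathcal{J}_d}^{\mathcal{K}}\Psi_\theta$. Define $\tau_{\mathcal{N}_1}(\theta)=\bigoplus_{d\in2\mathbb{Z}_{>0}}\mathcal{S}_d(X_{\varpi^{-d}},\theta)$ and $\tau_{\mathcal{N}_\varpi}(\theta)=\bigoplus_{d\in2\mathbb{Z}_{\ge0}+1}\mathcal{S}_d(X_{\varpi^{-d}},\theta)$. *)

theory Defs
  imports Complex_Main
begin

text \<open>Elements of F live in a field type 'f; v is the normalized discrete valuation
  (its value at 0 is irrelevant), w0 a uniformizer.\<close>

definition pF :: "('f::field \<Rightarrow> int) \<Rightarrow> int \<Rightarrow> 'f set" where
  "pF v n = {x. x = 0 \<or> v x \<ge> n}"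

definition residue_field :: "('f::field \<Rightarrow> int) \<Rightarrow> 'f set set" where
  "residue_field v = (\<lambda>x. {y \<in> pF v 0. x - y \<in> pF v 1}) ` pF v 0"

definition residue_card :: "('f::field \<Rightarrow> int) \<Rightarrow> nat" where
  "residue_card v = card (residue_field v)"

definition nonarch_local_field :: "('f::field \<Rightarrow> int) \<Rightarrow> 'f \<Rightarrow> bool" where
  "nonarch_local_field v w0 \<longleftrightarrow>
     (\<forall>x y. x \<noteq> 0 \<longrightarrow> y \<noteq> 0 \<longrightarrow> v (x * y) = v x + v y) \<and>
     (\<forall>x y. x \<noteq> 0 \<longrightarrow> y \<noteq> 0 \<longrightarrow> x + y \<noteq> 0 \<longrightarrow> v (x + y) \<ge> min (v x) (v y)) \<and>
     w0 \<noteq> 0 \<and> v w0 = 1 \<and>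
     (\<forall>X :: nat \<Rightarrow> 'f. (\<forall>N. \<exists>M. \<forall>m\<ge>M. \<forall>n\<ge>M. X m - X n \<in> pF v N) \<longrightarrow>
          (\<exists>L. \<forall>N. \<exists>M. \<forall>n\<ge>M. X n - L \<in> pF v N)) \<and>
     finite (residue_field v)"

definition odd_residual_char :: "('f::field \<Rightarrow> int) \<Rightarrow> bool" where
  "odd_residual_char v \<longleftrightarrow> (2::'f) \<noteq> 0 \<and> v 2 = 0"

section \<open>The quadratic extension E = F[sqrt eps], elements as pairs (a,b) = a + b sqrt eps\<close>

type_synonym 'f ext = "'f \<times> 'f"

definition eof :: "'f::field \<Rightarrow> 'f ext" where "eof a = (a, 0)"
definition eadd :: "'f::field ext \<Rightarrow> 'f ext \<Rightarrow> 'f ext" where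
  "eadd x y = (fst x + fst y, snd x + snd y)"
definition esub :: "'f::field ext \<Rightarrow> 'f ext \<Rightarrow> 'f ext" where
  "esub x y = (fst x - fst y, snd x - snd y)"
definition emul :: "'f::field \<Rightarrow> 'f ext \<Rightarrow> 'f ext \<Rightarrow> 'f ext" where
  "emul eps x y = (fst x * fst y + eps * snd x * snd y, fst x * snd y + snd x * fst y)"
definition econj :: "'f::field ext \<Rightarrow> 'f ext" where "econj x = (fst x, - snd x)"
definition enorm :: "'f::field \<Rightarrow> 'f ext \<Rightarrow> 'f" where
  "enorm eps x = fst x ^ 2 - eps * snd x ^ 2"
definition einv :: "'f::field \<Rightarrow> 'f ext \<Rightarrow> 'f ext" where
  "einv eps x = (fst x / enorm eps x, - snd x / enorm eps x)"

text \<open>p_E^n via the normalized valuation of E: E/F is unramified, so v_E = v_F o N / 2.\<close>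
definition pE :: "('f::field \<Rightarrow> int) \<Rightarrow> 'f \<Rightarrow> int \<Rightarrow> 'f ext set" where
  "pE v eps n = {x. x = (0, 0) \<or> v (enorm eps x) \<ge> 2 * n}"

definition unitsE :: "('f::field \<Rightarrow> int) \<Rightarrow> 'f \<Rightarrow> 'f ext set" where
  "unitsE v eps = pE v eps 0 - pE v eps 1"

record 'f mat2 =
  m11 :: "'f ext"
  m12 :: "'f ext"
  m21 :: "'f ext"
  m22 :: "'f ext"

definition mk :: "'f ext \<Rightarrow> 'f ext \<Rightarrow> 'f ext \<Rightarrow> 'f ext \<Rightarrow> 'f mat2" where
  "mk a b c d = \<lparr>m11 = a, m12 = b, m21 = c, m22 = d\<rparr>"

definition mmul :: "'f::field \<Rightarrow> 'f mat2 \<Rightarrow> 'f mat2 \<Rightarrow> 'f mat2" where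
  "mmul eps g h = mk
     (eadd (emul eps (m11 g) (m11 h)) (emul eps (m12 g) (m21 h)))
     (eadd (emul eps (m11 g) (m12 h)) (emul eps (m12 g) (m22 h)))
     (eadd (emul eps (m21 g) (m11 h)) (emul eps (m22 g) (m21 h)))
     (eadd (emul eps (m21 g) (m12 h)) (emul eps (m22 g) (m22 h)))"

definition msub :: "'f::field mat2 \<Rightarrow> 'f mat2 \<Rightarrow> 'f mat2" where
  "msub g h = mk (esub (m11 g) (m11 h)) (esub (m12 g) (m12 h))
                 (esub (m21 g) (m21 h)) (esub (m22 g) (m22 h))"

definition mI :: "'f::field mat2" where "mI = mk (1, 0) (0, 0) (0, 0) (1, 0)"
definition mw :: "'f::field mat2" where "mw = mk (0, 0) (1, 0) (1, 0) (0, 0)"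

definition mconjT :: "'f::field mat2 \<Rightarrow> 'f mat2" where
  "mconjT g = mk (econj (m11 g)) (econj (m21 g)) (econj (m12 g)) (econj (m22 g))"

definition mdet :: "'f::field \<Rightarrow> 'f mat2 \<Rightarrow> 'f ext" where
  "mdet eps g = esub (emul eps (m11 g) (m22 g)) (emul eps (m12 g) (m21 g))"

definition mtr :: "'f::field mat2 \<Rightarrow> 'f ext" where
  "mtr g = eadd (m11 g) (m22 g)"

definition inG :: "'f::field \<Rightarrow> 'f mat2 \<Rightarrow> bool" where
  "inG eps g \<longleftrightarrow> mdet eps g \<noteq> (0, 0) \<and> mmul eps (mmul eps (mconjT g) mw) g = mw"

definition inK :: "('f::field \<Rightarrow> int) \<Rightarrow> 'f \<Rightarrow> 'f mat2 \<Rightarrow> bool" where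
  "inK v eps g \<longleftrightarrow> inG eps g \<and> m11 g \<in> pE v eps 0 \<and> m12 g \<in> pE v eps 0
      \<and> m21 g \<in> pE v eps 0 \<and> m22 g \<in> pE v eps 0"

definition inKn :: "('f::field \<Rightarrow> int) \<Rightarrow> 'f \<Rightarrow> nat \<Rightarrow> 'f mat2 \<Rightarrow> bool" where
  "inKn v eps n g \<longleftrightarrow> inK v eps g \<and>
     (let h = msub g mI in m11 h \<in> pE v eps (int n) \<and> m12 h \<in> pE v eps (int n)
        \<and> m21 h \<in> pE v eps (int n) \<and> m22 h \<in> pE v eps (int n))"

definition inB :: "'f::field \<Rightarrow> 'f mat2 \<Rightarrow> bool" where
  "inB eps g \<longleftrightarrow> inG eps g \<and> m21 g = (0, 0)"

definition tmat :: "'f::field \<Rightarrow> 'f ext \<Rightarrow> 'f mat2" where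
  "tmat eps a = mk a (0, 0) (0, 0) (einv eps (econj a))"

definition inU :: "'f::field mat2 \<Rightarrow> bool" where
  "inU g \<longleftrightarrow> (\<exists>b. g = mk (1, 0) (0, b) (0, 0) (1, 0))"

definition inZ :: "'f::field \<Rightarrow> 'f mat2 \<Rightarrow> bool" where
  "inZ eps g \<longleftrightarrow> inG eps g \<and> (\<exists>z. g = mk z (0, 0) (0, 0) z)"

text \<open>J_d, with ceil(d/2) = (d+1) div 2 and ceil((d+1)/2) = (d+2) div 2.\<close>
definition inJ :: "('f::field \<Rightarrow> int) \<Rightarrow> 'f \<Rightarrow> nat \<Rightarrow> 'f mat2 \<Rightarrow> bool" where
  "inJ v eps d g \<longleftrightarrow> inG eps g \<and>
     esub (m11 g) (1, 0) \<in> pE v eps (int ((d + 1) div 2)) \<and>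
     esub (m22 g) (1, 0) \<in> pE v eps (int ((d + 1) div 2)) \<and>
     m12 g \<in> pE v eps (int ((d + 1) div 2)) \<and>
     m21 g \<in> pE v eps (int ((d + 2) div 2))"

definition additive_char_cond :: "('f::field \<Rightarrow> int) \<Rightarrow> ('f \<Rightarrow> complex) \<Rightarrow> bool" where
  "additive_char_cond v psi' \<longleftrightarrow>
     (\<forall>x y. psi' (x + y) = psi' x * psi' y) \<and> (\<forall>x. psi' x \<noteq> 0) \<and>
     (\<forall>x\<in>pF v 1. psi' x = 1) \<and> (\<exists>x\<in>pF v 0. psi' x \<noteq> 1)"

definition psiE :: "('f::field \<Rightarrow> complex) \<Rightarrow> 'f ext \<Rightarrow> complex" where
  "psiE psi' x = psi' (fst (eadd x (econj x)) / 2)"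

definition Xd :: "'f::field \<Rightarrow> nat \<Rightarrow> 'f mat2" where
  "Xd w0 d = mk (0, 0) (0, inverse w0 ^ d) (0, 0) (0, 0)"

definition PsiJ :: "'f::field \<Rightarrow> 'f \<Rightarrow> ('f \<Rightarrow> complex) \<Rightarrow> nat \<Rightarrow> 'f mat2 \<Rightarrow> complex" where
  "PsiJ eps w0 psi' d g = psiE psi' (mtr (mmul eps (Xd w0 d) (msub g mI)))"

text \<open>A character of T = {t(a)} identified with a homomorphism chi : E^x -> C^x, chi(t(a)) = chi a.\<close>
definition char_of_Ex :: "'f::field \<Rightarrow> ('f ext \<Rightarrow> complex) \<Rightarrow> bool" where
  "char_of_Ex eps chi \<longleftrightarrow>
     (\<forall>x y. x \<noteq> (0, 0) \<longrightarrow> y \<noteq> (0, 0) \<longrightarrow> chi (emul eps x y) = chi x * chi y) \<and>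
     (\<forall>x. x \<noteq> (0, 0) \<longrightarrow> chi x \<noteq> 0)"

text \<open>Filtration levels: level 0 = O_E^x, level n>0 = 1 + p_E^n; T_n = t(level n).
  S_n corresponds to the elements of level n lying in F.\<close>
definition levT :: "('f::field \<Rightarrow> int) \<Rightarrow> 'f \<Rightarrow> nat \<Rightarrow> 'f ext \<Rightarrow> bool" where
  "levT v eps n a \<longleftrightarrow> (if n = 0 then a \<in> unitsE v eps else esub a (1, 0) \<in> pE v eps (int n))"

definition levS :: "('f::field \<Rightarrow> int) \<Rightarrow> 'f \<Rightarrow> nat \<Rightarrow> 'f ext \<Rightarrow> bool" where
  "levS v eps n a \<longleftrightarrow> snd a = 0 \<and> levT v eps n a"

definition has_depth :: "(nat \<Rightarrow> 'x \<Rightarrow> bool) \<Rightarrow> ('x \<Rightarrow> complex) \<Rightarrow> nat \<Rightarrow> bool" where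
  "has_depth lev chi r \<longleftrightarrow>
     (r = 0 \<and> (\<forall>a. lev 0 a \<longrightarrow> chi a = 1)) \<or>
     ((\<exists>a. lev r a \<and> chi a \<noteq> 1) \<and> (\<forall>a. lev (r + 1) a \<longrightarrow> chi a = 1))"

definition minimal_depth :: "('f::field \<Rightarrow> int) \<Rightarrow> 'f \<Rightarrow> ('f ext \<Rightarrow> complex) \<Rightarrow> nat \<Rightarrow> bool" where
  "minimal_depth v eps chi r \<longleftrightarrow> has_depth (levT v eps) chi r \<and> has_depth (levS v eps) chi r"

type_synonym ('g, 'x) rep = "('x \<Rightarrow> complex) set \<times> ('g \<Rightarrow> ('x \<Rightarrow> complex) \<Rightarrow> ('x \<Rightarrow> complex))"

definition rep_iso :: "('g \<Rightarrow> bool) \<Rightarrow> ('g, 'x) rep \<Rightarrow> ('g, 'y) rep \<Rightarrow> bool" where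
  "rep_iso H R S \<longleftrightarrow> (\<exists>\<phi>. bij_betw \<phi> (fst R) (fst S) \<and>
     (\<forall>f\<in>fst R. \<forall>g\<in>fst R. \<forall>c. \<phi> (\<lambda>x. c * f x + g x) = (\<lambda>y. c * \<phi> f y + \<phi> g y)) \<and>
     (\<forall>h. H h \<longrightarrow> (\<forall>f\<in>fst R. \<phi> (snd R h f) = snd S h (\<phi> f))))"

definition rep_sum :: "('g, 'x) rep \<Rightarrow> ('g, 'y) rep \<Rightarrow> ('g, 'x + 'y) rep" where
  "rep_sum R S = ({h. (h \<circ> Inl) \<in> fst R \<and> (h \<circ> Inr) \<in> fst S},
     \<lambda>k h. case_sum (snd R k (h \<circ> Inl)) (snd S k (h \<circ> Inr)))"

definition triv_rep :: "nat \<Rightarrow> ('g, nat) rep" where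
  "triv_rep m = ({c. \<forall>i\<ge>m. c i = 0}, \<lambda>k c. c)"

definition principal_series :: "('f::field \<Rightarrow> int) \<Rightarrow> 'f \<Rightarrow> ('f ext \<Rightarrow> complex) \<Rightarrow> ('f mat2, 'f mat2) rep" where
  "principal_series v eps chi =
    ({f. (\<forall>g. \<not> inG eps g \<longrightarrow> f g = 0) \<and>
         (\<forall>b g. inB eps b \<longrightarrow> inG eps g \<longrightarrow> f (mmul eps b g) = chi (m11 b) * f g) \<and>
         (\<exists>n\<ge>1. \<forall>g k. inG eps g \<longrightarrow> inKn v eps n k \<longrightarrow> f (mmul eps g k) = f g)},
     \<lambda>k f g. if inG eps g then f (mmul eps g k) else 0)"

text \<open>S_d(X_{w0^-d}, theta) = Ind_{Z U J_d}^K Psi_theta, theta(zI) = chi z.\<close>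
definition S_space :: "('f::field \<Rightarrow> int) \<Rightarrow> 'f \<Rightarrow> 'f \<Rightarrow> ('f \<Rightarrow> complex) \<Rightarrow> ('f ext \<Rightarrow> complex)
      \<Rightarrow> nat \<Rightarrow> ('f mat2 \<Rightarrow> complex) set" where
  "S_space v eps w0 psi' chi d =
    {f. (\<forall>g. \<not> inK v eps g \<longrightarrow> f g = 0) \<and>
        (\<forall>z u j k. inZ eps z \<longrightarrow> inU u \<longrightarrow> inK v eps u \<longrightarrow> inJ v eps d j \<longrightarrow> inK v eps k \<longrightarrow>
           f (mmul eps (mmul eps (mmul eps z u) j) k) = chi (m11 z) * PsiJ eps w0 psi' d j * f k)}"

definition tau_rep :: "('f::field \<Rightarrow> int) \<Rightarrow> 'f \<Rightarrow> 'f \<Rightarrow> ('f \<Rightarrow> complex) \<Rightarrow> ('f ext \<Rightarrow> complex)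
      \<Rightarrow> nat set \<Rightarrow> ('f mat2, nat \<times> 'f mat2) rep" where
  "tau_rep v eps w0 psi' chi D =
    ({F. (\<forall>d. (if d \<in> D then (\<lambda>g. F (d, g)) \<in> S_space v eps w0 psi' chi d
               else (\<forall>g. F (d, g) = 0))) \<and> finite {d. \<exists>g. F (d, g) \<noteq> 0}},
     \<lambda>k F x. if inK v eps (snd x) then F (fst x, mmul eps (snd x) k) else 0)"

end

theory Submission
  imports Defs
begin

text \<open>
  After Iwasawa, \<open>\<pi>\<^sub>\<chi>\<close> is a space of functions on \<open>\<K>\<close>. Over \<open>\<K>\<^sub>m\<close> with \<open>m > r\<close> the
  character \<open>\<chi>\<close> can be divided out by a function of the bottom row of the matrix, and over
  \<open>\<K>\<^sub>1\<close> so can \<open>\<theta>\<close> from every \<open>\<S>\<^sub>d\<close>; hence it suffices to decompose the locally constant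
  functions on \<open>(B \<inter> \<K>) \<setminus> \<K>\<close>. Averaging against \<open>\<Psi>\<close> over the lower unipotents of \<open>\<J>\<^sub>d\<close> maps such
  functions to \<open>\<S>\<^sub>d\<close>, summing over the torus maps back, and with \<open>P\<^sub>n\<close> the average over the lower
  unipotents in \<open>\<pp>\<^sup>n\<close> Fourier inversion on \<open>\<pp>\<^sup>l / \<pp>\<^sup>d\<^sup>+\<^sup>1\<close>, \<open>l\<close> the level of \<open>\<J>\<^sub>d\<close>, gives
  \<open>P\<^sub>d\<^sub>+\<^sub>1 - P\<^sub>d\<close> for the composite. Telescoping leaves \<open>P\<^sub>1\<close>, whose image consists of the functions on
  the \<open>q + 1\<close> points of the projective line over the residue field.
\<close>

text \<open>The two sides need different multipliers. On the principal series, \<open>chi\<close> of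
  the inverse conjugate of a unit entry of the bottom row works, because \<open>tt a\<close> scales
  that row by the inverse conjugate of \<open>a\<close>. This function cannot serve for
  \<open>S_space\<close>: for small d its elements are invariant under torus elements
  \<open>tt (s, 0)\<close> with s in F close to 1, where \<open>chi\<close> may still be nontrivial.
  Only the action of norm-one scalars is prescribed there, so the second multiplier extends
  \<open>chi\<close> from norm-one elements to units modulo 1 + p_E; it is built from orbit
  representatives and need not be a character. All integrals run over powers of p in F: the lower
  unipotents are a copy of F on which the torus acts through the norm, and since the norm is onto
  the units, a sum over the torus becomes an integral over units u of F. The inversion formula then
  rests on a Ramanujan sum: the average of psi'(b u) over units is a combination of two indicator
  functions of b. The orthogonality relations between different d show that the pieces are
  independent and that every finite family of components occurs.\<close>

locale unramified_setup =
  fixes v :: "'f::field \<Rightarrow> int" and w0 eps :: 'f and psi' :: "'f \<Rightarrow> complex"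
  assumes local_field: "nonarch_local_field v w0"
    and odd_residue: "odd_residual_char v"
    and eps_nz: "eps \<noteq> 0" and v_eps: "v eps = 0"
    and eps_nonsquare: "\<not> (\<exists>y. y * y = eps)"
    and psi_cond: "additive_char_cond v psi'"
begin

section \<open>Powers of the maximal ideal, units, and square roots near 1\<close>

abbreviation P :: "int \<Rightarrow> 'f set" where "P n \<equiv> pF v n"

lemma v_mult: "x \<noteq> 0 \<Longrightarrow> y \<noteq> 0 \<Longrightarrow> v (x * y) = v x + v y"
  using local_field by (auto simp: nonarch_local_field_def)

lemma v_add: "x \<noteq> 0 \<Longrightarrow> y \<noteq> 0 \<Longrightarrow> x + y \<noteq> 0 \<Longrightarrow> v (x + y) \<ge> min (v x) (v y)"
  using local_field by (auto simp: nonarch_local_field_def)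

lemma w0_nz [simp]: "w0 \<noteq> 0" and v_w0 [simp]: "v w0 = 1"
  using local_field by (auto simp: nonarch_local_field_def)

lemma v_one [simp]: "v 1 = 0"
  using v_mult[of 1 1] by simp

lemma v_uminus [simp]: "v (- x) = v x"
proof (cases "x = 0")
  case False
  have "v (- 1) = 0" using v_mult[of "-1" "-1"] by simp
  with False show ?thesis using v_mult[of "-1" x] by simp
qed simp

lemma v_inverse: "x \<noteq> 0 \<Longrightarrow> v (inverse x) = - v x"
  using v_mult[of x "inverse x"] by simp

lemma v_power: "x \<noteq> 0 \<Longrightarrow> v (x ^ n) = int n * v x"
  by (induction n) (auto simp: v_mult algebra_simps)

lemma v_2 [simp]: "v 2 = 0" and two_nz [simp]: "(2::'f) \<noteq> 0"
  using odd_residue by (auto simp: odd_residual_char_def)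

lemma P_zero [simp]: "0 \<in> P n" by (simp add: pF_def)

lemma P_add: "x \<in> P n \<Longrightarrow> y \<in> P n \<Longrightarrow> x + y \<in> P n"
  using v_add[of x y] by (fastforce simp: pF_def min_def split: if_splits)

lemma P_uminus [simp]: "- x \<in> P n \<longleftrightarrow> x \<in> P n" by (simp add: pF_def)

lemma P_diff: "x \<in> P n \<Longrightarrow> y \<in> P n \<Longrightarrow> x - y \<in> P n"
  using P_add[of x n "- y"] by simp

lemma P_diff_commute: "x - y \<in> P n \<longleftrightarrow> y - x \<in> P n"
  using P_uminus[of "x - y" n] by simp

lemma P_mult: "x \<in> P m \<Longrightarrow> y \<in> P n \<Longrightarrow> x * y \<in> P (m + n)"
  by (cases "x = 0"; cases "y = 0") (auto simp: pF_def v_mult)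

lemma P_mult': "x \<in> P m \<Longrightarrow> y \<in> P n \<Longrightarrow> k \<le> m + n \<Longrightarrow> x * y \<in> P k"
  by (cases "x = 0"; cases "y = 0") (auto simp: pF_def v_mult)

lemma P_mono: "x \<in> P m \<Longrightarrow> n \<le> m \<Longrightarrow> x \<in> P n"
  by (auto simp: pF_def)

lemma P_multl: "x \<in> P 0 \<Longrightarrow> y \<in> P n \<Longrightarrow> x * y \<in> P n"
  using P_mult[of x 0 y n] by simp

lemma P_multr: "x \<in> P n \<Longrightarrow> y \<in> P 0 \<Longrightarrow> x * y \<in> P n"
  using P_mult[of x n y 0] by simp

lemma P_add_iff: "y \<in> P n \<Longrightarrow> x + y \<in> P n \<longleftrightarrow> x \<in> P n"
  using P_add[of x n y] P_diff[of "x + y" n y] by auto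

lemma P_diff_iff: "y \<in> P n \<Longrightarrow> x - y \<in> P n \<longleftrightarrow> x \<in> P n"
  using P_add_iff[of "-y" n x] by simp

lemma P_one [simp]: "1 \<in> P n \<longleftrightarrow> n \<le> 0" by (simp add: pF_def)

lemma P_eps_mult [simp]: "eps * x \<in> P n \<longleftrightarrow> x \<in> P n"
  using eps_nz v_eps by (cases "x = 0") (auto simp: pF_def v_mult)

lemma P_eps [simp]: "eps \<in> P 0" using P_eps_mult[of 1 0] by simp

lemma P_half [simp]: "x / 2 \<in> P n \<longleftrightarrow> x \<in> P n"
proof (cases "x = 0")
  case False
  have "v (x / 2) = v x" using v_mult[of "x/2" 2] False by simp
  with False show ?thesis by (simp add: pF_def)
qed simp

lemma P_two_mult [simp]: "2 * x \<in> P n \<longleftrightarrow> x \<in> P n"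
  using P_half[of "2 * x" n] by simp

lemma P_w0_power_mult: "w0 ^ n * x \<in> P (int n + m) \<longleftrightarrow> x \<in> P m"
  by (cases "x = 0") (auto simp: pF_def v_mult v_power)

lemma P_eq_zero: assumes "\<And>n. x \<in> P n" shows "x = 0"
  using assms[of "v x + 1"] by (auto simp: pF_def)

definition unit :: "'f \<Rightarrow> bool" where "unit x \<longleftrightarrow> x \<noteq> 0 \<and> v x = 0"

lemma unit_nz [simp]: "unit x \<Longrightarrow> x \<noteq> 0" by (simp add: unit_def)

lemma unit_iff: "unit x \<longleftrightarrow> x \<in> P 0 \<and> x \<notin> P 1"
  by (auto simp: unit_def pF_def)

lemma unit_P [simp]: "unit x \<Longrightarrow> x \<in> P 0" by (simp add: unit_iff)

lemma unit_one [simp]: "unit 1" and unit_two [simp]: "unit 2" and unit_eps [simp]: "unit eps"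
  using eps_nz v_eps by (auto simp: unit_def)

lemma unit_mult [simp]: "unit x \<Longrightarrow> unit y \<Longrightarrow> unit (x * y)" by (simp add: unit_def v_mult)

lemma unit_inverse [simp]: "unit x \<Longrightarrow> unit (inverse x)" by (simp add: unit_def v_inverse)

lemma unit_divide [simp]: "unit x \<Longrightarrow> unit y \<Longrightarrow> unit (x / y)" by (simp add: divide_inverse)

lemma P_unit_mult: "unit u \<Longrightarrow> u * x \<in> P n \<longleftrightarrow> x \<in> P n"
  by (cases "x = 0") (auto simp: pF_def v_mult unit_def)

lemma P_unit_mult_right: "unit u \<Longrightarrow> x * u \<in> P n \<longleftrightarrow> x \<in> P n"
  using P_unit_mult[of u x n] by (simp add: mult.commute)

lemma P_unit_divide: "unit u \<Longrightarrow> x / u \<in> P n \<longleftrightarrow> x \<in> P n"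
  using P_unit_mult[of "inverse u" x n] by (simp add: field_simps)

lemma unit_cong: assumes "unit x" "x - y \<in> P 1" shows "unit y"
  using assms P_diff[of x 1 "x - y"] P_add[of y 1 "x - y"] P_diff[of x 0 "x - y"] P_mono[of "x - y" 1 0]
  by (auto simp: unit_iff)

lemma unit_one_plus: "x - 1 \<in> P n \<Longrightarrow> n \<ge> 1 \<Longrightarrow> unit x"
  using unit_cong[of 1 x] P_diff_commute[of x 1 1] P_mono[of "x - 1" n 1] by auto

lemma complete: assumes "\<And>N. \<exists>M. \<forall>m\<ge>M. \<forall>n\<ge>M. X m - X n \<in> P N"
  obtains L where "\<And>N. \<exists>M. \<forall>n\<ge>(M::nat). X n - L \<in> P N"
proof -
  have "\<forall>X :: nat \<Rightarrow> 'f. (\<forall>N. \<exists>M. \<forall>m\<ge>M. \<forall>n\<ge>M. X m - X n \<in> P N) \<longrightarrow>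
          (\<exists>L. \<forall>N. \<exists>M. \<forall>n\<ge>M. X n - L \<in> P N)"
    using local_field by (simp add: nonarch_local_field_def)
  with assms that show ?thesis by blast
qed

text \<open>Hensel's lemma for the square, by a simplified Newton iteration: near 1 the derivative
  2x may be replaced by 2, which is a unit. Convergence is then only linear, one power of p per
  step, but this is enough.\<close>

lemma sqrt_one_plus:
  assumes a: "a - 1 \<in> P n" and n: "n \<ge> 1"
  obtains x where "x * x = a" "x - 1 \<in> P n"
proof -
  define X where "X = rec_nat (1::'f) (\<lambda>_ x. x + (a - x * x) / 2)"
  have X0: "X 0 = 1" and XS: "\<And>i. X (Suc i) = X i + (a - X i * X i) / 2"
    by (simp_all add: X_def)
  have step: "X i - 1 \<in> P n \<and> a - X i * X i \<in> P (n + int i)" for i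
  proof (induction i)
    case 0 show ?case using a by (simp add: X0)
  next
    case (Suc i)
    define f where "f = (a - X i * X i) / 2"
    have f2: "a - X i * X i - 2 * f = 0" by (simp add: f_def)
    have f: "f \<in> P (n + int i)" using Suc by (simp add: f_def)
    hence fn: "f \<in> P n" by (rule P_mono) simp
    have 1: "X (Suc i) - 1 = (X i - 1) + f" by (simp add: XS f_def)
    have "X (Suc i) - 1 \<in> P n" unfolding 1 using Suc fn by (intro P_add) auto
    \<comment> \<open>The linear term cancels up to \<open>f * (X i - 1)\<close>, which gains at
      least one power of p since \<open>X i\<close> is 1 modulo p^n with n at least 1.\<close>
    moreover have "a - X (Suc i) * X (Suc i) = (a - X i * X i - 2 * f) - 2 * (f * (X i - 1)) - f * f"
      by (simp add: XS f_def[symmetric]) (simp add: algebra_simps)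
    hence "a - X (Suc i) * X (Suc i) = - (2 * (f * (X i - 1))) - f * f"
      using f2 by simp
    moreover have "- (2 * (f * (X i - 1))) - f * f \<in> P (n + int (Suc i))"
      using Suc f fn n
      by (intro P_diff) (auto intro!: P_mult'[of _ "n + int i" _ n])
    ultimately show ?case by simp
  qed
  have near: "X (i + k) - X i \<in> P (n + int i)" for i k
  proof (induction k)
    case (Suc k)
    have "(a - X (i+k) * X (i+k)) / 2 \<in> P (n + int i)"
      using step[of "i+k"] by (auto intro: P_mono)
    with Suc show ?case using P_add[of "X (i+k) - X i" _ "(a - X (i+k) * X (i+k)) / 2"]
      by (simp add: XS algebra_simps)
  qed simp
  have cauchy: "\<exists>M. \<forall>m\<ge>M. \<forall>k\<ge>M. X m - X k \<in> P N" for N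
  proof (intro exI allI impI)
    fix m k assume "nat N \<le> m" "nat N \<le> k"
    then obtain m' k' where "m = nat N + m'" "k = nat N + k'" by (metis le_iff_add)
    hence "(X m - X (nat N)) - (X k - X (nat N)) \<in> P (n + int (nat N))"
      using near[of "nat N" m'] near[of "nat N" k'] by (simp only: P_diff)
    thus "X m - X k \<in> P N" using n by (auto intro: P_mono)
  qed
  obtain L where L: "\<And>N. \<exists>M. \<forall>i\<ge>M. X i - L \<in> P N" using complete[OF cauchy] by blast
  have "L - 1 \<in> P n"
  proof -
    obtain M where "X M - L \<in> P n" using L by blast
    thus ?thesis using P_diff[of "X M - 1" n "X M - L"] step[of M] by simp
  qed
  moreover have "a - L * L \<in> P N" for N
  proof -
    obtain M where M: "\<forall>i\<ge>M. X i - L \<in> P (max N 0)" using L by blast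
    \<comment> \<open>Beyond \<open>M\<close> the iterate is close to the limit; beyond
      \<open>nat N\<close> its own error lies in p^N.\<close>
    define i where "i = max M (nat N)"
    have i: "X i - L \<in> P (max N 0)" using M by (simp add: i_def)
    have x0: "X i \<in> P 0" using step[of i] P_add[of "X i - 1" 0 1] P_mono[of "X i - 1" n 0] n by auto
    have "L \<in> P 0" using P_diff[OF x0, of "X i - L"] P_mono[OF i, of 0] by simp
    hence "(X i - L) * (X i + L) \<in> P N" using i x0
      by (intro P_mult'[OF i P_add[of _ 0]]) auto
    moreover have "a - X i * X i \<in> P N"
      using step[of i] n by (auto simp: i_def intro: P_mono)
    moreover have "a - L * L = (a - X i * X i) + (X i - L) * (X i + L)" by (simp add: algebra_simps)
    ultimately show ?thesis by (metis P_add)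
  qed
  hence "L * L = a" using P_eq_zero[of "a - L * L"] by simp
  ultimately show ?thesis using that by blast
qed

section \<open>The unramified quadratic extension\<close>

text \<open>The norm form is anisotropic modulo p: a primitive zero modulo p would make
  \<open>eps\<close> a square up to a factor in 1 + p, and such a factor is itself a square.\<close>

lemma norm_unit: assumes "x \<in> P 0" "y \<in> P 0" "\<not> (x \<in> P 1 \<and> y \<in> P 1)"
  shows "unit (x * x - eps * (y * y))"
proof -
  have in0: "x * x - eps * (y * y) \<in> P 0" using assms by (intro P_diff) (auto intro!: P_multl)
  show ?thesis
  proof (rule ccontr)
    assume "\<not> ?thesis"
    with in0 have *: "x * x - eps * (y * y) \<in> P 1" by (simp add: unit_iff)
    have ynot: "y \<notin> P 1"
    proof
      assume "y \<in> P 1"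
      hence "eps * (y * y) \<in> P 1" using assms by (auto intro: P_multl)
      hence "x * x \<in> P 1" using * P_add[of "x * x - eps * (y * y)" 1 "eps * (y * y)"] by simp
      hence "x \<in> P 1" by (cases "x = 0") (auto simp: pF_def v_mult)
      with \<open>y \<in> P 1\<close> assms show False by simp
    qed
    hence uy: "unit y" using assms by (simp add: unit_iff)
    have ux: "unit x"
    proof (rule ccontr)
      assume "\<not> unit x"
      hence "x \<in> P 1" using assms by (simp add: unit_iff)
      hence "x * x \<in> P 1" using assms by (auto intro: P_multl)
      hence "eps * (y * y) \<in> P 1" using * P_diff[of "x * x" 1 "x * x - eps * (y * y)"] by simp
      thus False using uy P_unit_mult[OF uy, of y 1] ynot by simp
    qed
    define z where "z = eps * (y * y) / (x * x)"
    have "z - 1 = - ((x * x - eps * (y * y)) / (x * x))" using ux by (simp add: z_def field_simps)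
    hence "z - 1 \<in> P 1" using * P_unit_divide[of "x * x"] ux by simp
    then obtain s where s: "s * s = z" using sqrt_one_plus by blast
    have "(s * x / y) * (s * x / y) = (s * s) * (x * x) / (y * y)" by simp
    also have "\<dots> = eps" unfolding s z_def using ux uy by simp
    finally have "(s * x / y) * (s * x / y) = eps" .
    with eps_nonsquare show False by blast
  qed
qed

text \<open>Dividing the pair by a power of the uniformizer makes it primitive, and then
  \<open>norm_unit\<close> computes the valuation of the norm exactly.\<close>

lemma v_norm_ge: "enorm eps (x, y) \<in> P (2 * n) \<longleftrightarrow> x \<in> P n \<and> y \<in> P n"
proof
  assume h: "x \<in> P n \<and> y \<in> P n"
  show "enorm eps (x, y) \<in> P (2 * n)" unfolding enorm_def power2_eq_square
    using h by (simp add: mult.assoc, intro P_diff) (auto intro: P_mult'[of _ n _ n])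
next
  assume h: "enorm eps (x, y) \<in> P (2 * n)"
  show "x \<in> P n \<and> y \<in> P n"
  proof (cases "x = 0 \<and> y = 0")
    case False
    \<comment> \<open>The smaller valuation of the two coordinates; the cases are needed because
      \<open>v 0\<close> carries no information.\<close>
    define m where "m = (if x = 0 then v y else if y = 0 then v x else min (v x) (v y))"
    define s where "s = (if m \<ge> 0 then w0 ^ nat m else inverse (w0 ^ nat (- m)))"
    have s: "s \<noteq> 0" "v s = m" by (auto simp: s_def v_power v_inverse)
    have vx: "x / s \<noteq> 0 \<Longrightarrow> v (x / s) = v x - m" and vy: "y / s \<noteq> 0 \<Longrightarrow> v (y / s) = v y - m"
      using s by (auto simp: divide_inverse v_mult v_inverse)
    have "unit ((x / s) * (x / s) - eps * ((y / s) * (y / s)))"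
      using False vx vy s by (intro norm_unit) (auto simp: pF_def m_def split: if_splits)
    moreover have "enorm eps (x, y) = (s * s) * ((x / s) * (x / s) - eps * ((y / s) * (y / s)))"
      using s by (simp add: enorm_def power2_eq_square field_simps)
    ultimately have "enorm eps (x, y) \<noteq> 0" "v (enorm eps (x, y)) = 2 * m"
      using s by (auto simp: unit_def v_mult)
    with h have "n \<le> m" by (simp add: pF_def)
    thus ?thesis by (auto simp: pF_def m_def split: if_splits)
  qed simp
qed

lemma enorm_eq_0_iff: "enorm eps z = 0 \<longleftrightarrow> z = (0, 0)"
proof
  obtain x y where z: "z = (x, y)" by force
  assume "enorm eps z = 0"
  hence "x \<in> P n \<and> y \<in> P n" for n using v_norm_ge[of x y n] z by simp
  thus "z = (0, 0)" using P_eq_zero z by blast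
qed (simp add: enorm_def)

text \<open>This is where the extension being unramified enters: 1 and sqrt eps form a basis of O_E
  over O_F, so ideals of E can be tested on coordinates.\<close>

lemma pE_iff: "z \<in> pE v eps n \<longleftrightarrow> fst z \<in> P n \<and> snd z \<in> P n"
proof -
  have "z \<in> pE v eps n \<longleftrightarrow> enorm eps z \<in> P (2 * n)"
    using enorm_eq_0_iff[of z] by (auto simp: pE_def pF_def)
  thus ?thesis using v_norm_ge[of "fst z" "snd z" n] by simp
qed


section \<open>Averages of locally constant functions on fractional ideals\<close>

abbreviation q :: nat where "q \<equiv> residue_card v"

text \<open>Representatives of the quotient p^j / p^N, kept as elements of F so that quotients of
  ideals never have to be formed.\<close>

definition transversal :: "nat \<Rightarrow> nat \<Rightarrow> 'f set \<Rightarrow> bool" where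
  "transversal j N A \<longleftrightarrow> finite A \<and> A \<subseteq> P (int j) \<and> (\<forall>x\<in>P (int j). \<exists>a\<in>A. x - a \<in> P (int N))
     \<and> (\<forall>a\<in>A. \<forall>b\<in>A. a - b \<in> P (int N) \<longrightarrow> a = b)"

lemma residue_class_eq:
  assumes "x \<in> P 0" "y \<in> P 0"
  shows "{z \<in> P 0. x - z \<in> P 1} = {z \<in> P 0. y - z \<in> P 1} \<longleftrightarrow> x - y \<in> P 1"
proof
  assume "{z \<in> P 0. x - z \<in> P 1} = {z \<in> P 0. y - z \<in> P 1}"
  moreover have "y \<in> {z \<in> P 0. y - z \<in> P 1}" using assms by simp
  ultimately show "x - y \<in> P 1" by blast
next
  assume xy: "x - y \<in> P 1"
  have "x - z \<in> P 1 \<longleftrightarrow> y - z \<in> P 1" for z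
    using P_add_iff[OF xy, of "y - z"] by (simp add: algebra_simps)
  thus "{z \<in> P 0. x - z \<in> P 1} = {z \<in> P 0. y - z \<in> P 1}" by simp
qed

lemma finite_residue_field: "finite (residue_field v)"
  using local_field by (simp add: nonarch_local_field_def)

lemma transversal_residue: "\<exists>A. transversal 0 1 A \<and> card A = q"
proof -
  define C where "C = (\<lambda>x. {y \<in> P 0. x - y \<in> P 1})"
  have rf: "residue_field v = C ` P 0" by (simp add: residue_field_def C_def)
  have Ceq: "C x = C y \<longleftrightarrow> x - y \<in> P 1" if "x \<in> P 0" "y \<in> P 0" for x y
    using residue_class_eq[OF that] by (simp add: C_def)
  define e where "e = (\<lambda>D. SOME x. x \<in> P 0 \<and> C x = D)"
  have e: "e D \<in> P 0 \<and> C (e D) = D" if "D \<in> residue_field v" for D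
    unfolding e_def by (rule someI_ex) (use that rf in auto)
  have inj: "inj_on e (residue_field v)" using e by (metis inj_onI)
  have "\<exists>a\<in>e ` residue_field v. x - a \<in> P 1" if "x \<in> P 0" for x
    using e[of "C x"] Ceq[of x "e (C x)"] that rf by auto
  moreover have "e D = e D'" if "D \<in> residue_field v" "D' \<in> residue_field v" "e D - e D' \<in> P 1" for D D'
    using e Ceq that by metis
  ultimately show ?thesis using finite_residue_field e inj
    by (intro exI[of _ "e ` residue_field v"]) (auto simp: transversal_def card_image residue_card_def)
qed

lemma q_pos: "q > 0"
proof -
  have "0 \<in> P 0" by simp
  hence "residue_field v \<noteq> {}" unfolding residue_field_def by blast
  thus ?thesis using finite_residue_field by (simp add: residue_card_def card_gt_0_iff)
qed

lemma transversal_step: "\<exists>A. transversal j (Suc j) A \<and> card A = q"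
proof -
  obtain A where A: "transversal 0 1 A" "card A = q" using transversal_residue by blast
  let ?B = "(\<lambda>x. w0 ^ j * x) ` A"
  have mem: "w0 ^ j * x \<in> P (int j) \<longleftrightarrow> x \<in> P 0" "w0 ^ j * x \<in> P (1 + int j) \<longleftrightarrow> x \<in> P 1" for x
    using P_w0_power_mult[of j x 0] P_w0_power_mult[of j x 1] by (auto simp: algebra_simps)
  have *: "w0 ^ j * a - w0 ^ j * b = w0 ^ j * (a - b)" for a b by (simp add: algebra_simps)
  have "\<exists>a\<in>?B. x - a \<in> P (1 + int j)" if "x \<in> P (int j)" for x
  proof -
    define y where "y = x / w0 ^ j"
    have x: "x = w0 ^ j * y" by (simp add: y_def)
    with that mem have "y \<in> P 0" by simp
    thus ?thesis using A unfolding transversal_def x by (auto simp: * mem)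
  qed
  moreover have "inj_on (\<lambda>x. w0 ^ j * x) A" by (auto simp: inj_on_def)
  ultimately show ?thesis using A mem
    by (intro exI[of _ ?B]) (auto simp: transversal_def card_image *)
qed

text \<open>Representatives of p^j / p^N and of p^N / p^M combine along the filtration; injectivity
  of the sum gives the product formula for the index.\<close>

lemma transversal_sum:
  assumes A: "transversal j N A" and B: "transversal N M B" and jN: "j \<le> N" and NM: "N \<le> M"
  shows "transversal j M ((\<lambda>(a, b). a + b) ` (A \<times> B))" and "inj_on (\<lambda>(a, b). a + b) (A \<times> B)"
proof -
  have BN: "b \<in> B \<Longrightarrow> b \<in> P (int N)" for b using B by (auto simp: transversal_def)
  have Bj: "b \<in> B \<Longrightarrow> b \<in> P (int j)" for b using P_mono[OF BN, of b "int j"] jN by simp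
  have Aj: "a \<in> A \<Longrightarrow> a \<in> P (int j)" for a using A by (auto simp: transversal_def)
  have key: "a = a' \<and> b = b'" if "a \<in> A" "a' \<in> A" "b \<in> B" "b' \<in> B" "(a + b) - (a' + b') \<in> P (int M)" for a b a' b'
  proof -
    have "(a + b) - (a' + b') \<in> P (int N)" using that NM by (auto intro: P_mono)
    hence "((a + b) - (a' + b')) - (b - b') \<in> P (int N)" using BN that by (simp only: P_diff)
    hence "a = a'" using that A by (auto simp: transversal_def algebra_simps)
    thus ?thesis using that B by (auto simp: transversal_def)
  qed
  show "inj_on (\<lambda>(a, b). a + b) (A \<times> B)"
    using key by (force simp: inj_on_def)
  have "\<exists>a\<in>A. \<exists>b\<in>B. x - (a + b) \<in> P (int M)" if x: "x \<in> P (int j)" for x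
  proof -
    obtain a where a: "a \<in> A" "x - a \<in> P (int N)" using A x by (auto simp: transversal_def)
    then obtain b where "b \<in> B" "x - a - b \<in> P (int M)" using B unfolding transversal_def by blast
    with a show ?thesis by (auto simp: algebra_simps)
  qed
  hence cover: "\<forall>x\<in>P (int j). \<exists>c\<in>(\<lambda>(a, b). a + b) ` (A \<times> B). x - c \<in> P (int M)" by force
  have sep: "\<forall>c\<in>(\<lambda>(a, b). a + b) ` (A \<times> B). \<forall>d\<in>(\<lambda>(a, b). a + b) ` (A \<times> B). c - d \<in> P (int M) \<longrightarrow> c = d"
  proof (intro ballI impI)
    fix c d assume cd: "c \<in> (\<lambda>(a, b). a + b) ` (A \<times> B)" "d \<in> (\<lambda>(a, b). a + b) ` (A \<times> B)" "c - d \<in> P (int M)"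
    then obtain a b a' b' where ab: "c = a + b" "a \<in> A" "b \<in> B" "d = a' + b'" "a' \<in> A" "b' \<in> B"
      by (elim imageE) auto
    thus "c = d" using key[of a a' b b'] cd(3) by simp
  qed
  have "finite ((\<lambda>(a, b). a + b) ` (A \<times> B))" using A B by (simp add: transversal_def)
  moreover have "(\<lambda>(a, b). a + b) ` (A \<times> B) \<subseteq> P (int j)" using Aj Bj P_add by auto
  ultimately show "transversal j M ((\<lambda>(a, b). a + b) ` (A \<times> B))"
    using cover sep unfolding transversal_def by blast
qed

lemma transversal_exists: "j \<le> N \<Longrightarrow> \<exists>A. transversal j N A \<and> card A = q ^ (N - j)"
proof (induction N)
  case 0
  thus ?case by (intro exI[of _ "{0}"]) (auto simp: transversal_def)
next
  case (Suc N)
  show ?case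
  proof (cases "j = Suc N")
    case True
    thus ?thesis by (intro exI[of _ "{0}"]) (auto simp: transversal_def)
  next
    case False
    with Suc obtain A where A: "transversal j N A" "card A = q ^ (N - j)" by auto
    obtain B where B: "transversal N (Suc N) B" "card B = q" using transversal_step by blast
    have "card ((\<lambda>(a, b). a + b) ` (A \<times> B)) = q ^ (Suc N - j)"
      using transversal_sum(2)[OF A(1) B(1)] False Suc.prems A B
      by (simp add: card_image card_cartesian_product Suc_diff_le)
    thus ?thesis using transversal_sum(1)[OF A(1) B(1)] False Suc.prems by auto
  qed
qed

definition invar :: "nat \<Rightarrow> nat \<Rightarrow> ('f \<Rightarrow> 'c) \<Rightarrow> bool" where
  "invar j N h \<longleftrightarrow> (\<forall>x\<in>P (int j). \<forall>y\<in>P (int N). h (x + y) = h x)"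

lemma invar_mono: "invar j N h \<Longrightarrow> N \<le> M \<Longrightarrow> invar j M h"
  using P_mono[of _ "int M" "int N"] by (auto simp: invar_def)

lemma invarD: "invar j N h \<Longrightarrow> x \<in> P (int j) \<Longrightarrow> y - x \<in> P (int N) \<Longrightarrow> h y = h x"
  unfolding invar_def by (drule (1) bspec, drule (1) bspec) (simp add: add_diff_eq)

text \<open>Sending each element to the representative of its class in the other system gives
  mutually inverse maps that do not change \<open>h\<close>.\<close>

lemma transversal_sum_eq:
  fixes h :: "'f \<Rightarrow> 'c::comm_monoid_add"
  assumes A: "transversal j N A" and B: "transversal j N B" and h: "invar j N h"
  shows "sum h A = sum h B"
proof -
  define rep where "rep = (\<lambda>D x. SOME b. b \<in> D \<and> x - b \<in> P (int N))"
  have rep: "rep D x \<in> D \<and> x - rep D x \<in> P (int N)" if "transversal j N D" "x \<in> P (int j)" for D x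
    unfolding rep_def by (rule someI_ex) (use that in \<open>auto simp: transversal_def\<close>)
  have Aj: "\<And>a. a \<in> A \<Longrightarrow> a \<in> P (int j)" and Bj: "\<And>b. b \<in> B \<Longrightarrow> b \<in> P (int j)"
    using A B by (auto simp: transversal_def)
  have rep_rep: "rep D (rep E x) = x" if DD: "transversal j N D" "transversal j N E" "x \<in> D" for D E x
  proof -
    have x: "x \<in> P (int j)" using DD by (auto simp: transversal_def)
    have 1: "rep E x \<in> E \<and> x - rep E x \<in> P (int N)" using rep DD(2) x by blast
    hence "rep E x \<in> P (int j)" using DD by (auto simp: transversal_def)
    hence 2: "rep D (rep E x) \<in> D \<and> rep E x - rep D (rep E x) \<in> P (int N)" using rep DD(1) by blast
    have "x - rep D (rep E x) \<in> P (int N)"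
      using P_add[of "x - rep E x" "int N" "rep E x - rep D (rep E x)"] 1 2 by simp
    thus ?thesis using DD 2 unfolding transversal_def by metis
  qed
  show ?thesis
  proof (rule sum.reindex_bij_witness[of A "rep A" "rep B"])
    fix a assume a: "a \<in> A"
    show "rep A (rep B a) = a" "rep B a \<in> B" using rep_rep[OF A B a] rep[OF B Aj[OF a]] by auto
    show "h (rep B a) = h a"
      using rep[OF B Aj[OF a]] by (intro invarD[OF h Aj[OF a]]) (auto simp: P_diff_commute)
  next
    fix b assume b: "b \<in> B"
    show "rep B (rep A b) = b" "rep A b \<in> A" using rep_rep[OF B A b] rep[OF A Bj[OF b]] by auto
  qed
qed

lemma transversal_card: assumes "transversal j N A" "j \<le> N" shows "card A = q ^ (N - j)"
proof -
  obtain B where B: "transversal j N B" "card B = q ^ (N - j)" using transversal_exists[OF assms(2)] by blast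
  have "sum (\<lambda>_. 1::nat) A = sum (\<lambda>_. 1) B"
    by (rule transversal_sum_eq[OF assms(1) B(1)]) (simp add: invar_def)
  thus ?thesis using B by simp
qed

definition reps :: "nat \<Rightarrow> nat \<Rightarrow> 'f set" where "reps j N = (SOME A. transversal j N A)"

lemma transversal_reps: assumes "j \<le> N" shows "transversal j N (reps j N)"
proof -
  have "\<exists>A. transversal j N A" using transversal_exists[OF assms] by blast
  thus ?thesis unfolding reps_def by (rule someI_ex)
qed

lemma finite_reps: "j \<le> N \<Longrightarrow> finite (reps j N)"
  using transversal_reps[of j N] by (simp add: transversal_def)

lemma reps_P: "j \<le> N \<Longrightarrow> a \<in> reps j N \<Longrightarrow> a \<in> P (int j)"
  using transversal_reps[of j N] by (auto simp: transversal_def)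

lemma card_reps: "j \<le> N \<Longrightarrow> card (reps j N) = q ^ (N - j)"
  by (rule transversal_card[OF transversal_reps])

text \<open>A Riemann sum for the Haar integral over p^j of total mass 1; it is exact once
  \<open>h\<close> is invariant under p^N.\<close>

definition avg_upto :: "nat \<Rightarrow> nat \<Rightarrow> ('f \<Rightarrow> complex) \<Rightarrow> complex" where
  "avg_upto j N h = sum h (reps j N) / of_nat (q ^ (N - j))"

lemma avg_upto_split:
  assumes "j \<le> N" "N \<le> M" and h: "invar j M h"
  shows "avg_upto j M h = avg_upto j N (\<lambda>x. avg_upto N M (\<lambda>y. h (x + y)))"
proof -
  note t = transversal_sum[OF transversal_reps transversal_reps, OF assms(1,2,1,2)]
  have "sum h (reps j M) = sum h ((\<lambda>(a, b). a + b) ` (reps j N \<times> reps N M))"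
    using assms by (intro transversal_sum_eq[OF _ _ h] transversal_reps t) auto
  also have "\<dots> = (\<Sum>x\<in>reps j N. \<Sum>y\<in>reps N M. h (x + y))"
    by (subst sum.reindex[OF t(2)]) (simp add: sum.cartesian_product split_def)
  also have "q ^ (M - j) = q ^ (N - j) * q ^ (M - N)"
    using assms by (simp flip: power_add)
  ultimately show ?thesis
    by (simp add: avg_upto_def sum_divide_distrib mult.commute)
qed

lemma avg_upto_cong:
  assumes "j \<le> N" "\<And>x. x \<in> P (int j) \<Longrightarrow> h x = g x" shows "avg_upto j N h = avg_upto j N g"
proof -
  have "sum h (reps j N) = sum g (reps j N)"
    by (rule sum.cong[OF refl]) (rule assms(2)[OF reps_P[OF assms(1)]])
  thus ?thesis by (simp add: avg_upto_def)
qed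

lemma avg_upto_const:
  assumes "j \<le> N" "\<And>x. x \<in> P (int j) \<Longrightarrow> h x = c" shows "avg_upto j N h = c"
proof -
  have "avg_upto j N h = avg_upto j N (\<lambda>_. c)" using assms by (rule avg_upto_cong)
  thus ?thesis using card_reps[OF assms(1)] q_pos by (simp add: avg_upto_def)
qed

text \<open>The sequence is eventually constant for locally constant \<open>h\<close>; otherwise the limit is junk.\<close>

definition avg :: "nat \<Rightarrow> ('f \<Rightarrow> complex) \<Rightarrow> complex" where
  "avg j h = lim (\<lambda>N. avg_upto j N h)"

lemma avg_eq: assumes h: "invar j N h" and jN: "j \<le> N" shows "avg j h = avg_upto j N h"
proof -
  have "avg_upto j M h = avg_upto j N h" if "N \<le> M" for M
  proof -
    have "avg_upto j M h = avg_upto j N (\<lambda>x. avg_upto N M (\<lambda>y. h (x + y)))"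
      by (rule avg_upto_split[OF jN that invar_mono[OF h that]])
    also have "\<dots> = avg_upto j N h"
    proof (rule avg_upto_cong[OF jN])
      fix x assume "x \<in> P (int j)"
      thus "avg_upto N M (\<lambda>y. h (x + y)) = h x"
        using h by (intro avg_upto_const[OF that]) (simp add: invar_def)
    qed
    finally show ?thesis .
  qed
  hence "\<forall>\<^sub>F M in sequentially. avg_upto j M h = avg_upto j N h"
    unfolding eventually_sequentially by (intro exI[of _ N] allI impI)
  hence "(\<lambda>M. avg_upto j M h) \<longlonglongrightarrow> avg_upto j N h" by (rule tendsto_eventually)
  thus ?thesis unfolding avg_def by (rule limI)
qed

definition locconst :: "nat \<Rightarrow> ('f \<Rightarrow> 'c) \<Rightarrow> bool" where
  "locconst j h \<longleftrightarrow> (\<exists>N. invar j N h)"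

lemma locconst_common:
  assumes "locconst j h" "locconst i g"
  obtains N where "K \<le> N" "invar j N h" "invar i N g"
proof -
  obtain N1 N2 where "invar j N1 h" "invar i N2 g" using assms by (auto simp: locconst_def)
  hence "invar j (max K (max N1 N2)) h" "invar i (max K (max N1 N2)) g"
    using invar_mono[of j N1 h "max K (max N1 N2)"] invar_mono[of i N2 g "max K (max N1 N2)"] by simp_all
  thus ?thesis using that[of "max K (max N1 N2)"] by simp
qed

lemma locconst_level: assumes "locconst j h" obtains N where "K \<le> N" "invar j N h"
  using locconst_common[OF assms assms] by blast

lemma avg_const: "(\<And>x. x \<in> P (int j) \<Longrightarrow> h x = c) \<Longrightarrow> avg j h = c"
proof -
  assume h: "\<And>x. x \<in> P (int j) \<Longrightarrow> h x = c"
  have "invar j j h" unfolding invar_def using h P_add by metis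
  hence "avg j h = avg_upto j j h" by (rule avg_eq) simp
  also have "\<dots> = c" by (rule avg_upto_const[OF order_refl h])
  finally show ?thesis .
qed

lemma avg_cong:
  assumes "\<And>x. x \<in> P (int j) \<Longrightarrow> h x = g x" shows "avg j h = avg j g"
proof -
  have "\<forall>\<^sub>F N in sequentially. avg_upto j N h = avg_upto j N g"
    unfolding eventually_sequentially using avg_upto_cong[OF _ assms] by (intro exI[of _ j] allI impI)
  hence "(\<lambda>N. avg_upto j N h) \<longlonglongrightarrow> L \<longleftrightarrow> (\<lambda>N. avg_upto j N g) \<longlonglongrightarrow> L" for L
    by (rule tendsto_cong)
  thus ?thesis by (simp add: avg_def lim_def)
qed

lemma avg_linear:
  assumes "locconst j h" "locconst j g"
  shows "avg j (\<lambda>x. c * h x + g x) = c * avg j h + avg j g"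
proof -
  obtain N where N: "j \<le> N" "invar j N h" "invar j N g" using locconst_common[OF assms] by blast
  hence "invar j N (\<lambda>x. c * h x + g x)" by (simp add: invar_def)
  thus ?thesis using N
    by (simp add: avg_eq[of j N] avg_upto_def sum.distrib add_divide_distrib flip: sum_distrib_left)
qed

lemma avg_mult_left: "locconst j h \<Longrightarrow> avg j (\<lambda>x. c * h x) = c * avg j h"
proof -
  assume h: "locconst j h"
  have "locconst j (\<lambda>_. 0::complex)" by (simp add: locconst_def invar_def)
  from avg_linear[OF h this, of c] show ?thesis by (simp add: avg_const[of j "\<lambda>_. 0" 0])
qed

lemma avg_diff: "locconst j h \<Longrightarrow> locconst j g \<Longrightarrow> avg j (\<lambda>x. h x - g x) = avg j h - avg j g"
  using avg_linear[of j g h "-1"] by simp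

text \<open>An isometry of p^j permutes the cosets of p^N for every N. All later changes of
  variable, namely translations, unit scalings and a Moebius map, are instances.\<close>

lemma avg_isometry:
  assumes h: "locconst j h" and maps: "\<And>x. x \<in> P (int j) \<Longrightarrow> s x \<in> P (int j)"
    and iso: "\<And>x y n. x \<in> P (int j) \<Longrightarrow> y \<in> P (int j) \<Longrightarrow> s x - s y \<in> P n \<longleftrightarrow> x - y \<in> P n"
  shows "avg j (\<lambda>x. h (s x)) = avg j h"
proof -
  obtain N where N: "j \<le> N" "invar j N h" using locconst_level[OF h] by blast
  have hs: "invar j N (\<lambda>x. h (s x))"
    unfolding invar_def
  proof (intro ballI)
    fix x y assume xy: "x \<in> P (int j)" "y \<in> P (int N)"
    have xy': "x + y \<in> P (int j)" using xy N P_mono[of y "int N" "int j"] by (intro P_add) auto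
    show "h (s (x + y)) = h (s x)"
      using xy xy' by (intro invarD[OF N(2)] maps) (simp_all add: iso)
  qed
  let ?T = "reps j N"
  note T = transversal_reps[OF N(1)]
  have inj: "inj_on s ?T"
    using iso[of _ _ "int N"] T unfolding transversal_def inj_on_def by (metis P_zero diff_self subset_iff)
  define r where "r = (\<lambda>x. SOME b. b \<in> ?T \<and> s x - b \<in> P (int N))"
  have r: "r x \<in> ?T \<and> s x - r x \<in> P (int N)" if "x \<in> P (int j)" for x
    unfolding r_def by (rule someI_ex) (use maps[OF that] T in \<open>auto simp: transversal_def\<close>)
  have TP: "x \<in> ?T \<Longrightarrow> x \<in> P (int j)" for x using reps_P N by blast
  have rinj: "inj_on r ?T"
  proof (rule inj_onI)
    fix x y assume xy: "x \<in> ?T" "y \<in> ?T" "r x = r y"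
    have "(s x - r x) - (s y - r y) \<in> P (int N)" using r[OF TP] xy P_diff by blast
    hence "x - y \<in> P (int N)" using xy iso[of x y "int N"] TP by simp
    thus "x = y" using T xy by (auto simp: transversal_def)
  qed
  \<comment> \<open>Surjectivity comes from finiteness: an injective self-map of the finite set of
    representatives is onto.\<close>
  have rT: "r ` ?T = ?T"
    using r TP rinj finite_reps[OF N(1)] by (intro endo_inj_surj) auto
  have "sum (\<lambda>x. h (s x)) ?T = sum (\<lambda>x. h (r x)) ?T"
  proof (rule sum.cong)
    fix x assume "x \<in> ?T"
    thus "h (s x) = h (r x)" using r[of x] TP by (intro invarD[OF N(2)]) auto
  qed simp
  also have "\<dots> = sum h (r ` ?T)" using rinj by (simp add: sum.reindex)
  finally have "sum (\<lambda>x. h (s x)) ?T = sum h ?T" by (simp add: rT)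
  thus ?thesis using N hs by (simp add: avg_eq[of j N] avg_upto_def)
qed

lemma avg_translate:
  assumes "locconst j h" "a \<in> P (int j)" shows "avg j (\<lambda>x. h (x + a)) = avg j h"
  using assms by (intro avg_isometry[where s = "\<lambda>x. x + a"]) (simp_all add: P_add)

lemma avg_scale:
  assumes "locconst j h" "unit u" shows "avg j (\<lambda>x. h (x * u)) = avg j h"
  using assms
  by (intro avg_isometry[where s = "\<lambda>x. x * u"]) (simp_all add: P_unit_mult_right flip: left_diff_distrib)

lemma locconst_shift:
  assumes h: "locconst j h" and "j \<le> i" and "x \<in> P (int j)"
  shows "locconst i (\<lambda>y. h (x + y))"
proof -
  obtain N where N: "invar j N h" using h by (auto simp: locconst_def)
  have "invar i N (\<lambda>y. h (x + y))" unfolding invar_def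
  proof (intro ballI)
    fix y z assume y: "y \<in> P (int i)" and z: "z \<in> P (int N)"
    have "x + y \<in> P (int j)" using assms y by (auto intro!: P_add P_mono[OF y])
    thus "h (x + (y + z)) = h (x + y)" using N z by (simp add: invar_def flip: add.assoc)
  qed
  thus ?thesis by (auto simp: locconst_def)
qed

text \<open>Integration in stages along p^i inside p^j. The first form isolates an oscillating inner
  average, the second reduces the outer one to a finite sum.\<close>

lemma avg_split:
  assumes h: "locconst j h" and ji: "j \<le> i"
  shows "avg j h = avg j (\<lambda>x. avg i (\<lambda>y. h (x + y)))"
    and "avg j h = avg_upto j i (\<lambda>x. avg i (\<lambda>y. h (x + y)))"
proof -
  obtain N where N: "i \<le> N" "invar j N h" using locconst_level[OF h] by blast
  have inv: "invar i N (\<lambda>y. h (x + y))" if "x \<in> P (int j)" for x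
    unfolding invar_def
  proof (intro ballI)
    fix y z assume y: "y \<in> P (int i)" and z: "z \<in> P (int N)"
    have "x + y \<in> P (int j)" using ji that by (auto intro!: P_add P_mono[OF y])
    thus "h (x + (y + z)) = h (x + y)" using N z by (simp add: invar_def flip: add.assoc)
  qed
  have 1: "avg j h = avg_upto j N h" using N ji by (intro avg_eq) auto
  also have "\<dots> = avg_upto j i (\<lambda>x. avg_upto i N (\<lambda>y. h (x + y)))" using N ji by (intro avg_upto_split) auto
  also have "\<dots> = avg_upto j i (\<lambda>x. avg i (\<lambda>y. h (x + y)))"
    using N inv by (intro avg_upto_cong[OF ji]) (simp add: avg_eq[of i N])
  finally show 2: "avg j h = avg_upto j i (\<lambda>x. avg i (\<lambda>y. h (x + y)))" .
  have "invar j i (\<lambda>x. avg i (\<lambda>y. h (x + y)))" unfolding invar_def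
  proof (intro ballI)
    fix x z assume xz: "x \<in> P (int j)" "z \<in> P (int i)"
    have "avg i (\<lambda>y. h (x + (y + z))) = avg i (\<lambda>y. h (x + y))"
      by (rule avg_translate[of i "\<lambda>y. h (x + y)"]) (use xz inv in \<open>auto simp: locconst_def\<close>)
    thus "avg i (\<lambda>y. h (x + z + y)) = avg i (\<lambda>y. h (x + y))" by (simp add: algebra_simps)
  qed
  thus "avg j h = avg j (\<lambda>x. avg i (\<lambda>y. h (x + y)))" using 2 ji by (simp add: avg_eq[of j i])
qed

lemma avg_swap:
  assumes "\<And>y. y \<in> P (int j) \<Longrightarrow> invar i N (\<lambda>x. H x y)" "\<And>x. x \<in> P (int i) \<Longrightarrow> invar j N (\<lambda>y. H x y)"
  shows "avg i (\<lambda>x. avg j (\<lambda>y. H x y)) = avg j (\<lambda>y. avg i (\<lambda>x. H x y))"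
proof -
  \<comment> \<open>At one common level both averages are finite sums over fixed representatives, so
    exchanging them is exchanging finite sums.\<close>
  define M where "M = max N (max i j)"
  have M: "i \<le> M" "j \<le> M" "N \<le> M" by (auto simp: M_def)
  have I: "\<And>y. y \<in> P (int j) \<Longrightarrow> invar i M (\<lambda>x. H x y)" and J: "\<And>x. x \<in> P (int i) \<Longrightarrow> invar j M (\<lambda>y. H x y)"
    using assms M(3) invar_mono by blast+
  have 1: "avg i (\<lambda>x. avg j (H x)) = avg_upto i M (\<lambda>x. avg_upto j M (\<lambda>y. H x y))"
  proof -
    have "avg i (\<lambda>x. avg j (H x)) = avg i (\<lambda>x. avg_upto j M (\<lambda>y. H x y))"
      using J M by (intro avg_cong avg_eq) auto
    also have "invar i M (\<lambda>x. avg_upto j M (\<lambda>y. H x y))"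
      using I M(2) by (auto simp: invar_def intro!: avg_upto_cong)
    hence "avg i (\<lambda>x. avg_upto j M (\<lambda>y. H x y)) = avg_upto i M (\<lambda>x. avg_upto j M (\<lambda>y. H x y))"
      using M by (intro avg_eq) auto
    finally show ?thesis .
  qed
  have 2: "avg j (\<lambda>y. avg i (\<lambda>x. H x y)) = avg_upto j M (\<lambda>y. avg_upto i M (\<lambda>x. H x y))"
  proof -
    have "avg j (\<lambda>y. avg i (\<lambda>x. H x y)) = avg j (\<lambda>y. avg_upto i M (\<lambda>x. H x y))"
      using I M by (intro avg_cong avg_eq) auto
    also have "invar j M (\<lambda>y. avg_upto i M (\<lambda>x. H x y))"
      using J M(1) by (auto simp: invar_def intro!: avg_upto_cong)
    hence "avg j (\<lambda>y. avg_upto i M (\<lambda>x. H x y)) = avg_upto j M (\<lambda>y. avg_upto i M (\<lambda>x. H x y))"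
      using M by (intro avg_eq) auto
    finally show ?thesis .
  qed
  show ?thesis unfolding 1 2 avg_upto_def
    by (simp add: sum_divide_distrib[symmetric] mult.commute) (subst sum.swap, simp)
qed

text \<open>The factor is the index of p^i in p^j: the two averages are normalized on different
  ideals.\<close>

lemma avg_restrict:
  assumes h: "locconst i h" and ji: "j \<le> i"
  shows "locconst j (\<lambda>x. if x \<in> P (int i) then h x else 0)"
    and "of_nat (q ^ (i - j)) * avg j (\<lambda>x. if x \<in> P (int i) then h x else 0) = avg i h"
proof -
  obtain N where N: "i \<le> N" "invar i N h" using locconst_level[OF h] by blast
  let ?g = "\<lambda>x. if x \<in> P (int i) then h x else 0"
  have "invar j N ?g" unfolding invar_def
  proof (intro ballI)
    fix x y assume "x \<in> P (int j)" "y \<in> P (int N)"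
    moreover from this have "y \<in> P (int i)" using N by (auto intro: P_mono)
    ultimately show "?g (x + y) = ?g x" using N by (simp add: P_add_iff invar_def)
  qed
  thus lc: "locconst j ?g" by (auto simp: locconst_def)
  \<comment> \<open>The representative of the zero coset, the only coset on which the restricted
    function can be nonzero.\<close>
  obtain t where t: "t \<in> reps j i" "0 - t \<in> P (int i)"
    using transversal_reps[OF ji] P_zero[of "int j"] unfolding transversal_def by blast
  hence tP: "t \<in> P (int i)" by simp
  have inner: "avg i (\<lambda>y. ?g (x + y)) = (if x = t then avg i h else 0)" if x: "x \<in> reps j i" for x
  proof (cases "x = t")
    case True
    have "avg i (\<lambda>y. ?g (x + y)) = avg i (\<lambda>y. h (y + t))"
      using tP True by (intro avg_cong) (simp add: P_add add.commute)
    thus ?thesis using True avg_translate[OF h tP] by simp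
  next
    case False
    have "x \<notin> P (int i)"
    proof
      assume "x \<in> P (int i)"
      hence "x - t \<in> P (int i)" using tP by (intro P_diff)
      thus False using False x t transversal_reps[OF ji] unfolding transversal_def by blast
    qed
    hence "avg i (\<lambda>y. ?g (x + y)) = 0" by (intro avg_const) (simp add: P_add_iff)
    thus ?thesis using False by simp
  qed
  have "avg j ?g = avg_upto j i (\<lambda>x. if x = t then avg i h else 0)"
    unfolding avg_split(2)[OF lc ji] avg_upto_def using inner by (simp cong: sum.cong)
  also have "\<dots> = avg i h / of_nat (q ^ (i - j))"
    using t finite_reps[OF ji] by (simp add: avg_upto_def)
  finally show "of_nat (q ^ (i - j)) * avg j ?g = avg i h" using q_pos by simp
qed

section \<open>The additive character\<close>

lemma psi_add: "psi' (x + y) = psi' x * psi' y" and psi_nz [simp]: "psi' x \<noteq> 0"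
  and psi_P: "x \<in> P 1 \<Longrightarrow> psi' x = 1"
  using psi_cond by (auto simp: additive_char_cond_def)

lemma psi_0 [simp]: "psi' 0 = 1" using psi_P by simp

lemma psi_nontriv: obtains x where "x \<in> P 0" "psi' x \<noteq> 1"
  using psi_cond by (auto simp: additive_char_cond_def)

lemma psi_cong: assumes "x - y \<in> P 1" shows "psi' x = psi' y"
  using psi_add[of "x - y" y] psi_P[OF assms] by simp

lemma psi_level: "\<exists>N\<ge>K. \<forall>x\<in>P (int N). b * x \<in> P 1"
proof (cases "b = 0")
  case False
  define N where "N = max K (nat (1 - v b))"
  have "b * x \<in> P 1" if "x \<in> P (int N)" for x
    using that False by (intro P_mult'[of b "v b" x "int N"]) (auto simp: pF_def N_def)
  thus ?thesis by (intro exI[of _ N]) (auto simp: N_def)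
qed auto

lemma locconst_psi: "locconst j (\<lambda>x. psi' (b * x))"
proof -
  obtain N where "\<forall>x\<in>P (int N). b * x \<in> P 1" using psi_level by blast
  hence "invar j N (\<lambda>x. psi' (b * x))" by (auto simp: invar_def distrib_left psi_add psi_P)
  thus ?thesis by (auto simp: locconst_def)
qed

text \<open>Orthogonality of characters. If \<open>b\<close> is not in p^(1 - j), then b p^j
  contains O_F, so some translation in p^j multiplies the average by a value of \<open>psi'\<close>
  different from 1.\<close>

lemma avg_psi: "avg j (\<lambda>x. psi' (b * x)) = (if b \<in> P (1 - int j) then 1 else 0)"
proof (cases "b \<in> P (1 - int j)")
  case True
  hence "psi' (b * x) = 1" if "x \<in> P (int j)" for x
    using that by (intro psi_P P_mult'[of b "1 - int j" x "int j"]) auto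
  thus ?thesis using True avg_const[of j _ 1] by simp
next
  case False
  hence b: "b \<noteq> 0" "v b \<le> - int j" by (auto simp: pF_def)
  obtain x where x: "x \<in> P 0" "psi' x \<noteq> 1" by (rule psi_nontriv)
  have "inverse b \<in> P (int j)" using b by (simp add: pF_def v_inverse)
  hence xb: "x * inverse b \<in> P (int j)" using x by (intro P_multl)
  have "avg j (\<lambda>y. psi' (b * y)) = avg j (\<lambda>y. psi' (b * (y + x * inverse b)))"
    by (rule avg_translate[symmetric, OF locconst_psi xb])
  also have "\<dots> = avg j (\<lambda>y. psi' x * psi' (b * y))"
    using b by (simp add: distrib_left psi_add mult.left_commute[of b] mult.commute[of _ "psi' x"])
  also have "\<dots> = psi' x * avg j (\<lambda>y. psi' (b * y))" by (rule avg_mult_left[OF locconst_psi])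
  finally have "avg j (\<lambda>y. psi' (b * y)) = 0" using x by simp
  thus ?thesis using False by simp
qed

lemma locconst_mult:
  fixes h g :: "'f \<Rightarrow> complex"
  shows "locconst j h \<Longrightarrow> locconst j g \<Longrightarrow> locconst j (\<lambda>x. h x * g x)"
proof -
  assume "locconst j h" "locconst j g"
  then obtain N where "invar j N h" "invar j N g" by (rule locconst_common[of j h j g 0])
  hence "invar j N (\<lambda>x. h x * g x)" by (simp add: invar_def)
  thus ?thesis by (auto simp: locconst_def)
qed


section \<open>Surjectivity of the norm on units\<close>

text \<open>A quadratic map is at most two-to-one modulo \<open>\<pp>\<close>, and one-to-one over its value at 0. Hence the
  values of \<open>x\<^sup>2\<close> and of \<open>u + \<epsilon> y\<^sup>2\<close> overlap, which makes \<open>u\<close> a norm modulo \<open>\<pp>\<close>.\<close>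

lemma card_quadratic_values:
  assumes b: "b \<in> P 0" and e: "unit e" and T: "transversal 0 1 T"
    and g: "\<And>x. x \<in> T \<Longrightarrow> g x \<in> T \<and> b + e * (x * x) - g x \<in> P 1"
  shows "card T + 1 \<le> 2 * card (g ` T)"
proof -
  have fin: "finite T" and TP: "\<And>x. x \<in> T \<Longrightarrow> x \<in> P 0" using T by (auto simp: transversal_def)
  have Teq: "x = y" if "x \<in> T" "y \<in> T" "x - y \<in> P 1" for x y using T that by (auto simp: transversal_def)
  have geq: "x - y \<in> P 1 \<or> x + y \<in> P 1" if "x \<in> T" "y \<in> T" "g x = g y" for x y
  proof -
    have "(b + e * (x * x) - g x) - (b + e * (y * y) - g y) \<in> P 1" using g[OF that(1)] g[OF that(2)] by (blast intro: P_diff)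
    hence "e * ((x - y) * (x + y)) \<in> P 1" using that by (simp add: algebra_simps)
    hence 1: "(x - y) * (x + y) \<in> P 1" using P_unit_mult[OF e] by simp
    show ?thesis
    proof (rule ccontr)
      assume "\<not> ?thesis"
      hence "unit (x - y)" "unit (x + y)" using that TP P_add P_diff by (auto simp: unit_iff)
      hence "unit ((x - y) * (x + y))" by simp
      with 1 show False by (simp add: unit_iff)
    qed
  qed
  have "0 \<in> P (int 0)" by simp
  \<comment> \<open>\<open>t\<close> represents the zero class, the only class fixed by negation, so
    its fibre is a single point; this produces the extra 1 in the bound.\<close>
  then obtain t where t: "t \<in> T" "0 - t \<in> P 1" using T unfolding transversal_def by fastforce
  have fib2: "card {x \<in> T. g x = s} \<le> 2" for s
  proof (cases "\<exists>x\<in>T. g x = s")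
    case True
    then obtain x where x: "x \<in> T" "g x = s" by blast
    have "\<exists>y\<in>T. - x - y \<in> P 1" using T TP[OF x(1)] unfolding transversal_def by simp
    then obtain y where y: "y \<in> T" "- x - y \<in> P 1" by blast
    have "{x \<in> T. g x = s} \<subseteq> {x, y}"
    proof
      fix z assume z: "z \<in> {x \<in> T. g x = s}"
      hence "z - x \<in> P 1 \<or> z + x \<in> P 1" using geq[of z x] x by simp
      thus "z \<in> {x, y}"
      proof
        assume "z - x \<in> P 1" thus ?thesis using Teq[of z x] z x by simp
      next
        assume "z + x \<in> P 1"
        hence "(z + x) + (- x - y) \<in> P 1" using y by (blast intro: P_add)
        thus ?thesis using Teq[of z y] z y by simp
      qed
    qed
    hence "card {x \<in> T. g x = s} \<le> card {x, y}" by (intro card_mono) auto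
    also have "\<dots> \<le> 2" by (simp add: card_insert_if)
    finally show ?thesis .
  next
    case False
    hence e: "{x \<in> T. g x = s} = {}" by blast
    show ?thesis unfolding e by simp
  qed
  have fibt: "{x \<in> T. g x = g t} = {t}"
  proof -
    have "x = t" if "x \<in> T" "g x = g t" for x
    proof -
      have "x - t \<in> P 1 \<or> x + t \<in> P 1" using geq that t by simp
      hence "x - t \<in> P 1" using t P_diff_iff[of t 1 x] P_add_iff[of t 1 x] by auto
      thus ?thesis using Teq that t by simp
    qed
    thus ?thesis using t by auto
  qed
  have "card T = (\<Sum>s\<in>g ` T. card {x \<in> T. g x = s})"
    using sum.group[OF fin finite_imageI[OF fin], of g g "\<lambda>_. 1::nat"] by simp
  also have "\<dots> = 1 + (\<Sum>s\<in>g ` T - {g t}. card {x \<in> T. g x = s})"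
    using t fin fibt by (subst sum.remove[of _ "g t"]) auto
  also have "(\<Sum>s\<in>g ` T - {g t}. card {x \<in> T. g x = s}) \<le> (\<Sum>s\<in>g ` T - {g t}. 2)"
    by (intro sum_mono fib2)
  also have "\<dots> = 2 * (card (g ` T) - 1)" using t by simp
  finally have "card T \<le> 1 + 2 * (card (g ` T) - 1)" by simp
  moreover have "card (g ` T) > 0" using t fin by (auto simp: card_gt_0_iff)
  ultimately show ?thesis by linarith
qed

text \<open>Counting only makes \<open>u\<close> a norm modulo p. The remaining quotient lies in 1 +
  p, hence is a square in F, and rescaling by its root corrects the norm exactly.\<close>

lemma norm_surj: assumes u: "unit u" obtains a where "a \<in> unitsE v eps" "enorm eps a = u"
proof -
  obtain T where T: "transversal 0 1 T" using transversal_residue by blast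
  have fin: "finite T" and TP: "\<And>x. x \<in> T \<Longrightarrow> x \<in> P 0" using T by (auto simp: transversal_def)
  have "\<exists>g. \<forall>x\<in>T. g x \<in> T \<and> b + e * (x * x) - g x \<in> P 1" if "b \<in> P 0" "e \<in> P 0" for b e
  proof -
    have "\<exists>y\<in>T. b + e * (x * x) - y \<in> P 1" if x: "x \<in> T" for x
    proof -
      have "b + e * (x * x) \<in> P 0" using TP[OF x] that \<open>b \<in> P 0\<close> \<open>e \<in> P 0\<close> by (auto intro!: P_add P_multl)
      thus ?thesis using T unfolding transversal_def by simp
    qed
    thus ?thesis by metis
  qed
  note ex = this
  obtain g where g: "\<forall>x\<in>T. g x \<in> T \<and> 0 + 1 * (x * x) - g x \<in> P 1" using ex[of 0 1] by auto
  obtain h where h: "\<forall>x\<in>T. h x \<in> T \<and> u + eps * (x * x) - h x \<in> P 1" using ex[of u eps] u by auto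
  \<comment> \<open>Both images fill more than half of \<open>T\<close>, so they cannot be
    disjoint.\<close>
  have "g ` T \<inter> h ` T \<noteq> {}"
  proof
    assume *: "g ` T \<inter> h ` T = {}"
    have "card (g ` T \<union> h ` T) = card (g ` T) + card (h ` T)"
      using fin * by (intro card_Un_disjoint) auto
    moreover have "card (g ` T \<union> h ` T) \<le> card T" using g h fin by (intro card_mono) auto
    moreover have "card T + 1 \<le> 2 * card (g ` T)"
      using g by (intro card_quadratic_values[OF _ _ T, of 0 1 g]) auto
    moreover have "card T + 1 \<le> 2 * card (h ` T)"
      using h u by (intro card_quadratic_values[OF _ _ T, of u eps h]) auto
    ultimately show False by linarith
  qed
  then obtain x y where xy: "x \<in> T" "y \<in> T" "g x = h y" by blast
  have "(0 + 1 * (x * x) - g x) - (u + eps * (y * y) - h y) \<in> P 1" by (rule P_diff) (use g h xy in auto)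
  hence 1: "enorm eps (x, y) - u \<in> P 1" using xy by (simp add: enorm_def power2_eq_square algebra_simps)
  hence un: "unit (enorm eps (x, y))" using unit_cong[OF u, of "enorm eps (x, y)"] P_diff_commute by blast
  have "u / enorm eps (x, y) - 1 = (u - enorm eps (x, y)) / enorm eps (x, y)" using un by (simp add: diff_divide_distrib)
  hence "u / enorm eps (x, y) - 1 \<in> P 1" using 1 un by (simp add: P_unit_divide P_diff_commute)
  then obtain s where s: "s * s = u / enorm eps (x, y)" using sqrt_one_plus by blast
  have "enorm eps (s * x, s * y) = (s * s) * enorm eps (x, y)" by (simp add: enorm_def power2_eq_square algebra_simps)
  hence N: "enorm eps (s * x, s * y) = u" using un s by simp
  moreover have "(s * x, s * y) \<in> unitsE v eps"
    using v_norm_ge[of "s * x" "s * y" 0] v_norm_ge[of "s * x" "s * y" 1] u N P_mono[of u 2 1]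
    by (auto simp: unitsE_def pE_iff unit_iff)
  ultimately show ?thesis using that by blast
qed


section \<open>The group\<close>

abbreviation mm (infixl "\<cdot>" 70) where "g \<cdot> h \<equiv> mmul eps g h"
abbreviation OE :: "int \<Rightarrow> 'f ext set" where "OE n \<equiv> pE v eps n"
abbreviation UE :: "'f ext set" where "UE \<equiv> unitsE v eps"
abbreviation em (infixl "\<odot>" 70) where "x \<odot> y \<equiv> emul eps x y"
abbreviation N :: "'f ext \<Rightarrow> 'f" where "N \<equiv> enorm eps"
abbreviation tt where "tt \<equiv> tmat eps"

definition nb :: "'f \<Rightarrow> 'f mat2" where "nb c = mk (1, 0) (0, 0) (0, c) (1, 0)"
definition ub :: "'f \<Rightarrow> 'f mat2" where "ub x = mk (1, 0) (0, x) (0, 0) (1, 0)"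
text \<open>The adjoint for the Hermitian form \<open>mw\<close>. It is the inverse on G, and its
  entries require no division.\<close>

definition minv :: "'f mat2 \<Rightarrow> 'f mat2" where
  "minv g = mk (econj (m22 g)) (econj (m12 g)) (econj (m21 g)) (econj (m11 g))"

lemmas ext_defs = eadd_def esub_def emul_def econj_def

lemma mk_simps [simp]: "m11 (mk a b c d) = a" "m12 (mk a b c d) = b" "m21 (mk a b c d) = c" "m22 (mk a b c d) = d"
  by (simp_all add: mk_def)

lemma mat_eq_iff: "g = h \<longleftrightarrow> m11 g = m11 h \<and> m12 g = m12 h \<and> m21 g = m21 h \<and> m22 g = m22 h"
  for g h :: "'a mat2"
  by (cases g; cases h) auto

lemma mk_entries: "mk (m11 g) (m12 g) (m21 g) (m22 g) = g"
  by (simp add: mat_eq_iff)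

lemma emul_commute: "x \<odot> y = y \<odot> x" and emul_assoc: "x \<odot> y \<odot> z = x \<odot> (y \<odot> z)"
  and emul_one [simp]: "x \<odot> (1, 0) = x" "(1, 0) \<odot> x = x"
  and emul_zero [simp]: "x \<odot> (0, 0) = (0, 0)" "(0, 0) \<odot> x = (0, 0)"
  by (simp_all add: ext_defs algebra_simps)

lemma eadd_zero [simp]: "eadd x (0, 0) = x" "eadd (0, 0) x = x" and esub_zero [simp]: "esub x (0, 0) = x"
  by (simp_all add: ext_defs)

lemma econj_simps [simp]: "econj (econj x) = x" "econj (1, 0) = (1, 0)" "econj (0, 0) = (0, 0)"
  "econj (x \<odot> y) = econj x \<odot> econj y"
  by (simp_all add: ext_defs algebra_simps)

lemma N_mult: "N (x \<odot> y) = N x * N y"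
  by (simp add: enorm_def emul_def power2_eq_square algebra_simps)

lemma N_simps [simp]: "N (econj x) = N x" "N (1, 0) = 1" "N (0, 0) = 0"
  by (simp_all add: enorm_def econj_def)

lemma N_nz [simp]: "N x = 0 \<longleftrightarrow> x = (0, 0)" by (rule enorm_eq_0_iff)

lemma emul_eq_zero: "x \<odot> y = (0, 0) \<longleftrightarrow> x = (0, 0) \<or> y = (0, 0)"
  using N_mult[of x y] N_nz by (metis mult_eq_0_iff)

lemma emul_inv: assumes "x \<noteq> (0, 0)" shows "x \<odot> einv eps x = (1, 0)" "einv eps x \<odot> x = (1, 0)"
proof -
  have n: "N x \<noteq> 0" using assms by simp
  have "fst x * fst x - eps * (snd x * snd x) = N x" by (simp add: enorm_def power2_eq_square)
  thus "x \<odot> einv eps x = (1, 0)"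
    using n by (simp add: einv_def emul_def mult.commute[of "snd x" "fst x"] mult.assoc flip: diff_divide_distrib)
  thus "einv eps x \<odot> x = (1, 0)" by (simp add: emul_commute)
qed

lemma einv_unique: assumes "x \<odot> y = (1, 0)" shows "y = einv eps x"
proof -
  have x: "x \<noteq> (0, 0)" using assms by auto
  have "y = (einv eps x \<odot> x) \<odot> y" using emul_inv[OF x] by simp
  also have "\<dots> = einv eps x" unfolding emul_assoc assms by simp
  finally show ?thesis .
qed

lemma einv_mult: "x \<noteq> (0, 0) \<Longrightarrow> y \<noteq> (0, 0) \<Longrightarrow> einv eps (x \<odot> y) = einv eps x \<odot> einv eps y"
  by (rule einv_unique[symmetric]) (metis emul_assoc emul_commute emul_inv(1) emul_one(1))

lemma einv_nz [simp]: "x \<noteq> (0, 0) \<Longrightarrow> einv eps x \<noteq> (0, 0)"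
  using emul_inv(1)[of x] by auto

lemma einv_einv [simp]: "x \<noteq> (0, 0) \<Longrightarrow> einv eps (einv eps x) = x"
  by (rule einv_unique[symmetric]) (simp add: emul_inv)

lemma econj_nz [simp]: "econj x = (0, 0) \<longleftrightarrow> x = (0, 0)"
  by (cases x) (simp add: econj_def)

lemma econj_einv: "econj (einv eps x) = einv eps (econj x)"
  by (simp add: econj_def einv_def enorm_def)

lemma einv_one [simp]: "einv eps (1, 0) = (1, 0)" by (simp add: einv_def enorm_def)

lemma N_inv: "x \<noteq> (0, 0) \<Longrightarrow> N (einv eps x) = 1 / N x"
  using N_mult[of x "einv eps x"] emul_inv[of x] by (simp add: field_simps)

lemma einv_econj: "einv eps (econj a) = (fst a / N a, snd a / N a)"
  by (simp add: einv_def econj_def enorm_def)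

lemma OE_norm: "z \<in> OE n \<longleftrightarrow> N z \<in> P (2 * n)"
  using v_norm_ge[of "fst z" "snd z" n] by (simp add: pE_iff)

lemma UE_norm: "z \<in> UE \<longleftrightarrow> unit (N z)"
proof
  assume "z \<in> UE"
  thus "unit (N z)" using norm_unit[of "fst z" "snd z"]
    by (auto simp: unitsE_def pE_iff enorm_def power2_eq_square)
next
  assume "unit (N z)"
  thus "z \<in> UE" using P_mono[of "N z" 2 1] by (auto simp: unitsE_def OE_norm unit_iff)
qed

lemma UE_nz: "z \<in> UE \<Longrightarrow> z \<noteq> (0, 0)" by (auto simp: unitsE_def pE_iff)

lemma OE_one [simp]: "(1, 0) \<in> OE n \<longleftrightarrow> n \<le> 0" by (simp add: pE_iff)
lemma OE_add: "x \<in> OE n \<Longrightarrow> y \<in> OE n \<Longrightarrow> eadd x y \<in> OE n" by (simp add: pE_iff eadd_def P_add)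
lemma OE_sub: "x \<in> OE n \<Longrightarrow> y \<in> OE n \<Longrightarrow> esub x y \<in> OE n" by (simp add: pE_iff esub_def P_diff)
lemma OE_conj [simp]: "econj x \<in> OE n \<longleftrightarrow> x \<in> OE n" by (simp add: pE_iff econj_def)
lemma OE_mult: "x \<in> OE m \<Longrightarrow> y \<in> OE n \<Longrightarrow> x \<odot> y \<in> OE (m + n)"
  using P_mult[of "N x" "2 * m" "N y" "2 * n"] by (simp add: OE_norm N_mult algebra_simps)
lemma OE_multl: "x \<in> OE 0 \<Longrightarrow> y \<in> OE n \<Longrightarrow> x \<odot> y \<in> OE n" using OE_mult[of x 0 y n] by simp
lemma OE_multr: "x \<in> OE n \<Longrightarrow> y \<in> OE 0 \<Longrightarrow> x \<odot> y \<in> OE n" using OE_mult[of x n y 0] by simp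
lemma OE_mono: "x \<in> OE m \<Longrightarrow> n \<le> m \<Longrightarrow> x \<in> OE n" using P_mono[of _ m n] by (simp add: pE_iff)
lemma OE_unit_mult: "u \<in> UE \<Longrightarrow> u \<odot> x \<in> OE n \<longleftrightarrow> x \<in> OE n"
  by (simp add: OE_norm UE_norm N_mult P_unit_mult)
lemma OE_sub_commute: "esub x y \<in> OE n \<longleftrightarrow> esub y x \<in> OE n"
  by (simp add: pE_iff esub_def P_diff_commute)

lemma UE_mult [simp]: "x \<in> UE \<Longrightarrow> y \<in> UE \<Longrightarrow> x \<odot> y \<in> UE" by (simp add: UE_norm N_mult)
lemma UE_one [simp]: "(1, 0) \<in> UE" by (simp add: UE_norm)
lemma UE_conj [simp]: "econj x \<in> UE \<longleftrightarrow> x \<in> UE" by (simp add: UE_norm)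
lemma UE_inv [simp]: "x \<in> UE \<Longrightarrow> einv eps x \<in> UE"
  using UE_nz[of x] by (simp add: UE_norm N_inv)
lemma UE_OE: "x \<in> UE \<Longrightarrow> x \<in> OE 0" by (simp add: unitsE_def)
lemma UE_near_one: "esub a (1, 0) \<in> OE n \<Longrightarrow> n \<ge> 1 \<Longrightarrow> a \<in> UE"
  unfolding UE_norm
proof -
  assume a: "esub a (1, 0) \<in> OE n" "n \<ge> 1"
  have s: "snd a \<in> P 1" and f: "fst a - 1 \<in> P 1"
    using a P_mono[of _ n 1] by (auto simp: pE_iff esub_def)
  have "fst a \<in> P 0" using unit_one_plus[OF f] by simp
  moreover have "fst a \<notin> P 1" using unit_one_plus[OF f] by (simp add: unit_iff)
  ultimately have "unit (fst a * fst a - eps * (snd a * snd a))"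
    using P_mono[OF s, of 0] by (intro norm_unit) auto
  thus "unit (N a)" by (simp add: enorm_def power2_eq_square)
qed

lemma mm_assoc: "(g \<cdot> h) \<cdot> k = g \<cdot> (h \<cdot> k)"
  by (simp add: mat_eq_iff mmul_def ext_defs algebra_simps)

lemma mI_mult [simp]: "mI \<cdot> g = g" "g \<cdot> mI = g"
  by (simp_all add: mat_eq_iff mmul_def mI_def)

lemma mw_mw [simp]: "mw \<cdot> mw = mI" "mw \<cdot> (mw \<cdot> g) = g"
  by (simp_all add: mat_eq_iff mmul_def mI_def mw_def)

lemma mconjT_mult: "mconjT (g \<cdot> h) = mconjT h \<cdot> mconjT g"
  by (simp add: mat_eq_iff mmul_def mconjT_def ext_defs algebra_simps)

lemma mconjT_simps [simp]: "mconjT mw = (mw :: 'f mat2)"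
  by (simp_all add: mat_eq_iff mconjT_def mw_def)

lemma minv_eq: "minv g = mw \<cdot> mconjT g \<cdot> mw"
  by (simp add: mat_eq_iff mmul_def mconjT_def mw_def minv_def)

lemma minv_mult: "minv (g \<cdot> h) = minv h \<cdot> minv g"
  by (simp add: minv_eq mconjT_mult mm_assoc)

lemma minv_minv [simp]: "minv (minv g) = g"
  by (simp add: minv_def mk_entries)

lemma mdet_mult: "mdet eps (g \<cdot> h) = mdet eps g \<odot> mdet eps h"
  by (simp add: mdet_def mmul_def ext_defs algebra_simps)

text \<open>Multiplying the form identity by \<open>mw\<close> turns it into an inverse relation;
  conversely the determinant of that relation supplies the nonvanishing demanded by
  \<open>inG\<close>.\<close>

lemma inG_iff: "inG eps g \<longleftrightarrow> minv g \<cdot> g = mI"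
proof
  assume "inG eps g"
  hence "mw \<cdot> (mconjT g \<cdot> mw \<cdot> g) = mw \<cdot> mw" by (simp add: inG_def)
  thus "minv g \<cdot> g = mI" by (simp add: minv_eq mm_assoc)
next
  assume h: "minv g \<cdot> g = mI"
  hence "mdet eps (minv g) \<odot> mdet eps g = (1, 0)"
    using mdet_mult[of "minv g" g] by (simp add: mdet_def mI_def esub_def)
  hence "mdet eps g \<noteq> (0, 0)" by auto
  moreover have "mw \<cdot> (minv g \<cdot> g) = mw" using h by simp
  ultimately show "inG eps g" by (simp add: inG_def minv_eq mm_assoc)
qed

lemma minv_left: "inG eps g \<Longrightarrow> minv g \<cdot> g = mI" by (simp add: inG_iff)

text \<open>A left inverse that coexists with a right inverse is two-sided; the adjugate divided by
  the determinant is the right inverse used here.\<close>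

lemma minv_right: assumes g: "inG eps g" shows "g \<cdot> minv g = mI"
proof -
  define ad where "ad = mk (m22 g) (esub (0, 0) (m12 g)) (esub (0, 0) (m21 g)) (m11 g)"
  define d where "d = mdet eps g"
  have d: "d \<noteq> (0, 0)" using g by (simp add: inG_def d_def)
  have ad: "g \<cdot> ad = mk d (0, 0) (0, 0) d"
    by (simp add: ad_def d_def mat_eq_iff mmul_def mdet_def ext_defs algebra_simps)
  have dd: "mk d (0, 0) (0, 0) d \<cdot> mk (einv eps d) (0, 0) (0, 0) (einv eps d) = mI"
    using emul_inv[OF d] by (simp add: mat_eq_iff mmul_def mI_def)
  have "g \<cdot> minv g = (g \<cdot> minv g) \<cdot> (g \<cdot> ad \<cdot> mk (einv eps d) (0, 0) (0, 0) (einv eps d))"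
    by (simp add: ad dd)
  also have "\<dots> = g \<cdot> (minv g \<cdot> g) \<cdot> ad \<cdot> mk (einv eps d) (0, 0) (0, 0) (einv eps d)"
    by (simp add: mm_assoc)
  also have "\<dots> = mI" using g by (simp add: minv_left ad dd)
  finally show ?thesis .
qed

lemma inG_mult: "inG eps g \<Longrightarrow> inG eps h \<Longrightarrow> inG eps (g \<cdot> h)"
  unfolding inG_iff minv_mult by (metis mm_assoc mI_mult(1))

lemma inG_minv: "inG eps g \<Longrightarrow> inG eps (minv g)"
  using minv_right by (simp add: inG_iff)

lemma minv_cancel: "inG eps g \<Longrightarrow> minv g \<cdot> (g \<cdot> h) = h" "inG eps g \<Longrightarrow> g \<cdot> (minv g \<cdot> h) = h"
  by (simp_all add: minv_left minv_right flip: mm_assoc)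

lemma inG_nb [simp]: "inG eps (nb c)" and inG_ub [simp]: "inG eps (ub c)" and inG_mw [simp]: "inG eps mw"
  and inG_mI [simp]: "inG eps mI"
  by (simp_all add: inG_iff minv_def nb_def ub_def mw_def mI_def mat_eq_iff mmul_def ext_defs)

lemma inG_tt [simp]: "a \<noteq> (0, 0) \<Longrightarrow> inG eps (tt a)"
  by (simp add: inG_iff minv_def tmat_def mI_def mat_eq_iff mmul_def econj_einv emul_inv)

lemma nb_add: "nb c \<cdot> nb d = nb (c + d)" and ub_add: "ub c \<cdot> ub d = ub (c + d)"
  and nb_0 [simp]: "nb 0 = mI" and ub_0 [simp]: "ub 0 = mI"
  by (simp_all add: nb_def ub_def mI_def mat_eq_iff mmul_def ext_defs add.commute)

lemma tt_mult: "a \<noteq> (0, 0) \<Longrightarrow> b \<noteq> (0, 0) \<Longrightarrow> tt a \<cdot> tt b = tt (a \<odot> b)"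
  by (simp add: tmat_def mat_eq_iff mmul_def einv_mult)

lemma tt_one [simp]: "tt (1, 0) = mI" by (simp add: tmat_def mI_def)

lemma tt_ub: "a \<noteq> (0, 0) \<Longrightarrow> tt a \<cdot> ub x = ub (x * N a) \<cdot> tt a"
  unfolding tmat_def einv_econj by (simp add: ub_def mat_eq_iff mmul_def ext_defs mult_ac)

lemma nb_tt: "a \<noteq> (0, 0) \<Longrightarrow> nb c \<cdot> tt a = tt a \<cdot> nb (c * N a)"
  unfolding tmat_def einv_econj by (simp add: nb_def mat_eq_iff mmul_def ext_defs mult_ac)

lemma nb_ub: assumes "1 + eps * c * x \<noteq> 0"
  shows "nb c \<cdot> ub x = tt (inverse (1 + eps * c * x), 0) \<cdot> ub (x * (1 + eps * c * x)) \<cdot> nb (c / (1 + eps * c * x))"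
proof -
  define D where "D = 1 + eps * c * x"
  have D: "D \<noteq> 0" "eps * c * x = D - 1" using assms by (auto simp: D_def)
  have e: "einv eps (econj (inverse D, 0)) = (D, 0)"
    using D unfolding einv_econj by (simp add: enorm_def power2_eq_square field_simps)
  have "inverse D + c * (eps * (x * inverse D)) = inverse D * (1 + eps * c * x)" by (simp add: algebra_simps)
  also have "\<dots> = 1" using D by simp
  finally have "inverse D + c * (eps * (x * inverse D)) = 1" .
  thus ?thesis unfolding D_def[symmetric] tmat_def e
    using D by (simp add: nb_def ub_def mat_eq_iff mmul_def ext_defs mult_ac)
qed

lemma prod_entries:
  "m22 (tt a \<cdot> ub x \<cdot> nb c) = einv eps (econj a)"
  "m21 (tt a \<cdot> ub x \<cdot> nb c) = einv eps (econj a) \<odot> (0, c)"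
  "m12 (tt a \<cdot> ub x \<cdot> nb c) = a \<odot> (0, x)"
  "m11 (tt a \<cdot> ub x \<cdot> nb c) = a \<odot> (1 + eps * x * c, 0)"
  by (simp_all add: tmat_def ub_def nb_def mmul_def ext_defs algebra_simps)

text \<open>Specializes the coordinate test to multiples of sqrt eps, the form taken by the
  off-diagonal entries of unipotents.\<close>

lemma emul_sqrt_OE [simp]: "(0, c) \<in> OE n \<longleftrightarrow> c \<in> P n" by (simp add: pE_iff)

lemma borel_decomp: assumes b: "inB eps b"
  obtains a x where "a \<noteq> (0, 0)" "b = tt a \<cdot> ub x" "m11 b = a"
proof -
  have G: "inG eps b" and z: "m21 b = (0, 0)" using b by (auto simp: inB_def)
  have e: "econj (m22 b) \<odot> m11 b = (1, 0)" "eadd (econj (m22 b) \<odot> m12 b) (econj (m12 b) \<odot> m22 b) = (0, 0)"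
    using minv_left[OF G] z by (simp_all add: mat_eq_iff mmul_def minv_def mI_def)
  define a where "a = m11 b"
  define x where "x = snd (econj (m22 b) \<odot> m12 b)"
  have a: "a \<noteq> (0, 0)" using e by (auto simp: a_def)
  have "econj a \<odot> m22 b = (1, 0)" using arg_cong[OF e(1), of econj] by (simp add: a_def emul_commute)
  hence d: "m22 b = einv eps (econj a)" by (rule einv_unique)
  have "2 * fst (econj (m22 b) \<odot> m12 b) = 0" using e(2) by (simp add: ext_defs algebra_simps)
  hence "econj (m22 b) \<odot> m12 b = (0, x)" by (auto simp: x_def prod_eq_iff)
  hence "a \<odot> (0, x) = (econj (m22 b) \<odot> m11 b) \<odot> m12 b" by (metis a_def emul_assoc emul_commute)
  hence ax: "a \<odot> (0, x) = m12 b" using e(1) by simp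
  have "b = tt a \<cdot> ub x"
    unfolding mat_eq_iff by (simp add: z d ax tmat_def ub_def mmul_def flip: a_def)
  thus ?thesis by (rule that[OF a _ a_def[symmetric]])
qed

lemma row_relation: assumes g: "inG eps g"
  shows "eadd (m21 g \<odot> econj (m22 g)) (m22 g \<odot> econj (m21 g)) = (0, 0)"
    and "eadd (m21 g \<odot> econj (m12 g)) (m22 g \<odot> econj (m11 g)) = (1, 0)"
  using minv_right[OF g] by (simp_all add: mat_eq_iff mmul_def minv_def mI_def)

text \<open>Unitarity of the bottom row forces m21 / m22 to have trace zero, so it is a multiple of
  sqrt eps. A lower unipotent can therefore clear \<open>m21\<close>, leaving a Borel
  element.\<close>

lemma big_cell_decomp: assumes g: "inG eps g" and d: "m22 g \<noteq> (0, 0)"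
  obtains a x c where "a \<noteq> (0, 0)" "g = tt a \<cdot> ub x \<cdot> nb c"
proof -
  define c where "c = snd (m21 g \<odot> einv eps (m22 g))"
  have "2 * fst (m21 g \<odot> econj (m22 g)) = 0" using row_relation(1)[OF g] by (simp add: ext_defs algebra_simps)
  hence "fst (m21 g \<odot> econj (m22 g)) = 0" by (simp only: mult_eq_0_iff two_nz simp_thms)
  moreover have "fst (m21 g \<odot> einv eps (m22 g)) = fst (m21 g \<odot> econj (m22 g)) / N (m22 g)"
    by (simp add: einv_def econj_def emul_def add_divide_distrib diff_divide_distrib)
  ultimately have "fst (m21 g \<odot> einv eps (m22 g)) = 0" by simp
  hence "m21 g \<odot> einv eps (m22 g) = (0, c)" by (simp add: c_def prod_eq_iff)
  hence "(m21 g \<odot> einv eps (m22 g)) \<odot> m22 g = (0, c) \<odot> m22 g" by simp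
  hence gc: "m21 g = m22 g \<odot> (0, c)"
    using emul_inv[OF d] by (simp add: emul_assoc) (simp add: emul_commute)
  have "m21 (g \<cdot> nb (- c)) = (0, 0)" using gc by (simp add: mmul_def nb_def ext_defs)
  hence "inB eps (g \<cdot> nb (- c))" using inG_mult[OF g] by (simp add: inB_def)
  then obtain a x where ax: "a \<noteq> (0, 0)" "g \<cdot> nb (- c) = tt a \<cdot> ub x" by (rule borel_decomp)
  have "g = g \<cdot> nb (- c) \<cdot> nb c" by (simp add: mm_assoc nb_add)
  thus ?thesis using that ax by metis
qed

lemma inK_G: "inK v eps g \<Longrightarrow> inG eps g" by (simp add: inK_def)

lemma inK_mult: "inK v eps g \<Longrightarrow> inK v eps h \<Longrightarrow> inK v eps (g \<cdot> h)"
  unfolding inK_def by (simp add: inG_mult) (simp add: mmul_def OE_add OE_multl)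

lemma inK_minv: "inK v eps g \<Longrightarrow> inK v eps (minv g)"
  by (simp add: inK_def inG_minv) (simp add: minv_def)

lemma inK_simps [simp]: "inK v eps mw" "inK v eps mI" "inK v eps (nb c) \<longleftrightarrow> c \<in> P 0" "inK v eps (ub c) \<longleftrightarrow> c \<in> P 0"
  unfolding inK_def by simp_all (simp_all add: nb_def ub_def mw_def mI_def)

lemma inK_tt [simp]: "a \<in> UE \<Longrightarrow> inK v eps (tt a)"
  using inG_tt[OF UE_nz, of a] unfolding inK_def by (simp add: tmat_def UE_OE)

lemma inK_cases: assumes k: "inK v eps k"
  shows "m22 k \<in> UE \<or> m21 k \<in> UE"
proof (rule ccontr)
  assume "\<not> ?thesis"
  hence "m22 k \<in> OE 1" "m21 k \<in> OE 1" using k by (auto simp: unitsE_def inK_def)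
  hence "eadd (m21 k \<odot> econj (m12 k)) (m22 k \<odot> econj (m11 k)) \<in> OE 1"
    using k by (intro OE_add OE_multr) (auto simp: inK_def)
  thus False unfolding row_relation(2)[OF inK_G[OF k]] by simp
qed

text \<open>The equivalences hold for every n at once, so that this one factorization serves K, the
  congruence subgroups and the groups J_d.\<close>

lemma big_cell_K: assumes k: "inG eps k" "m22 k \<in> UE" "m21 k \<in> OE 0" "m12 k \<in> OE 0"
  obtains a x c where "a \<in> UE" "x \<in> P 0" "c \<in> P 0" "k = tt a \<cdot> ub x \<cdot> nb c"
    "\<And>n. c \<in> P n \<longleftrightarrow> m21 k \<in> OE n" "\<And>n. x \<in> P n \<longleftrightarrow> m12 k \<in> OE n"
    "\<And>n. esub a (1, 0) \<in> OE n \<longleftrightarrow> esub (m22 k) (1, 0) \<in> OE n"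
proof -
  obtain a x c where g: "a \<noteq> (0, 0)" "k = tt a \<cdot> ub x \<cdot> nb c"
    using big_cell_decomp[OF k(1) UE_nz[OF k(2)]] by blast
  have e: "m22 k = einv eps (econj a)" "m21 k = einv eps (econj a) \<odot> (0, c)" "m12 k = a \<odot> (0, x)"
    unfolding g(2) by (rule prod_entries)+
  have "econj a = einv eps (m22 k)" using g e by simp
  hence "econj a \<in> UE" using k(2) by simp
  hence a: "a \<in> UE" by simp
  have c: "c \<in> P n \<longleftrightarrow> m21 k \<in> OE n" for n using a by (simp add: e OE_unit_mult)
  have x: "x \<in> P n \<longleftrightarrow> m12 k \<in> OE n" for n using a by (simp add: e OE_unit_mult)
  have d: "esub a (1, 0) \<in> OE n \<longleftrightarrow> esub (m22 k) (1, 0) \<in> OE n" for n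
  proof -
    have "esub (econj a) (1, 0) = econj (esub a (1, 0))" by (simp add: ext_defs)
    hence "esub a (1, 0) \<in> OE n \<longleftrightarrow> esub (econj a) (1, 0) \<in> OE n" by simp
    also have "\<dots> \<longleftrightarrow> m22 k \<odot> esub (econj a) (1, 0) \<in> OE n" using k(2) by (simp add: OE_unit_mult)
    also have "m22 k \<odot> esub (econj a) (1, 0) = esub (m22 k \<odot> econj a) (m22 k)"
      by (simp add: ext_defs algebra_simps)
    also have "m22 k \<odot> econj a = (1, 0)" using g e emul_inv(2)[of "econj a"] by simp
    finally show ?thesis by (simp add: OE_sub_commute)
  qed
  show ?thesis by (rule that[OF a _ _ g(2) c x d]) (simp_all only: c x k)
qed

lemma K_decomp: assumes k: "inK v eps k"
  obtains a x c where "a \<in> UE" "x \<in> P 0" "c \<in> P 0" "k = tt a \<cdot> ub x \<cdot> nb c" "m22 k \<in> UE"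
  | a x c where "a \<in> UE" "x \<in> P 0" "c \<in> P 1" "k = tt a \<cdot> ub x \<cdot> nb c \<cdot> mw" "m22 k \<notin> UE"
proof (cases "m22 k \<in> UE")
  case True
  thus ?thesis using big_cell_K[of k] k that(1) by (metis inK_def)
next
  case False
  hence "m21 k \<in> UE" using inK_cases[OF k] by simp
  moreover have e: "m22 (k \<cdot> mw) = m21 k" "m21 (k \<cdot> mw) = m22 k" by (simp_all add: mmul_def mw_def)
  moreover have "inK v eps (k \<cdot> mw)" using k by (simp add: inK_mult)
  ultimately obtain a x c where g: "a \<in> UE" "x \<in> P 0" "c \<in> P 0" "k \<cdot> mw = tt a \<cdot> ub x \<cdot> nb c"
    "\<And>n. c \<in> P n \<longleftrightarrow> m21 (k \<cdot> mw) \<in> OE n"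
    using big_cell_K[of "k \<cdot> mw"] by (metis inK_def)
  have "c \<in> P 1" using g False e k by (auto simp: unitsE_def inK_def)
  moreover have "k = tt a \<cdot> ub x \<cdot> nb c \<cdot> mw" using g(4) by (metis mI_mult(2) mm_assoc mw_mw(1))
  ultimately show ?thesis using that(2) g False by blast
qed

text \<open>Whichever entry of the bottom row has the smaller valuation serves as denominator; if it
  is \<open>m21\<close>, multiplication by \<open>mw\<close> exchanges the two columns
  first.\<close>

lemma iwasawa: assumes g: "inG eps g"
  obtains a x k where "a \<noteq> (0, 0)" "inK v eps k" "g = tt a \<cdot> ub x \<cdot> k"
proof -
  have main: "\<exists>a x k. a \<noteq> (0, 0) \<and> inK v eps k \<and> g = tt a \<cdot> ub x \<cdot> k"
    if g: "inG eps g" and d: "m22 g \<noteq> (0, 0)" "m21 g \<odot> einv eps (m22 g) \<in> OE 0" for g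
  proof -
    obtain a x c where e: "a \<noteq> (0, 0)" "g = tt a \<cdot> ub x \<cdot> nb c" using big_cell_decomp[OF g d(1)] by blast
    have "m21 g = m22 g \<odot> (0, c)" unfolding e(2) prod_entries ..
    hence "m21 g \<odot> einv eps (m22 g) = (0, c) \<odot> (m22 g \<odot> einv eps (m22 g))"
      by (metis emul_assoc emul_commute)
    hence "c \<in> P 0" using d by (simp add: emul_inv)
    thus ?thesis using e by (intro exI[of _ a] exI[of _ x] exI[of _ "nb c"]) simp
  qed
  have nz: "\<not> (m21 g = (0, 0) \<and> m22 g = (0, 0))" using row_relation(2)[OF g] by auto
  define s t where "s = m21 g" and "t = m22 g"
  have dich: "(t \<noteq> (0, 0) \<and> s \<odot> einv eps t \<in> OE 0) \<or> (s \<noteq> (0, 0) \<and> t \<odot> einv eps s \<in> OE 0)"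
  proof (cases "s = (0, 0) \<or> t = (0, 0)")
    case True thus ?thesis using nz by (auto simp: s_def t_def)
  next
    case False
    hence "N s * inverse (N t) \<in> P 0 \<or> N t * inverse (N s) \<in> P 0"
      by (auto simp: pF_def v_mult v_inverse)
    thus ?thesis using False by (auto simp: OE_norm N_mult N_inv divide_inverse)
  qed
  show ?thesis
  proof (cases "t \<noteq> (0, 0) \<and> s \<odot> einv eps t \<in> OE 0")
    case True
    thus ?thesis using main[OF g] that by (auto simp: s_def t_def)
  next
    case False
    have "inG eps (g \<cdot> mw)" using g by (simp add: inG_mult)
    moreover have "m22 (g \<cdot> mw) = s" "m21 (g \<cdot> mw) = t" by (simp_all add: mmul_def mw_def s_def t_def)
    ultimately obtain a x k where e: "a \<noteq> (0, 0)" "inK v eps k" "g \<cdot> mw = tt a \<cdot> ub x \<cdot> k"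
      using main[of "g \<cdot> mw"] dich False by auto
    have "g = tt a \<cdot> ub x \<cdot> (k \<cdot> mw)" using e(3) by (metis mI_mult(2) mm_assoc mw_mw(1))
    thus ?thesis using that[of a "k \<cdot> mw" x] e by (simp add: inK_mult)
  qed
qed

section \<open>Congruence subgroups: normality and Iwahori factorization\<close>

definition congr :: "int \<Rightarrow> 'f mat2 \<Rightarrow> 'f mat2 \<Rightarrow> bool" where
  "congr n g h \<longleftrightarrow> esub (m11 g) (m11 h) \<in> OE n \<and> esub (m12 g) (m12 h) \<in> OE n
     \<and> esub (m21 g) (m21 h) \<in> OE n \<and> esub (m22 g) (m22 h) \<in> OE n"

lemma inKn_iff: "inKn v eps n g \<longleftrightarrow> inK v eps g \<and> congr (int n) g mI"
  by (simp add: inKn_def congr_def msub_def Let_def)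

lemma congr_mult_left: assumes k: "inK v eps k" and c: "congr n g h"
  shows "congr n (k \<cdot> g) (k \<cdot> h)"
proof -
  have *: "esub (eadd (a \<odot> x) (b \<odot> y)) (eadd (a \<odot> x') (b \<odot> y')) = eadd (a \<odot> esub x x') (b \<odot> esub y y')"
    for a b x y x' y' by (simp add: ext_defs algebra_simps)
  show ?thesis using k c by (simp add: congr_def mmul_def * inK_def OE_add OE_multl)
qed

lemma congr_mult_right: assumes k: "inK v eps k" and c: "congr n g h"
  shows "congr n (g \<cdot> k) (h \<cdot> k)"
proof -
  have *: "esub (eadd (x \<odot> a) (y \<odot> b)) (eadd (x' \<odot> a) (y' \<odot> b)) = eadd (esub x x' \<odot> a) (esub y y' \<odot> b)"
    for a b x y x' y' by (simp add: ext_defs algebra_simps)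
  show ?thesis using k c by (simp add: congr_def mmul_def * inK_def OE_add OE_multr)
qed

lemma inKn_conj: assumes k: "inK v eps k" and h: "inKn v eps n h"
  shows "inKn v eps n (k \<cdot> h \<cdot> minv k)"
proof -
  have "congr n (k \<cdot> h \<cdot> minv k) (k \<cdot> mI \<cdot> minv k)"
    using k h by (intro congr_mult_right congr_mult_left inK_minv) (auto simp: inKn_iff)
  thus ?thesis using k h by (simp add: inKn_iff minv_right inK_G inK_mult inK_minv)
qed

lemma inKn_conj': assumes "inK v eps k" "inKn v eps n h" shows "inKn v eps n (minv k \<cdot> h \<cdot> k)"
  using inKn_conj[OF inK_minv[OF assms(1)] assms(2)] by simp

lemma inKn_mono: "inKn v eps n h \<Longrightarrow> m \<le> n \<Longrightarrow> inKn v eps m h"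
  using OE_mono[of _ "int n" "int m"] by (simp add: inKn_iff congr_def)

lemma inKn_nb: "c \<in> P (int n) \<Longrightarrow> inKn v eps n (nb c)"
  using P_mono[of c "int n" 0] by (simp add: inKn_iff congr_def) (simp add: nb_def mI_def ext_defs pE_iff)

lemma inKn_decomp: assumes h: "inKn v eps n h" and n: "n \<ge> 1"
  obtains a x c where "a \<in> UE" "x \<in> P (int n)" "c \<in> P (int n)" "h = tt a \<cdot> ub x \<cdot> nb c"
    "esub a (1, 0) \<in> OE (int n)"
proof -
  have e: "esub (m22 h) (1, 0) \<in> OE (int n)" "m21 h \<in> OE (int n)" "m12 h \<in> OE (int n)"
    using h by (auto simp: inKn_iff congr_def mI_def)
  have "m22 h \<in> UE" using UE_near_one[OF e(1)] n by simp
  thus ?thesis using big_cell_K[of h] h e that unfolding inKn_iff inK_def by metis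
qed


section \<open>Fourier analysis on the compact group\<close>

text \<open>\<open>lv d\<close> and \<open>dp d\<close> are the exponents \<open>\<lceil>(d + 1) / 2\<rceil>\<close> and \<open>\<lceil>d / 2\<rceil>\<close> defining \<open>\<J>\<^sub>d\<close>, and
  \<open>\<Psi>\<close> is \<open>c \<mapsto> psi' (bt d * c)\<close> on the lower unipotents \<open>nb c\<close>.\<close>

definition lv :: "nat \<Rightarrow> nat" where "lv d = (d + 2) div 2"
definition dp :: "nat \<Rightarrow> nat" where "dp d = (d + 1) div 2"
definition bt :: "nat \<Rightarrow> 'f" where "bt d = eps * inverse w0 ^ d"

lemma unit_mult_iff: "unit b \<Longrightarrow> unit (a * b) \<longleftrightarrow> unit a"
  by (cases "a = 0") (auto simp: unit_def v_mult)

text \<open>The duality that makes the character of J_d well behaved: a product of p^(lv d) and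
  p^(dp d) lies in p^(d + 1), where psi' (bt d * _) is trivial.\<close>

lemma lv_dp: "lv d + dp d = d + 1" by (simp add: lv_def dp_def)
lemma lv_le: "d \<ge> 1 \<Longrightarrow> lv d \<le> d" by (simp add: lv_def)
lemma lv_pos: "lv d \<ge> 1" by (simp add: lv_def)
lemma dp_pos: "d \<ge> 1 \<Longrightarrow> dp d \<ge> 1" by (simp add: dp_def)

lemma bt_mult: "bt d * c \<in> P m \<longleftrightarrow> c \<in> P (m + int d)"
proof -
  have "w0 ^ d * (bt d * c) = eps * c" by (simp add: bt_def power_inverse)
  thus ?thesis using P_w0_power_mult[of d "bt d * c" m] by (simp only: P_eps_mult add.commute)
qed

lemma bt_P: "bt d \<in> P m \<longleftrightarrow> m + int d \<le> 0" using bt_mult[of d 1 m] by simp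

abbreviation K :: "'f mat2 \<Rightarrow> bool" where "K \<equiv> inK v eps"

text \<open>Level n is imposed by left invariance under lower unipotents, which keeps all averages
  one-dimensional. By normality of K_n in K this yields right invariance under K_n; see
  \<open>VKl_right\<close>.\<close>

definition VKl :: "nat \<Rightarrow> ('f mat2 \<Rightarrow> complex) set" where
  "VKl n = {F. (\<forall>k. \<not> K k \<longrightarrow> F k = 0) \<and> (\<forall>a k. a \<in> UE \<longrightarrow> K k \<longrightarrow> F (tt a \<cdot> k) = F k)
     \<and> (\<forall>x k. x \<in> P 0 \<longrightarrow> K k \<longrightarrow> F (ub x \<cdot> k) = F k)
     \<and> (\<forall>c k. c \<in> P (int n) \<longrightarrow> K k \<longrightarrow> F (nb c \<cdot> k) = F k)}"

definition VK :: "('f mat2 \<Rightarrow> complex) set" where "VK = (\<Union>n\<in>{1..}. VKl n)"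

text \<open>\<open>\<S>\<^sub>d\<close> for the trivial central character. Invariance under \<open>Z\<close> and under \<open>t(a)\<close> with
  \<open>a \<in> 1 + \<pp>\<^sub>E\<^sup>n\<close>, \<open>n = dp d\<close>, together amount to invariance under \<open>t(a)\<close> with norm in \<open>1 + \<pp>\<^sup>n\<close>.\<close>

definition S1 :: "nat \<Rightarrow> ('f mat2 \<Rightarrow> complex) set" where
  "S1 d = {s. (\<forall>k. \<not> K k \<longrightarrow> s k = 0)
     \<and> (\<forall>a k. a \<in> UE \<longrightarrow> N a - 1 \<in> P (int (dp d)) \<longrightarrow> K k \<longrightarrow> s (tt a \<cdot> k) = s k)
     \<and> (\<forall>x k. x \<in> P 0 \<longrightarrow> K k \<longrightarrow> s (ub x \<cdot> k) = s k)
     \<and> (\<forall>c k. c \<in> P (int (lv d)) \<longrightarrow> K k \<longrightarrow> s (nb c \<cdot> k) = psi' (bt d * c) * s k)}"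

lemma VKl_mono: "F \<in> VKl n \<Longrightarrow> n \<le> m \<Longrightarrow> F \<in> VKl m"
  using P_mono[of _ "int m" "int n"] by (simp add: VKl_def)

lemma VKl_VK: "F \<in> VKl n \<Longrightarrow> n \<ge> 1 \<Longrightarrow> F \<in> VK" by (auto simp: VK_def)

lemma VKl_off: "F \<in> VKl n \<Longrightarrow> \<not> K k \<Longrightarrow> F k = 0"
  and VKl_tt: "F \<in> VKl n \<Longrightarrow> a \<in> UE \<Longrightarrow> K k \<Longrightarrow> F (tt a \<cdot> k) = F k"
  and VKl_ub: "F \<in> VKl n \<Longrightarrow> x \<in> P 0 \<Longrightarrow> K k \<Longrightarrow> F (ub x \<cdot> k) = F k"
  and VKl_nb: "F \<in> VKl n \<Longrightarrow> c \<in> P (int n) \<Longrightarrow> K k \<Longrightarrow> F (nb c \<cdot> k) = F k"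
  unfolding VKl_def by blast+

lemma S1_off: "s \<in> S1 d \<Longrightarrow> \<not> K k \<Longrightarrow> s k = 0"
  and S1_tt: "s \<in> S1 d \<Longrightarrow> a \<in> UE \<Longrightarrow> N a - 1 \<in> P (int (dp d)) \<Longrightarrow> K k \<Longrightarrow> s (tt a \<cdot> k) = s k"
  and S1_ub: "s \<in> S1 d \<Longrightarrow> x \<in> P 0 \<Longrightarrow> K k \<Longrightarrow> s (ub x \<cdot> k) = s k"
  and S1_nb: "s \<in> S1 d \<Longrightarrow> c \<in> P (int (lv d)) \<Longrightarrow> K k \<Longrightarrow> s (nb c \<cdot> k) = psi' (bt d * c) * s k"
  unfolding S1_def by blast+

lemma K_nb: "c \<in> P (int j) \<Longrightarrow> K k \<Longrightarrow> K (nb c \<cdot> k)"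
  using P_mono[of c "int j" 0] by (simp add: inK_mult)

lemma K_tt: "a \<in> UE \<Longrightarrow> K k \<Longrightarrow> K (tt a \<cdot> k)" by (simp add: inK_mult)

lemma K_ub: "x \<in> P 0 \<Longrightarrow> K k \<Longrightarrow> K (ub x \<cdot> k)" by (simp add: inK_mult)

lemma nb_sum: "nb (c + d) \<cdot> k = nb d \<cdot> (nb c \<cdot> k)"
  by (simp add: nb_add add.commute flip: mm_assoc)

lemma nb_tt': "a \<in> UE \<Longrightarrow> nb c \<cdot> (tt a \<cdot> k) = tt a \<cdot> (nb (c * N a) \<cdot> k)"
  using nb_tt[of a c] UE_nz by (simp flip: mm_assoc)

lemma tt_nb': "a \<in> UE \<Longrightarrow> tt a \<cdot> (nb c \<cdot> k) = nb (c * inverse (N a)) \<cdot> (tt a \<cdot> k)"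
proof -
  assume a: "a \<in> UE"
  have "c * inverse (N a) * N a = c" using UE_nz[OF a] by (simp add: mult.assoc)
  thus ?thesis using nb_tt'[OF a, of "c * inverse (N a)" k] by (simp only:)
qed

lemma tt_ub': "a \<in> UE \<Longrightarrow> tt a \<cdot> (ub x \<cdot> k) = ub (x * N a) \<cdot> (tt a \<cdot> k)"
  using tt_ub[of a x] UE_nz by (simp flip: mm_assoc)

lemma tt_tt': "a \<in> UE \<Longrightarrow> b \<in> UE \<Longrightarrow> tt a \<cdot> (tt b \<cdot> k) = tt (a \<odot> b) \<cdot> k"
  using UE_nz by (simp add: tt_mult flip: mm_assoc)

lemma UE_N [simp]: "a \<in> UE \<Longrightarrow> unit (N a)" by (simp add: UE_norm)

lemma VKl_invar: assumes F: "F \<in> VKl n" and k: "K k" shows "invar j n (\<lambda>c. F (nb c \<cdot> k))"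
  unfolding invar_def using VKl_nb[OF F] K_nb[OF _ k] by (simp add: nb_sum)

lemma VKl_lc: "F \<in> VKl n \<Longrightarrow> K k \<Longrightarrow> locconst j (\<lambda>c. F (nb c \<cdot> k))"
  unfolding locconst_def using VKl_invar[of F n k j] by blast

lemma VKl_lc_psi: "F \<in> VKl n \<Longrightarrow> K k \<Longrightarrow> locconst j (\<lambda>c. psi' (b * c) * F (nb c \<cdot> k))"
  by (intro locconst_mult locconst_psi VKl_lc)

section \<open>Projections and the maps to and from the spaces \<open>S1 d\<close>\<close>

definition Pn :: "nat \<Rightarrow> ('f mat2 \<Rightarrow> complex) \<Rightarrow> 'f mat2 \<Rightarrow> complex" where
  "Pn j F k = (if K k then avg j (\<lambda>c. F (nb c \<cdot> k)) else 0)"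

definition Phi :: "nat \<Rightarrow> ('f mat2 \<Rightarrow> complex) \<Rightarrow> 'f mat2 \<Rightarrow> complex" where
  "Phi d F k = (if K k then avg (lv d) (\<lambda>c. psi' (- bt d * c) * F (nb c \<cdot> k)) else 0)"

definition An :: "'f \<Rightarrow> 'f ext" where "An u = (SOME a. a \<in> UE \<and> N a = inverse u)"

text \<open>The adjoint of \<open>Phi d\<close>: the factor turns the average over units modulo \<open>\<pp>\<^sup>n\<close>, \<open>n = dp d\<close>, into
  the sum over the torus modulo the elements fixing \<open>s\<close>. Taking norm \<open>1 / u\<close> makes conjugation by
  \<open>tt (An u)\<close> scale \<open>nb c\<close> to \<open>nb (c * u)\<close>.\<close>

definition Psi :: "nat \<Rightarrow> ('f mat2 \<Rightarrow> complex) \<Rightarrow> 'f mat2 \<Rightarrow> complex" where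
  "Psi d s k = (if K k then of_nat (q ^ dp d) * avg 0 (\<lambda>u. if unit u then s (tt (An u) \<cdot> k) else 0) else 0)"

lemma An: assumes "unit u" shows "An u \<in> UE" "N (An u) = inverse u"
proof -
  have "\<exists>a. a \<in> UE \<and> N a = inverse u" using norm_surj[of "inverse u"] assms by (metis unit_inverse)
  hence "An u \<in> UE \<and> N (An u) = inverse u" unfolding An_def by (rule someI_ex)
  thus "An u \<in> UE" "N (An u) = inverse u" by auto
qed

lemma one_plus_unit: "c \<in> P 1 \<Longrightarrow> x \<in> P 0 \<Longrightarrow> unit (1 + eps * c * x)"
  by (rule unit_one_plus[of _ 1]) (auto simp: mult.assoc intro: P_multr)

lemma VKl_nb_ub: assumes F: "F \<in> VKl n" and c: "c \<in> P 1" and x: "x \<in> P 0" and k: "K k"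
  shows "F (nb c \<cdot> (ub x \<cdot> k)) = F (nb (c / (1 + eps * c * x)) \<cdot> k)"
proof -
  define D where "D = 1 + eps * c * x"
  have D: "unit D" unfolding D_def using c x by (rule one_plus_unit)
  have e: "nb c \<cdot> (ub x \<cdot> k) = tt (inverse D, 0) \<cdot> (ub (x * D) \<cdot> (nb (c / D) \<cdot> k))"
    using nb_ub[of c x] D unfolding D_def[symmetric] by (simp flip: mm_assoc)
  have a: "(inverse D, 0) \<in> UE" using D by (simp add: UE_norm enorm_def power2_eq_square)
  have "c / D \<in> P (int 1)" using c D by (simp add: P_unit_divide)
  hence k': "K (nb (c / D) \<cdot> k)" using k by (rule K_nb)
  have xD: "x * D \<in> P 0" using x D by (simp add: P_unit_mult_right)
  show ?thesis unfolding e D_def[symmetric]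
    by (simp only: VKl_tt[OF F a K_ub[OF xD k']] VKl_ub[OF F xD k'])
qed

text \<open>The difference of two images is (c - d) divided by the product of two units, so the map
  is an isometry.\<close>

lemma avg_moebius: assumes h: "locconst j h" and j: "j \<ge> 1" and x: "x \<in> P 0"
  shows "avg j (\<lambda>c. h (c / (1 + eps * c * x))) = avg j h"
proof -
  have u: "unit (1 + eps * c * x)" if "c \<in> P (int j)" for c
    using that j x P_mono[OF that, of 1] by (intro one_plus_unit) auto
  show ?thesis
  proof (rule avg_isometry[OF h, where s = "\<lambda>c. c / (1 + eps * c * x)"])
    fix c assume "c \<in> P (int j)"
    thus "c / (1 + eps * c * x) \<in> P (int j)" using u by (simp add: P_unit_divide)
  next
    fix c d n assume cd: "c \<in> P (int j)" "d \<in> P (int j)"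
    have "c / (1 + eps * c * x) - d / (1 + eps * d * x) = (c - d) / ((1 + eps * c * x) * (1 + eps * d * x))"
      using u[OF cd(1)] u[OF cd(2)] by (simp add: diff_frac_eq) (simp add: algebra_simps)
    thus "c / (1 + eps * c * x) - d / (1 + eps * d * x) \<in> P n \<longleftrightarrow> c - d \<in> P n"
      using u[OF cd(1)] u[OF cd(2)] by (simp add: P_unit_divide)
  qed
qed

text \<open>Invariance under the torus and the upper unipotents survives averaging because they act
  on the variable in p by a unit scaling and by the Moebius map, both measure preserving.\<close>

lemma Pn_1: assumes F: "F \<in> VKl n" shows "Pn 1 F \<in> VKl 1"
  unfolding VKl_def
proof (intro CollectI conjI allI impI)
  fix k assume "\<not> K k" thus "Pn 1 F k = 0" by (simp add: Pn_def)
next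
  fix a k assume a: "a \<in> UE" and k: "K k"
  have "avg 1 (\<lambda>c. F (nb c \<cdot> (tt a \<cdot> k))) = avg 1 (\<lambda>c. F (nb (c * N a) \<cdot> k))"
  proof (rule avg_cong)
    fix c assume c: "c \<in> P (int 1)"
    hence "c * N a \<in> P (int 1)" using a by (simp add: P_unit_mult_right)
    thus "F (nb c \<cdot> (tt a \<cdot> k)) = F (nb (c * N a) \<cdot> k)"
      unfolding nb_tt'[OF a] using VKl_tt[OF F a] K_nb k by blast
  qed
  also have "\<dots> = avg 1 (\<lambda>c. F (nb c \<cdot> k))"
    using a by (intro avg_scale[where h = "\<lambda>c. F (nb c \<cdot> k)"] VKl_lc[OF F k]) simp
  finally show "Pn 1 F (tt a \<cdot> k) = Pn 1 F k" using a k by (simp add: Pn_def K_tt)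
next
  fix x k assume x: "x \<in> P 0" and k: "K k"
  have "avg 1 (\<lambda>c. F (nb c \<cdot> (ub x \<cdot> k))) = avg 1 (\<lambda>c. F (nb (c / (1 + eps * c * x)) \<cdot> k))"
    using VKl_nb_ub[OF F _ x k] by (intro avg_cong) simp
  also have "\<dots> = avg 1 (\<lambda>c. F (nb c \<cdot> k))"
    using x by (intro avg_moebius[where h = "\<lambda>c. F (nb c \<cdot> k)"] VKl_lc[OF F k]) simp_all
  finally show "Pn 1 F (ub x \<cdot> k) = Pn 1 F k" using x k by (simp add: Pn_def K_ub)
next
  fix c k assume c: "c \<in> P (int 1)" and k: "K k"
  have "avg 1 (\<lambda>d. F (nb d \<cdot> (nb c \<cdot> k))) = avg 1 (\<lambda>d. F (nb (d + c) \<cdot> k))"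
    by (simp add: nb_add flip: mm_assoc)
  also have "\<dots> = avg 1 (\<lambda>c. F (nb c \<cdot> k))"
    by (rule avg_translate[OF VKl_lc[OF F k] c])
  finally show "Pn 1 F (nb c \<cdot> k) = Pn 1 F k" using K_nb[OF c k] k by (simp add: Pn_def)
qed

lemma Pn_id: assumes F: "F \<in> VKl n" and "n \<le> j" shows "Pn j F = F"
proof
  fix k show "Pn j F k = F k"
    using assms VKl_nb[OF VKl_mono[OF F assms(2)], of _ k] VKl_off[OF F, of k]
    by (cases "K k") (auto simp: Pn_def intro!: avg_const)
qed

text \<open>The substitutions are those of \<open>Pn_1\<close>. What must be checked in addition is
  that they leave the oscillating factor unchanged, and this is what determines \<open>lv d\<close>
  and \<open>dp d\<close>.\<close>

lemma Phi_S1: assumes F: "F \<in> VKl n" and d: "d \<ge> 1" shows "Phi d F \<in> S1 d"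
  unfolding S1_def
proof (intro CollectI conjI allI impI)
  fix k assume "\<not> K k" thus "Phi d F k = 0" by (simp add: Phi_def)
next
  fix a k assume a: "a \<in> UE" and Na: "N a - 1 \<in> P (int (dp d))" and k: "K k"
  have "avg (lv d) (\<lambda>c. psi' (- bt d * c) * F (nb c \<cdot> (tt a \<cdot> k)))
     = avg (lv d) (\<lambda>c. psi' (- bt d * (c * N a)) * F (nb (c * N a) \<cdot> k))"
  proof (rule avg_cong)
    fix c assume c: "c \<in> P (int (lv d))"
    hence "c * N a \<in> P (int (lv d))" using a by (simp add: P_unit_mult_right)
    hence 1: "F (nb c \<cdot> (tt a \<cdot> k)) = F (nb (c * N a) \<cdot> k)"
      unfolding nb_tt'[OF a] using VKl_tt[OF F a] K_nb k by blast
    \<comment> \<open>Here lv d + dp d = d + 1 is used.\<close>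
    have "bt d * (c * (N a - 1)) \<in> P 1"
      unfolding bt_mult using lv_dp[of d] by (intro P_mult'[OF c Na]) simp
    hence "psi' (- bt d * c) = psi' (- bt d * (c * N a))" by (intro psi_cong) (simp add: algebra_simps)
    with 1 show "psi' (- bt d * c) * F (nb c \<cdot> (tt a \<cdot> k)) = psi' (- bt d * (c * N a)) * F (nb (c * N a) \<cdot> k)"
      by simp
  qed
  also have "\<dots> = avg (lv d) (\<lambda>c. psi' (- bt d * c) * F (nb c \<cdot> k))"
    using a by (intro avg_scale[where h = "\<lambda>c. psi' (- bt d * c) * F (nb c \<cdot> k)"] VKl_lc_psi[OF F k]) simp
  finally show "Phi d F (tt a \<cdot> k) = Phi d F k" using a k by (simp add: Phi_def K_tt)
next
  fix x k assume x: "x \<in> P 0" and k: "K k"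
  have "avg (lv d) (\<lambda>c. psi' (- bt d * c) * F (nb c \<cdot> (ub x \<cdot> k)))
     = avg (lv d) (\<lambda>c. psi' (- bt d * (c / (1 + eps * c * x))) * F (nb (c / (1 + eps * c * x)) \<cdot> k))"
  proof (rule avg_cong)
    fix c assume c: "c \<in> P (int (lv d))"
    hence c1: "c \<in> P 1" using lv_pos[of d] by (elim P_mono) simp
    note 1 = VKl_nb_ub[OF F c1 x k] and u = one_plus_unit[OF c1 x]
    \<comment> \<open>The Moebius map moves \<open>c\<close> by a term quadratic in
      \<open>c\<close>, harmless because 2 lv d is at least d + 1.\<close>
    have "c * (eps * c * x) \<in> P (1 + int d)"
    proof (rule P_mult'[OF c])
      show "eps * c * x \<in> P (int (lv d))" using c x by (simp add: mult.assoc P_multr)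
      show "1 + int d \<le> int (lv d) + int (lv d)" by (simp add: lv_def)
    qed
    hence "bt d * (c * (eps * c * x) / (1 + eps * c * x)) \<in> P 1"
      unfolding bt_mult using u by (simp add: P_unit_divide)
    moreover have "c * (eps * c * x) / (1 + eps * c * x) = c - c / (1 + eps * c * x)"
      using u by (simp add: field_simps)
    ultimately have "psi' (- bt d * c) = psi' (- bt d * (c / (1 + eps * c * x)))"
      by (intro psi_cong) (simp add: right_diff_distrib P_diff_commute)
    with 1 show "psi' (- bt d * c) * F (nb c \<cdot> (ub x \<cdot> k))
      = psi' (- bt d * (c / (1 + eps * c * x))) * F (nb (c / (1 + eps * c * x)) \<cdot> k)" by simp
  qed
  also have "\<dots> = avg (lv d) (\<lambda>c. psi' (- bt d * c) * F (nb c \<cdot> k))"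
    using x lv_pos by (intro avg_moebius[where h = "\<lambda>c. psi' (- bt d * c) * F (nb c \<cdot> k)"] VKl_lc_psi[OF F k])
  finally show "Phi d F (ub x \<cdot> k) = Phi d F k" using x k by (simp add: Phi_def K_ub)
next
  fix c k assume c: "c \<in> P (int (lv d))" and k: "K k"
  have "psi' (- bt d * (y + c)) * psi' (bt d * c) = psi' (- bt d * y)" for y
    by (simp add: distrib_left flip: psi_add)
  hence "avg (lv d) (\<lambda>y. psi' (- bt d * y) * F (nb y \<cdot> (nb c \<cdot> k)))
     = avg (lv d) (\<lambda>y. psi' (bt d * c) * (psi' (- bt d * (y + c)) * F (nb (y + c) \<cdot> k)))"
    by (intro avg_cong) (metis mm_assoc mult.assoc mult.commute nb_add)
  also have "\<dots> = psi' (bt d * c) * avg (lv d) (\<lambda>y. psi' (- bt d * (y + c)) * F (nb (y + c) \<cdot> k))"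
    by (rule avg_mult_left) (use locconst_shift[OF VKl_lc_psi[OF F k, of "lv d" "- bt d"] order_refl c] in \<open>simp add: add.commute\<close>)
  also have "avg (lv d) (\<lambda>y. psi' (- bt d * (y + c)) * F (nb (y + c) \<cdot> k)) = avg (lv d) (\<lambda>y. psi' (- bt d * y) * F (nb y \<cdot> k))"
    by (rule avg_translate[OF VKl_lc_psi[OF F k] c])
  finally show "Phi d F (nb c \<cdot> k) = psi' (bt d * c) * Phi d F k" using K_nb[OF c k] k by (simp add: Phi_def)
qed

text \<open>Functions in \<open>S1 d\<close> see \<open>tt a\<close> only through the norm modulo 1
  + p^(dp d), so the choice made in \<open>An\<close> is immaterial.\<close>

lemma S1_tt_eq: assumes s: "s \<in> S1 d" and a: "a \<in> UE" and b: "b \<in> UE" and k: "K k"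
  and ab: "N a * inverse (N b) - 1 \<in> P (int (dp d))"
  shows "s (tt a \<cdot> k) = s (tt b \<cdot> k)"
proof -
  have ne: "b \<noteq> (0, 0)" using UE_nz[OF b] .
  have "(a \<odot> einv eps b) \<odot> b = a" unfolding emul_assoc emul_inv(2)[OF ne] by simp
  hence "tt a \<cdot> k = tt (a \<odot> einv eps b) \<cdot> (tt b \<cdot> k)" using a b by (simp add: tt_tt')
  moreover have "N (a \<odot> einv eps b) - 1 \<in> P (int (dp d))"
    using ab ne by (simp add: N_mult N_inv divide_inverse)
  ultimately show ?thesis using S1_tt[OF s, of "a \<odot> einv eps b" "tt b \<cdot> k"] a b k by (simp add: K_tt)
qed

lemma S1_unit_invar: assumes s: "s \<in> S1 d" and d: "d \<ge> 1" and k: "K k"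
  shows "invar 0 (dp d) (\<lambda>u. if unit u then s (tt (An u) \<cdot> k) else 0)"
  unfolding invar_def
proof (intro ballI)
  fix u y assume u: "u \<in> P (int 0)" and y: "y \<in> P (int (dp d))"
  have y1: "y \<in> P 1" using P_mono[OF y] dp_pos[OF d] by simp
  have iff: "unit (u + y) \<longleftrightarrow> unit u"
    using unit_cong[of u "u + y"] unit_cong[of "u + y" u] y1 by auto
  show "(if unit (u + y) then s (tt (An (u + y)) \<cdot> k) else 0) = (if unit u then s (tt (An u) \<cdot> k) else 0)"
  proof (cases "unit u")
    case True
    hence uy: "unit (u + y)" using iff by simp
    have "N (An (u + y)) * inverse (N (An u)) - 1 = - (y / (u + y))"
      unfolding An(2)[OF True] An(2)[OF uy] using True uy by (simp add: field_simps)
    hence "s (tt (An (u + y)) \<cdot> k) = s (tt (An u) \<cdot> k)"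
      using An[OF True] An[OF uy] y uy by (intro S1_tt_eq[OF s _ _ k]) (simp_all add: P_unit_divide)
    thus ?thesis using True uy by simp
  qed (simp add: iff)
qed

lemma S1_nb_d1: assumes s: "s \<in> S1 d" and c: "c \<in> P (int (d + 1))" and k: "K k"
  shows "s (nb c \<cdot> k) = s k"
proof -
  have "c \<in> P (int (lv d))" using c by (rule P_mono) (simp add: lv_def)
  moreover have "bt d * c \<in> P 1" using c by (simp add: bt_mult add.commute)
  ultimately show ?thesis using S1_nb[OF s _ k, of c] by (simp add: psi_P)
qed

text \<open>Full torus invariance comes from the substitution u -> u / N a. The level is d + 1
  because conjugation by \<open>tt (An u)\<close> preserves p^(d + 1), on which the character is
  trivial.\<close>

lemma Psi_VKl: assumes s: "s \<in> S1 d" and d: "d \<ge> 1" shows "Psi d s \<in> VKl (d + 1)"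
  unfolding VKl_def
proof (intro CollectI conjI allI impI)
  fix k assume "\<not> K k" thus "Psi d s k = 0" by (simp add: Psi_def)
next
  fix a k assume a: "a \<in> UE" and k: "K k"
  let ?g = "\<lambda>u. if unit u then s (tt (An u) \<cdot> k) else 0"
  have "avg 0 (\<lambda>u. if unit u then s (tt (An u) \<cdot> (tt a \<cdot> k)) else 0) = avg 0 (\<lambda>u. ?g (u * inverse (N a)))"
  proof (rule avg_cong)
    fix u
    have ua: "unit (u * inverse (N a)) \<longleftrightarrow> unit u"
      using a by (intro unit_mult_iff) simp
    show "(if unit u then s (tt (An u) \<cdot> (tt a \<cdot> k)) else 0) = ?g (u * inverse (N a))"
    proof (cases "unit u")
      case True
      hence u': "unit (u * inverse (N a))" using ua by simp
      have "N (An u \<odot> a) * inverse (N (An (u * inverse (N a)))) = 1"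
        unfolding N_mult An(2)[OF True] An(2)[OF u'] using True UE_nz[OF a] by (simp add: field_simps)
      hence "s (tt (An u \<odot> a) \<cdot> k) = s (tt (An (u * inverse (N a))) \<cdot> k)"
        using An(1)[OF True] An(1)[OF u'] a by (intro S1_tt_eq[OF s _ _ k]) simp_all
      thus ?thesis using True u' a An[OF True] by (simp add: tt_tt')
    qed (simp add: ua)
  qed
  also have "\<dots> = avg 0 ?g"
    using S1_unit_invar[OF s d k] a by (intro avg_scale) (auto simp: locconst_def)
  finally show "Psi d s (tt a \<cdot> k) = Psi d s k" using a k by (simp add: Psi_def K_tt)
next
  fix x k assume x: "x \<in> P 0" and k: "K k"
  have "avg 0 (\<lambda>u. if unit u then s (tt (An u) \<cdot> (ub x \<cdot> k)) else 0) = avg 0 (\<lambda>u. if unit u then s (tt (An u) \<cdot> k) else 0)"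
  proof (rule avg_cong)
    fix u
    have "s (tt (An u) \<cdot> (ub x \<cdot> k)) = s (tt (An u) \<cdot> k)" if u: "unit u"
      using An[OF u] x k by (simp add: tt_ub' S1_ub[OF s] K_tt P_unit_mult_right u)
    thus "(if unit u then s (tt (An u) \<cdot> (ub x \<cdot> k)) else 0) = (if unit u then s (tt (An u) \<cdot> k) else 0)" by simp
  qed
  thus "Psi d s (ub x \<cdot> k) = Psi d s k" using x k by (simp add: Psi_def K_ub)
next
  fix c k assume c: "c \<in> P (int (d + 1))" and k: "K k"
  have "avg 0 (\<lambda>u. if unit u then s (tt (An u) \<cdot> (nb c \<cdot> k)) else 0) = avg 0 (\<lambda>u. if unit u then s (tt (An u) \<cdot> k) else 0)"
  proof (rule avg_cong)
    fix u
    have "s (tt (An u) \<cdot> (nb c \<cdot> k)) = s (tt (An u) \<cdot> k)" if u: "unit u"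
    proof -
      have "c * inverse (N (An u)) \<in> P (int (d + 1))" using An[OF u] u c by (simp add: P_unit_mult_right)
      thus ?thesis using An[OF u] k by (simp only: tt_nb' S1_nb_d1[OF s] K_tt)
    qed
    thus "(if unit u then s (tt (An u) \<cdot> (nb c \<cdot> k)) else 0) = (if unit u then s (tt (An u) \<cdot> k) else 0)" by simp
  qed
  thus "Psi d s (nb c \<cdot> k) = Psi d s k" using K_nb[OF c k] k by (simp add: Psi_def)
qed

text \<open>For level at most d the function is constant along p^d while psi' (bt d * _) is
  nontrivial there. Consequently each function has only finitely many components.\<close>

lemma Phi_vanish: assumes F: "F \<in> VKl n" and d: "n \<le> d" "d \<ge> 1" shows "Phi d F = (\<lambda>_. 0)"
proof
  fix k
  show "Phi d F k = 0"
  proof (cases "K k")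
    case True
    let ?h = "\<lambda>c. psi' (- bt d * c) * F (nb c \<cdot> k)"
    have "avg (lv d) ?h = avg (lv d) (\<lambda>x. avg d (\<lambda>y. ?h (x + y)))"
      by (rule avg_split(1)[OF VKl_lc_psi[OF F True] lv_le[OF d(2)]])
    also have "\<dots> = 0"
    proof (rule avg_const)
      fix x assume x: "x \<in> P (int (lv d))"
      have "avg d (\<lambda>y. ?h (x + y)) = avg d (\<lambda>y. ?h x * psi' (- bt d * y))"
      proof (rule avg_cong)
        fix y assume y: "y \<in> P (int d)"
        have "F (nb (x + y) \<cdot> k) = F (nb x \<cdot> k)"
          unfolding nb_sum by (rule VKl_nb[OF VKl_mono[OF F d(1)] y K_nb[OF x True]])
        moreover have "psi' (- bt d * (x + y)) = psi' (- bt d * x) * psi' (- bt d * y)"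
          by (simp only: distrib_left psi_add)
        ultimately show "?h (x + y) = ?h x * psi' (- bt d * y)" by (simp only: mult_ac)
      qed
      also have "\<dots> = ?h x * avg d (\<lambda>y. psi' (- bt d * y))" by (rule avg_mult_left[OF locconst_psi])
      also have "avg d (\<lambda>y. psi' (- bt d * y)) = 0" unfolding avg_psi by (simp add: bt_P)
      finally show "avg d (\<lambda>y. ?h (x + y)) = 0" by simp
    qed
    finally show ?thesis using True by (simp add: Phi_def)
  qed (simp add: Phi_def)
qed


lemma invar_mult_left: "invar j n h \<Longrightarrow> invar j n (\<lambda>x. c * h x)" for c :: complex
  by (simp add: invar_def)

text \<open>After exchanging the averages, the unit average of the character is a Ramanujan sum in
  \<open>c\<close>: the indicator of p^(d + 1) minus 1/q times that of p^d. These cut the average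
  over p^(lv d) down to the two projections.\<close>

lemma Psi_Phi: assumes F: "F \<in> VKl n" and d: "d \<ge> 1"
  shows "Psi d (Phi d F) k = Pn (d + 1) F k - Pn d F k"
proof (cases "K k")
  case k: True
  let ?l = "lv d" and ?e = "dp d" and ?b = "bt d"
  let ?f = "\<lambda>c. F (nb c \<cdot> k)"
  define H where "H = (\<lambda>u c. (if unit u then psi' (- ?b * u * c) else 0) * ?f c)"
  let ?fd = "\<lambda>c. if c \<in> P (int d) then ?f c else 0" and ?fd1 = "\<lambda>c. if c \<in> P (int (d + 1)) then ?f c else 0"
  have H_eq: "(\<lambda>u. H u c) = (\<lambda>u. ?f c * (if unit u then psi' (- ?b * c * u) else 0))" for c
    by (rule ext) (simp add: H_def mult_ac)
  have e1: "?e \<ge> 1" using dp_pos[OF d] .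
  \<comment> \<open>The indices of p^(d + 1) and of p^d in p^(lv d) are q^(dp d) and q^(dp d - 1):
    exactly the factor in \<open>Psi\<close>, without and with the 1/q of the Ramanujan sum.\<close>
  have e_sub: "d + 1 - ?l = ?e" "d - ?l = ?e - 1" using lv_dp[of d] lv_le[OF d] by linarith+
  have inner: "(if unit u then Phi d F (tt (An u) \<cdot> k) else 0) = avg ?l (H u)" for u
  proof (cases "unit u")
    case u: True
    let ?g = "\<lambda>c. psi' (- ?b * u * c) * ?f c"
    have "Phi d F (tt (An u) \<cdot> k) = avg ?l (\<lambda>c. psi' (- ?b * c) * F (nb c \<cdot> (tt (An u) \<cdot> k)))"
      using k An[OF u] by (simp add: Phi_def K_tt)
    also have "\<dots> = avg ?l (\<lambda>c. ?g (c * inverse u))"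
    proof (rule avg_cong)
      fix c assume c: "c \<in> P (int ?l)"
      hence "c * inverse u \<in> P (int ?l)" using u by (simp add: P_unit_mult_right)
      hence "F (nb c \<cdot> (tt (An u) \<cdot> k)) = F (nb (c * inverse u) \<cdot> k)"
        unfolding nb_tt'[OF An(1)[OF u]] An(2)[OF u] using VKl_tt[OF F An(1)[OF u]] K_nb k by blast
      moreover have "- ?b * u * (c * inverse u) = - ?b * c" using u by simp
      ultimately show "psi' (- ?b * c) * F (nb c \<cdot> (tt (An u) \<cdot> k)) = ?g (c * inverse u)" by (simp only:)
    qed
    also have "\<dots> = avg ?l ?g"
      using u by (intro avg_scale[where h = ?g] VKl_lc_psi[OF F k]) simp
    finally show ?thesis using u by (simp add: H_def)
  next
    case False
    have "avg ?l (H u) = 0" using False by (intro avg_const) (simp add: H_def)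
    thus ?thesis using False by simp
  qed
  define I where "I = (\<lambda>c. avg 0 (\<lambda>u. if unit u then psi' (- ?b * c * u) else 0))"
  have unit_inv: "invar 0 ?e (\<lambda>u. if unit u then psi' (- ?b * c * u) else 0)" if c: "c \<in> P (int ?l)" for c
    unfolding invar_def
  proof (intro ballI)
    fix u y assume u: "u \<in> P (int 0)" and y: "y \<in> P (int ?e)"
    have "y \<in> P 1" using P_mono[OF y] e1 by simp
    hence iff: "unit (u + y) \<longleftrightarrow> unit u" using unit_cong[of u "u + y"] unit_cong[of "u + y" u] by auto
    have "?b * (c * y) \<in> P 1" unfolding bt_mult using lv_dp[of d] by (intro P_mult'[OF c y]) simp
    hence "psi' (- ?b * c * (u + y)) = psi' (- ?b * c * u)"
      by (intro psi_cong) (simp add: algebra_simps)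
    thus "(if unit (u + y) then psi' (- ?b * c * (u + y)) else 0) = (if unit u then psi' (- ?b * c * u) else 0)"
      using iff by (simp only:)
  qed
  have qe: "q ^ ?e = q * q ^ (?e - 1)" using e1 by (cases ?e) auto
  \<comment> \<open>The units are O_F without p; character orthogonality on each of these two ideals
    gives an indicator, and 1/q is the mass of p.\<close>
  have I: "I c = (if c \<in> P (int (d + 1)) then 1 else 0) - 1 / of_nat q * (if c \<in> P (int d) then 1 else 0)" for c
  proof -
    let ?r = "\<lambda>u. if u \<in> P (int 1) then psi' (- ?b * c * u) else 0"
    have "I c = avg 0 (\<lambda>u. psi' (- ?b * c * u) - ?r u)"
      unfolding I_def by (rule avg_cong) (simp add: unit_iff)
    also have "\<dots> = avg 0 (\<lambda>u. psi' (- ?b * c * u)) - avg 0 ?r"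
      by (rule avg_diff[OF locconst_psi avg_restrict(1)[OF locconst_psi]]) simp
    also have "avg 0 (\<lambda>u. psi' (- ?b * c * u)) = (if c \<in> P (int (d + 1)) then 1 else 0)"
      unfolding avg_psi using bt_mult[of d c 1] by (simp add: add.commute)
    also have "of_nat (q ^ (1 - 0)) * avg 0 ?r = avg 1 (\<lambda>u. psi' (- ?b * c * u))"
      by (rule avg_restrict(2)[OF locconst_psi]) simp
    hence "of_nat q * avg 0 ?r = (if c \<in> P (int d) then 1 else 0)"
      unfolding avg_psi using bt_mult[of d c 0] by simp
    hence "avg 0 ?r = 1 / of_nat q * (if c \<in> P (int d) then 1 else 0)" using q_pos by (auto simp: field_simps)
    finally show ?thesis .
  qed
  have "Psi d (Phi d F) k = of_nat (q ^ ?e) * avg 0 (\<lambda>u. avg ?l (H u))"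
    using k inner by (simp add: Psi_def)
  also have "avg 0 (\<lambda>u. avg ?l (H u)) = avg ?l (\<lambda>c. avg 0 (\<lambda>u. H u c))"
  proof (rule avg_swap[where N = "max (d + 1) n"])
    fix c assume c: "c \<in> P (int ?l)"
    have "invar 0 ?e (\<lambda>u. H u c)" unfolding H_eq by (rule invar_mult_left[OF unit_inv[OF c]])
    thus "invar 0 (max (d + 1) n) (\<lambda>u. H u c)" by (rule invar_mono) (simp add: dp_def)
  next
    fix u assume u: "u \<in> P (int 0)"
    have "psi' (- ?b * u * (x + y)) = psi' (- ?b * u * x)" if y: "y \<in> P (int (d + 1))" for x y
    proof -
      have "?b * (u * y) \<in> P 1" unfolding bt_mult using u y by (intro P_multl) (simp_all add: add.commute)
      thus ?thesis by (intro psi_cong) (simp add: algebra_simps)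
    qed
    hence "invar ?l (d + 1) (\<lambda>c. if unit u then psi' (- ?b * u * c) else 0)" by (simp add: invar_def)
    hence "invar ?l (max (d + 1) n) (\<lambda>c. if unit u then psi' (- ?b * u * c) else 0)" by (rule invar_mono) simp
    moreover have "invar ?l (max (d + 1) n) ?f" by (rule invar_mono[OF VKl_invar[OF F k]]) simp
    ultimately show "invar ?l (max (d + 1) n) (H u)" unfolding H_def invar_def by simp
  qed
  also have "avg ?l (\<lambda>c. avg 0 (\<lambda>u. H u c)) = avg ?l (\<lambda>c. - (1 / of_nat q) * ?fd c + ?fd1 c)"
  proof (rule avg_cong)
    fix c assume c: "c \<in> P (int ?l)"
    have "avg 0 (\<lambda>u. H u c) = ?f c * I c"
      unfolding I_def H_eq by (rule avg_mult_left) (use unit_inv[OF c] in \<open>auto simp: locconst_def\<close>)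
    thus "avg 0 (\<lambda>u. H u c) = - (1 / of_nat q) * ?fd c + ?fd1 c" unfolding I by (auto simp: right_diff_distrib)
  qed
  also have "\<dots> = - (1 / of_nat q) * avg ?l ?fd + avg ?l ?fd1"
    using lv_le[OF d] by (intro avg_linear avg_restrict(1) VKl_lc[OF F k]) simp_all
  also have "of_nat (q ^ ?e) * (- (1 / of_nat q) * avg ?l ?fd + avg ?l ?fd1)
      = of_nat (q ^ ?e) * avg ?l ?fd1 - of_nat (q ^ (?e - 1)) * avg ?l ?fd"
    unfolding qe using q_pos by (simp add: field_simps)
  also have "of_nat (q ^ ?e) * avg ?l ?fd1 = avg (d + 1) ?f"
    using avg_restrict(2)[OF VKl_lc[OF F k, of "d + 1"], of ?l] lv_le[OF d] e_sub(1) by simp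
  also have "of_nat (q ^ (?e - 1)) * avg ?l ?fd = avg d ?f"
    using avg_restrict(2)[OF VKl_lc[OF F k, of d], of ?l] lv_le[OF d] e_sub(2) by simp
  finally show ?thesis using k by (simp add: Pn_def)
qed (simp add: Psi_def Pn_def)


text \<open>The common start of the orthogonality relations: b = 0 gives \<open>Pn\<close>, b = bt d
  gives \<open>Phi d\<close>. Moving \<open>nb c\<close> past \<open>tt (An u)\<close> scales
  \<open>c\<close> by \<open>u\<close>, since \<open>An u\<close> has norm 1/u.\<close>

lemma Psi_expand: assumes s: "s \<in> S1 e" and e: "e \<ge> 1" and k: "K k"
  shows "avg i (\<lambda>c. psi' (- b * c) * Psi e s (nb c \<cdot> k))
    = of_nat (q ^ dp e) * avg 0 (\<lambda>u. if unit u then avg i (\<lambda>c. psi' (- b * c) * s (nb (c * u) \<cdot> (tt (An u) \<cdot> k))) else 0)"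
proof -
  define H where "H = (\<lambda>c u. psi' (- b * c) * (if unit u then s (tt (An u) \<cdot> (nb c \<cdot> k)) else 0))"
  obtain M where M: "\<forall>x\<in>P (int M). - b * x \<in> P 1" using psi_level[of 0 "- b"] by blast
  have Hinv: "invar 0 (dp e) (H c)" if c: "c \<in> P (int i)" for c
    unfolding H_def by (rule invar_mult_left[OF S1_unit_invar[OF s e K_nb[OF c k]]])
  have sum: "H c u = (if unit u then psi' (- b * c) * s (nb (c * u) \<cdot> (tt (An u) \<cdot> k)) else 0)" for c u
    using An[of u] by (simp add: H_def tt_nb')
  have "avg i (\<lambda>c. psi' (- b * c) * Psi e s (nb c \<cdot> k)) = avg i (\<lambda>c. of_nat (q ^ dp e) * avg 0 (H c))"
  proof (rule avg_cong)
    fix c assume c: "c \<in> P (int i)"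
    have "avg 0 (H c) = psi' (- b * c) * avg 0 (\<lambda>u. if unit u then s (tt (An u) \<cdot> (nb c \<cdot> k)) else 0)"
      unfolding H_def by (rule avg_mult_left) (use S1_unit_invar[OF s e K_nb[OF c k]] in \<open>auto simp: locconst_def\<close>)
    thus "psi' (- b * c) * Psi e s (nb c \<cdot> k) = of_nat (q ^ dp e) * avg 0 (H c)"
      using K_nb[OF c k] by (simp add: Psi_def)
  qed
  have Cinv: "invar i (max M (e + 1)) (\<lambda>c. H c u)" if u: "u \<in> P (int 0)" for u
    unfolding invar_def
  proof (intro ballI)
    fix x y assume x: "x \<in> P (int i)" and y: "y \<in> P (int (max M (e + 1)))"
    have y1: "y \<in> P (int M)" and y2: "y \<in> P (int (e + 1))" using y by (auto elim!: P_mono)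
    have p: "psi' (- b * (x + y)) = psi' (- b * x)"
      using M[rule_format, OF y1] by (intro psi_cong) (simp add: distrib_left)
    show "H (x + y) u = H x u"
    proof (cases "unit u")
      case True
      have yu: "y * u \<in> P (int (e + 1))" using y2 True by (simp add: P_unit_mult_right)
      have "x * u \<in> P (int i)" using x True by (simp add: P_unit_mult_right)
      hence "s (nb ((x + y) * u) \<cdot> (tt (An u) \<cdot> k)) = s (nb (x * u) \<cdot> (tt (An u) \<cdot> k))"
        unfolding distrib_right nb_sum using An[OF True] k yu by (intro S1_nb_d1[OF s yu] K_nb K_tt)
      thus ?thesis unfolding sum p by simp
    qed (simp add: sum)
  qed
  have Hinv': "invar 0 (max M (e + 1)) (H c)" if c: "c \<in> P (int i)" for c
    by (rule invar_mono[OF Hinv[OF c]]) (simp add: dp_def)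
  have lc: "locconst i (\<lambda>c. avg 0 (H c))"
  proof -
    have "invar i (max M (e + 1)) (\<lambda>c. avg 0 (H c))"
      unfolding invar_def by (intro ballI avg_cong) (use Cinv in \<open>auto simp: invar_def\<close>)
    thus ?thesis by (auto simp: locconst_def)
  qed
  note \<open>avg i (\<lambda>c. psi' (- b * c) * Psi e s (nb c \<cdot> k)) = _\<close>
  also have "avg i (\<lambda>c. of_nat (q ^ dp e) * avg 0 (H c)) = of_nat (q ^ dp e) * avg i (\<lambda>c. avg 0 (H c))"
    by (rule avg_mult_left[OF lc])
  also have "avg i (\<lambda>c. avg 0 (H c)) = avg 0 (\<lambda>u. avg i (\<lambda>c. H c u))"
    by (rule avg_swap[where N = "max M (e + 1)"]) (rule Cinv Hinv', assumption)+
  also have "\<dots> = avg 0 (\<lambda>u. if unit u then avg i (\<lambda>c. psi' (- b * c) * s (nb (c * u) \<cdot> (tt (An u) \<cdot> k))) else 0)"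
  proof (rule avg_cong)
    fix u
    show "avg i (\<lambda>c. H c u) = (if unit u then avg i (\<lambda>c. psi' (- b * c) * s (nb (c * u) \<cdot> (tt (An u) \<cdot> k))) else 0)"
      unfolding sum by (cases "unit u") (simp_all add: avg_const)
  qed
  finally show ?thesis .
qed

text \<open>On cosets of p^j inside p^i the integrand is a constant times the character with
  parameter bt e * u - b, and the last hypothesis makes that character nontrivial on p^j.\<close>

lemma S1_char_vanish: assumes s: "s \<in> S1 e" and k: "K k" and u: "unit u"
  and j: "j = max i (lv e)" and b: "bt e * u - b \<notin> P (1 - int j)"
  shows "avg i (\<lambda>c. psi' (- b * c) * s (nb (c * u) \<cdot> k)) = 0"
proof -
  let ?h = "\<lambda>c. psi' (- b * c) * s (nb (c * u) \<cdot> k)"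
  have lc: "locconst i ?h"
  proof (rule locconst_mult[OF locconst_psi])
    have "invar i (e + 1) (\<lambda>c. s (nb (c * u) \<cdot> k))" unfolding invar_def
    proof (intro ballI)
      fix x y assume x: "x \<in> P (int i)" and y: "y \<in> P (int (e + 1))"
      have yu: "y * u \<in> P (int (e + 1))" and xu: "x * u \<in> P (int i)" using x y u by (simp_all add: P_unit_mult_right)
      show "s (nb ((x + y) * u) \<cdot> k) = s (nb (x * u) \<cdot> k)"
        unfolding distrib_right nb_sum by (rule S1_nb_d1[OF s yu K_nb[OF xu k]])
    qed
    thus "locconst i (\<lambda>c. s (nb (c * u) \<cdot> k))" by (auto simp: locconst_def)
  qed
  have "avg i ?h = avg i (\<lambda>x. avg j (\<lambda>y. ?h (x + y)))" by (rule avg_split(1)[OF lc]) (simp add: j)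
  also have "\<dots> = 0"
  proof (rule avg_const)
    fix x assume x: "x \<in> P (int i)"
    have "avg j (\<lambda>y. ?h (x + y)) = avg j (\<lambda>y. ?h x * psi' ((bt e * u - b) * y))"
    proof (rule avg_cong)
      fix y assume y: "y \<in> P (int j)"
      have yu: "y * u \<in> P (int (lv e))" and xu: "x * u \<in> P (int i)"
        using x y u P_mono[OF y, of "int (lv e)"] by (simp_all add: P_unit_mult_right j)
      have "s (nb ((x + y) * u) \<cdot> k) = psi' (bt e * (y * u)) * s (nb (x * u) \<cdot> k)"
        unfolding distrib_right nb_sum by (rule S1_nb[OF s yu K_nb[OF xu k]])
      moreover have "psi' (- b * (x + y)) * psi' (bt e * (y * u)) = psi' (- b * x) * psi' ((bt e * u - b) * y)"
        unfolding psi_add[symmetric] by (simp add: algebra_simps)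
      ultimately show "?h (x + y) = ?h x * psi' ((bt e * u - b) * y)" by (metis mult.assoc mult.commute)
    qed
    also have "\<dots> = ?h x * avg j (\<lambda>y. psi' ((bt e * u - b) * y))" by (rule avg_mult_left[OF locconst_psi])
    also have "avg j (\<lambda>y. psi' ((bt e * u - b) * y)) = 0" unfolding avg_psi using b by simp
    finally show "avg j (\<lambda>y. ?h (x + y)) = 0" by simp
  qed
  finally show ?thesis .
qed

lemma P1_Psi: assumes s: "s \<in> S1 e" and e: "e \<ge> 1" shows "Pn 1 (Psi e s) = (\<lambda>_. 0)"
proof
  fix k
  show "Pn 1 (Psi e s) k = 0"
  proof (cases "K k")
    case k: True
    \<comment> \<open>The case b = 0, written so as to match \<open>Psi_expand\<close>. Since bt e *
      u has valuation -e and lv e is at most e, its character is nontrivial on p^(max 1 (lv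
      e)).\<close>
    have "avg 1 (\<lambda>c. psi' (- 0 * c) * s (nb (c * u) \<cdot> (tt (An u) \<cdot> k))) = 0" if u: "unit u" for u
    proof (rule S1_char_vanish[OF s K_tt[OF An(1)[OF u] k] u refl])
      show "bt e * u - 0 \<notin> P (1 - int (max 1 (lv e)))"
        using lv_le[OF e] lv_pos[of e] u by (simp add: P_unit_mult_right bt_P)
    qed
    hence "(\<lambda>u. if unit u then avg 1 (\<lambda>c. psi' (- 0 * c) * s (nb (c * u) \<cdot> (tt (An u) \<cdot> k))) else 0) = (\<lambda>_. 0)"
      by auto
    hence "avg 1 (\<lambda>c. psi' (- 0 * c) * Psi e s (nb c \<cdot> k)) = 0"
      unfolding Psi_expand[OF s e k] by (simp only: avg_const mult_zero_right)
    thus ?thesis using k by (simp add: Pn_def)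
  qed (simp add: Pn_def)
qed

text \<open>The parameters bt e * u and bt d have different valuations -e and -d, so no unit u makes
  them cancel.\<close>

lemma Phi_Psi_ne: assumes s: "s \<in> S1 e" and e: "e \<ge> 1" and d: "d \<ge> 1" "d \<noteq> e"
  shows "Phi d (Psi e s) = (\<lambda>_. 0)"
proof
  fix k
  show "Phi d (Psi e s) k = 0"
  proof (cases "K k")
    case k: True
    have "avg (lv d) (\<lambda>c. psi' (- bt d * c) * s (nb (c * u) \<cdot> (tt (An u) \<cdot> k))) = 0" if u: "unit u" for u
    proof (rule S1_char_vanish[OF s K_tt[OF An(1)[OF u] k] u refl], rule notI)
      assume "bt e * u - bt d \<in> P (1 - int (max (lv d) (lv e)))"
      hence h: "bt e * u - bt d \<in> P (1 - int (max d e))"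
        by (rule P_mono) (use lv_le[OF e] lv_le[OF d(1)] in auto)
      show False
      proof (cases "d < e")
        case True
        have "bt d \<in> P (1 - int (max d e))" using True by (simp add: bt_P)
        with h have "bt e * u \<in> P (1 - int (max d e))" by (simp only: P_diff_iff)
        thus False using u True by (simp add: P_unit_mult_right bt_P)
      next
        case False
        have "bt e * u \<in> P (1 - int (max d e))" using False d u by (simp add: P_unit_mult_right bt_P)
        hence "bt e * u - (bt e * u - bt d) \<in> P (1 - int (max d e))" using h by (rule P_diff)
        thus False using False by (simp add: bt_P)
      qed
    qed
    hence "(\<lambda>u. if unit u then avg (lv d) (\<lambda>c. psi' (- bt d * c) * s (nb (c * u) \<cdot> (tt (An u) \<cdot> k))) else 0) = (\<lambda>_. 0)"
      by auto
    hence "avg (lv d) (\<lambda>c. psi' (- bt d * c) * Psi e s (nb c \<cdot> k)) = 0"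
      unfolding Psi_expand[OF s e k] by (simp only: avg_const mult_zero_right)
    thus ?thesis using k by (simp add: Phi_def)
  qed (simp add: Phi_def)
qed

text \<open>Only units in 1 + p^(dp d) contribute, each giving the value \<open>s k\<close>; they
  have mass q^(-dp d), cancelled by the factor in \<open>Psi\<close>.\<close>

lemma Phi_Psi_eq: assumes s: "s \<in> S1 d" and d: "d \<ge> 1"
  shows "Phi d (Psi d s) = s"
proof
  fix k
  show "Phi d (Psi d s) k = s k"
  proof (cases "K k")
    case k: True
    let ?I = "\<lambda>u. avg (lv d) (\<lambda>c. psi' (- bt d * c) * s (nb (c * u) \<cdot> (tt (An u) \<cdot> k)))"
    have far: "?I u = 0" if u: "unit u" "u - 1 \<notin> P (int (dp d))" for u
    proof (rule S1_char_vanish[OF s K_tt[OF An(1)[OF u(1)] k] u(1) refl])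
      have "bt d * u - bt d = bt d * (u - 1)" by (simp add: algebra_simps)
      moreover have "1 - int (lv d) + int d = int (dp d)" using lv_dp[of d] by simp
      ultimately show "bt d * u - bt d \<notin> P (1 - int (max (lv d) (lv d)))" using u by (simp add: bt_mult)
    qed
    have near: "?I u = s k" if u: "u - 1 \<in> P (int (dp d))" "unit u" for u
    proof (rule avg_const)
      fix c assume c: "c \<in> P (int (lv d))"
      have cu: "c * u \<in> P (int (lv d))" using c u by (simp add: P_unit_mult_right)
      have "N (An u) - 1 = - ((u - 1) * inverse u)" using An(2)[OF u(2)] u(2) by (simp add: field_simps)
      hence "N (An u) - 1 \<in> P (int (dp d))" using u by (simp add: P_unit_mult_right)
      hence 1: "s (tt (An u) \<cdot> k) = s k" by (rule S1_tt[OF s An(1)[OF u(2)] _ k])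
      have 2: "s (nb (c * u) \<cdot> (tt (An u) \<cdot> k)) = psi' (bt d * (c * u)) * s (tt (An u) \<cdot> k)"
        by (rule S1_nb[OF s cu K_tt[OF An(1)[OF u(2)] k]])
      have "bt d * (c * (u - 1)) \<in> P 1"
        unfolding bt_mult using lv_dp[of d] by (intro P_mult'[OF c u(1)]) simp
      hence 3: "psi' (- bt d * c) * psi' (bt d * (c * u)) = 1"
        unfolding psi_add[symmetric] by (intro psi_P) (simp add: algebra_simps)
      show "psi' (- bt d * c) * s (nb (c * u) \<cdot> (tt (An u) \<cdot> k)) = s k"
        unfolding 2 1 using 3 by (metis mult.assoc mult_1)
    qed
    let ?c = "\<lambda>u. if u \<in> P (int (dp d)) then s k else 0"
    have lc: "locconst 0 ?c"
      by (rule avg_restrict(1)[of "dp d" "\<lambda>_. s k" 0]) (auto simp: locconst_def invar_def)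
    have "avg (lv d) (\<lambda>c. psi' (- bt d * c) * Psi d s (nb c \<cdot> k)) = of_nat (q ^ dp d) * avg 0 (\<lambda>u. if unit u then ?I u else 0)"
      by (rule Psi_expand[OF s d k])
    also have "avg 0 (\<lambda>u. if unit u then ?I u else 0) = avg 0 (\<lambda>u. ?c (u + - 1))"
    proof (rule avg_cong)
      fix u :: 'f
      have "unit u" if "u - 1 \<in> P (int (dp d))" using unit_one_plus[OF that] dp_pos[OF d] by simp
      thus "(if unit u then ?I u else 0) = ?c (u + - 1)"
        using far[of u] near[of u] by (cases "u - 1 \<in> P (int (dp d))") auto
    qed
    also have "\<dots> = avg 0 ?c" by (rule avg_translate[OF lc]) simp
    also have "of_nat (q ^ dp d) * avg 0 ?c = avg (dp d) (\<lambda>_. s k)"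
      using avg_restrict(2)[of "dp d" "\<lambda>_. s k" 0] by (simp add: locconst_def invar_def)
    also have "\<dots> = s k" by (rule avg_const) simp
    finally show ?thesis using k by (simp add: Phi_def)
  qed (simp add: Phi_def S1_off[OF s])
qed

lemma VK_decomp: assumes F: "F \<in> VKl n" and n: "n \<ge> 1"
  shows "F k = Pn 1 F k + (\<Sum>d = 1..<n. Psi d (Phi d F) k)"
proof -
  have "(\<Sum>d = 1..<n. Psi d (Phi d F) k) = (\<Sum>d = 1..<n. Pn (Suc d) F k - Pn d F k)"
    using Psi_Phi[OF F] by (intro sum.cong) auto
  also have "\<dots> = Pn n F k - Pn 1 F k" using n by (rule sum_Suc_diff')
  finally show ?thesis using Pn_id[OF F order_refl] by simp
qed


section \<open>Functions of the bottom row\<close>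

lemma bottom_row:
  "m21 (tt a \<cdot> k) = einv eps (econj a) \<odot> m21 k" "m22 (tt a \<cdot> k) = einv eps (econj a) \<odot> m22 k"
  "m21 (ub x \<cdot> k) = m21 k" "m22 (ub x \<cdot> k) = m22 k"
  "m21 (nb c \<cdot> k) = eadd (m21 k) ((0, c) \<odot> m11 k)" "m22 (nb c \<cdot> k) = eadd (m22 k) ((0, c) \<odot> m12 k)"
  by (simp_all add: tmat_def ub_def nb_def mmul_def) (simp_all add: eadd_def add.commute)

text \<open>Left multiplication by the generators of the relevant subgroups and right multiplication
  by K_n all change the bottom row in this manner, so each function of the row needs only one
  congruence lemma.\<close>

definition row_cong :: "int \<Rightarrow> 'f ext \<Rightarrow> 'f mat2 \<Rightarrow> 'f mat2 \<Rightarrow> bool" where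
  "row_cong n w k' k \<longleftrightarrow> esub (m21 k') (w \<odot> m21 k) \<in> OE n \<and> esub (m22 k') (w \<odot> m22 k) \<in> OE n"

lemma row_cong_tt: "row_cong n (einv eps (econj a)) (tt a \<cdot> k) k"
  and row_cong_ub: "row_cong n (1, 0) (ub x \<cdot> k) k"
  by (simp_all add: row_cong_def bottom_row) (simp_all add: esub_def pE_iff)

lemma row_cong_nb: "K k \<Longrightarrow> c \<in> P n \<Longrightarrow> row_cong n (1, 0) (nb c \<cdot> k) k"
proof -
  assume k: "K k" and c: "c \<in> P n"
  have "esub (eadd x y) x = y" for x y :: "'f ext" by (simp add: esub_def eadd_def)
  thus ?thesis using k c by (simp add: row_cong_def bottom_row inK_def OE_multr)
qed

lemma row_cong_right: "K k \<Longrightarrow> inKn v eps n h \<Longrightarrow> row_cong (int n) (1, 0) (k \<cdot> h) k"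
  using congr_mult_left[of k "int n" h mI] by (simp add: inKn_iff row_cong_def congr_def)

lemma OE_cong_UE: assumes "x \<in> UE" "esub y x \<in> OE 1" shows "y \<in> UE"
proof -
  have "einv eps x \<odot> esub y x = esub (einv eps x \<odot> y) (einv eps x \<odot> x)" by (simp add: ext_defs algebra_simps)
  also have "einv eps x \<odot> x = (1, 0)" using emul_inv UE_nz assms by simp
  finally have "esub (einv eps x \<odot> y) (1, 0) \<in> OE 1" using assms OE_unit_mult[of "einv eps x" "esub y x" 1] by simp
  hence "einv eps x \<odot> y \<in> UE" by (rule UE_near_one) simp
  hence "x \<odot> (einv eps x \<odot> y) \<in> UE" using assms UE_mult by blast
  moreover have "x \<odot> (einv eps x \<odot> y) = y" unfolding emul_assoc[symmetric] using emul_inv(1)[OF UE_nz[OF assms(1)]] by simp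
  ultimately show ?thesis by simp
qed

lemma UE_mult_iff: "w \<in> UE \<Longrightarrow> w \<odot> x \<in> UE \<longleftrightarrow> x \<in> UE"
  by (simp add: UE_norm N_mult unit_mult_iff mult.commute[of "N w"])

lemma row_cong_UE: assumes "row_cong n w k' k" "w \<in> UE" "n \<ge> 1"
  shows "m22 k' \<in> UE \<longleftrightarrow> m22 k \<in> UE"
proof -
  have 1: "esub (m22 k') (w \<odot> m22 k) \<in> OE 1" using assms OE_mono unfolding row_cong_def by blast
  have "m22 k' \<in> UE \<longleftrightarrow> w \<odot> m22 k \<in> UE"
    using OE_cong_UE[of "w \<odot> m22 k" "m22 k'"] OE_cong_UE[of "m22 k'" "w \<odot> m22 k"] 1 OE_sub_commute by blast
  thus ?thesis using UE_mult_iff[OF assms(2)] by simp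
qed

text \<open>The preference for \<open>m22\<close> matters: whether \<open>m22\<close> is a unit is
  unchanged under \<open>row_cong\<close>, so congruent rows select the same entry.\<close>

definition row_unit :: "'f mat2 \<Rightarrow> 'f ext" where
  "row_unit k = (if m22 k \<in> UE then m22 k else m21 k)"

lemma row_unit_UE: "K k \<Longrightarrow> row_unit k \<in> UE" using inK_cases[of k] by (auto simp: row_unit_def)

lemma row_unit_cong: assumes "row_cong n w k' k" "w \<in> UE" "n \<ge> 1"
  shows "esub (row_unit k') (w \<odot> row_unit k) \<in> OE n"
  using row_cong_UE[OF assms] assms(1) by (simp add: row_unit_def row_cong_def)

text \<open>The reduction of the bottom row to a point of the projective line over the residue field
  (\<open>None\<close> is the point at infinity).\<close>

definition cls :: "'f mat2 \<Rightarrow> 'f set option" where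
  "cls k = (if m22 k \<in> UE then Some {y \<in> P 0. snd (m21 k \<odot> einv eps (m22 k)) - y \<in> P 1} else None)"

lemma cls_cong: assumes r: "row_cong 1 w k' k" and w: "w \<in> UE" and k: "K k" "K k'"
  shows "cls k' = cls k"
proof (cases "m22 k \<in> UE")
  case True
  let ?c = "m21 k" and ?d = "m22 k" and ?c' = "m21 k'" and ?d' = "m22 k'"
  have d': "?d' \<in> UE" using row_cong_UE[OF r w] True by simp
  have cO: "?c \<in> OE 0" "?c' \<in> OE 0" using k by (auto simp: inK_def)
  \<comment> \<open>Cross-multiplying the two ratios makes the terms with \<open>w\<close>
    cancel.\<close>
  have "esub (?c' \<odot> ?d) (?c \<odot> ?d') = esub (esub ?c' (w \<odot> ?c) \<odot> ?d) (?c \<odot> esub ?d' (w \<odot> ?d))"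
    by (simp add: ext_defs algebra_simps)
  also have "\<dots> \<in> OE 1"
  proof (rule OE_sub)
    show "esub ?c' (w \<odot> ?c) \<odot> ?d \<in> OE 1" by (rule OE_multr) (use r True in \<open>simp_all add: row_cong_def UE_OE\<close>)
    show "?c \<odot> esub ?d' (w \<odot> ?d) \<in> OE 1" by (rule OE_multl) (use r cO in \<open>simp_all add: row_cong_def\<close>)
  qed
  finally have 1: "einv eps (?d \<odot> ?d') \<odot> esub (?c' \<odot> ?d) (?c \<odot> ?d') \<in> OE 1"
    using True d' by (simp add: OE_unit_mult)
  have e: "einv eps (?d \<odot> ?d') = einv eps ?d \<odot> einv eps ?d'" using UE_nz True d' by (simp add: einv_mult)
  have "einv eps (?d \<odot> ?d') \<odot> esub (?c' \<odot> ?d) (?c \<odot> ?d')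
    = esub (?c' \<odot> einv eps ?d' \<odot> (einv eps ?d \<odot> ?d)) (?c \<odot> einv eps ?d \<odot> (einv eps ?d' \<odot> ?d'))"
    unfolding e by (simp add: ext_defs algebra_simps)
  also have "\<dots> = esub (?c' \<odot> einv eps ?d') (?c \<odot> einv eps ?d)"
    using emul_inv(2) UE_nz True d' by simp
  finally have "snd (?c' \<odot> einv eps ?d') - snd (?c \<odot> einv eps ?d) \<in> P 1"
    using 1 by (simp add: pE_iff esub_def)
  moreover have "snd (?c' \<odot> einv eps ?d') \<in> P 0" "snd (?c \<odot> einv eps ?d) \<in> P 0"
    using OE_multr[OF cO(1) UE_OE[OF UE_inv[OF True]]] OE_multr[OF cO(2) UE_OE[OF UE_inv[OF d']]]
    by (simp_all only: pE_iff)
  ultimately show ?thesis unfolding cls_def using True d' residue_class_eq by simp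
next
  case False
  thus ?thesis using row_cong_UE[OF r w] by (simp add: cls_def)
qed

lemma cls_big_cell: assumes "a \<in> UE"
  shows "cls (tt a \<cdot> ub x \<cdot> nb c) = Some {y \<in> P 0. c - y \<in> P 1}"
proof -
  have u: "einv eps (econj a) \<in> UE" using assms by simp
  have "einv eps (econj a) \<odot> (0, c) \<odot> einv eps (einv eps (econj a)) = (0, c)"
    using emul_inv(1)[OF UE_nz[OF u]] by (metis emul_assoc emul_commute emul_one(1))
  thus ?thesis using u by (simp add: cls_def prod_entries)
qed

text \<open>Since K_n is normal in K, \<open>h\<close> can be moved to the left of \<open>k\<close>,
  where its Iwahori factors are absorbed one by one.\<close>

lemma VKl_right: assumes F: "F \<in> VKl n" and n: "n \<ge> 1" and k: "K k" and h: "inKn v eps n h"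
  shows "F (k \<cdot> h) = F k"
proof -
  obtain a x c where d: "a \<in> UE" "x \<in> P (int n)" "c \<in> P (int n)" "k \<cdot> h \<cdot> minv k = tt a \<cdot> ub x \<cdot> nb c"
    using inKn_decomp[OF inKn_conj[OF k h] n] by blast
  have "k \<cdot> h = (k \<cdot> h \<cdot> minv k) \<cdot> k" using minv_left[OF inK_G[OF k]] by (simp add: mm_assoc)
  also have "\<dots> = tt a \<cdot> (ub x \<cdot> (nb c \<cdot> k))" unfolding d(4) by (simp add: mm_assoc)
  finally have e: "k \<cdot> h = tt a \<cdot> (ub x \<cdot> (nb c \<cdot> k))" .
  have x: "x \<in> P 0" using d(2) by (rule P_mono) simp
  have k1: "K (nb c \<cdot> k)" using K_nb d k by blast
  show ?thesis unfolding e
    by (simp only: VKl_tt[OF F d(1) K_ub[OF x k1]] VKl_ub[OF F x k1] VKl_nb[OF F d(3) k])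
qed

text \<open>Any two elements in a fibre of \<open>cls\<close> are connected by the left moves that
  fix level 1 functions: within the big cell by a shift in p, at infinity through
  \<open>mw\<close>.\<close>

lemma VKl_cls: assumes F: "F \<in> VKl 1" and k: "K k" "K k'" and c: "cls k = cls k'"
  shows "F k = F k'"
proof -
  have red: "F (tt a \<cdot> ub x \<cdot> k) = F k" if "a \<in> UE" "x \<in> P 0" "K k" for a x k
    using VKl_tt[OF F that(1) K_ub[OF that(2,3)]] VKl_ub[OF F that(2,3)] by (simp add: mm_assoc)
  show ?thesis
  proof (cases "m22 k \<in> UE")
    case True
    hence "m22 k' \<in> UE" using c by (auto simp: cls_def split: if_splits)
    then obtain a x b a' x' b' where d: "a \<in> UE" "x \<in> P 0" "b \<in> P 0" "k = tt a \<cdot> ub x \<cdot> nb b"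
      "a' \<in> UE" "x' \<in> P 0" "b' \<in> P 0" "k' = tt a' \<cdot> ub x' \<cdot> nb b'"
      using K_decomp[OF k(1)] K_decomp[OF k(2)] True by (metis (no_types, lifting))
    have "{y \<in> P 0. b - y \<in> P 1} = {y \<in> P 0. b' - y \<in> P 1}"
      using c unfolding d(4,8) cls_big_cell[OF d(1)] cls_big_cell[OF d(5)] by simp
    hence bb: "b - b' \<in> P (int 1)" using residue_class_eq d by simp
    have "F k = F (nb b)" unfolding d(4) using d by (intro red) simp_all
    also have "nb b = nb (b - b') \<cdot> nb b'" by (simp add: nb_add)
    also have "F (nb (b - b') \<cdot> nb b') = F (nb b')" using d by (intro VKl_nb[OF F bb]) simp
    also have "\<dots> = F k'" unfolding d(8) using d by (intro red[symmetric]) simp_all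
    finally show ?thesis .
  next
    case False
    have "F k = F mw" if kk: "K k" "m22 k \<notin> UE" for k
    proof -
      obtain a x b where d: "a \<in> UE" "x \<in> P 0" "b \<in> P 1" "k = tt a \<cdot> ub x \<cdot> nb b \<cdot> mw"
        using K_decomp[OF kk(1)] kk(2) by (metis (no_types, lifting))
      have b: "b \<in> P (int 1)" using d by simp
      have "F k = F (tt a \<cdot> ub x \<cdot> (nb b \<cdot> mw))" unfolding d(4) by (simp add: mm_assoc)
      also have "\<dots> = F (nb b \<cdot> mw)" using d K_nb[OF b, of mw] by (intro red) simp_all
      also have "\<dots> = F mw" by (intro VKl_nb[OF F b]) simp
      finally show ?thesis .
    qed
    moreover have "m22 k' \<notin> UE" using c False by (auto simp: cls_def split: if_splits)
    ultimately show ?thesis using False k by simp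
  qed
qed

lemma cls_VKl: "(\<lambda>k. if K k then val (cls k) else 0) \<in> VKl 1"
proof -
  have 1: "cls (tt a \<cdot> k) = cls k" if "a \<in> UE" "K k" for a k
    using cls_cong[OF row_cong_tt _ that(2) K_tt[OF that]] that by simp
  have 2: "cls (ub x \<cdot> k) = cls k" if "x \<in> P 0" "K k" for x k
    using cls_cong[OF row_cong_ub _ that(2) K_ub[OF that]] by simp
  have 3: "cls (nb c \<cdot> k) = cls k" if "c \<in> P (int 1)" "K k" for c k
    using cls_cong[OF row_cong_nb _ that(2) K_nb[OF that]] that by simp
  show ?thesis unfolding VKl_def using K_tt K_ub K_nb[of _ 1] 1 2 3 by simp
qed

abbreviation cls_range :: "'f set option set" where "cls_range \<equiv> insert None (Some ` residue_field v)"

lemma cls_in_range: assumes k: "K k" shows "cls k \<in> cls_range"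
proof (cases "m22 k \<in> UE")
  case True
  have "m21 k \<odot> einv eps (m22 k) \<in> OE 0"
    using k True by (intro OE_multr) (simp_all add: inK_def UE_OE)
  hence "snd (m21 k \<odot> einv eps (m22 k)) \<in> P 0" by (simp add: pE_iff)
  thus ?thesis using True by (simp add: cls_def residue_field_def)
qed (simp add: cls_def)

lemma cls_surj: assumes "C \<in> cls_range" shows "\<exists>k. K k \<and> cls k = C"
proof (cases C)
  case None
  have "cls mw = None" using UE_nz[of "(0, 0)"] by (auto simp: cls_def mw_def)
  thus ?thesis using None by (intro exI[of _ mw]) simp
next
  case (Some D)
  then obtain c where c: "c \<in> P 0" "D = {y \<in> P 0. c - y \<in> P 1}" using assms by (auto simp: residue_field_def)
  have "cls (nb c) = C" using cls_big_cell[of "(1, 0)" 0 c] Some c by simp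
  thus ?thesis using c by (intro exI[of _ "nb c"]) simp
qed

lemma card_cls_range: "card cls_range = q + 1" "finite cls_range"
  using finite_residue_field by (simp_all add: residue_card_def card_image)

section \<open>Linearity\<close>

lemma VKl_linear: "F \<in> VKl n \<Longrightarrow> G \<in> VKl n \<Longrightarrow> (\<lambda>k. c * F k + G k) \<in> VKl n"
  unfolding VKl_def by simp

lemma VKl_zero: "(\<lambda>_. 0) \<in> VKl n" unfolding VKl_def by simp

lemma VKl_sum: "(\<And>d. d \<in> D \<Longrightarrow> G d \<in> VKl n) \<Longrightarrow> (\<lambda>k. \<Sum>d\<in>D. G d k) \<in> VKl n"
proof (induction D rule: infinite_finite_induct)
  case (insert d D)
  have "(\<lambda>k. 1 * G d k + (\<Sum>d\<in>D. G d k)) \<in> VKl n" using insert by (intro VKl_linear) auto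
  thus ?case using insert by simp
qed (simp_all add: VKl_zero)

lemma VK_linear: assumes "F \<in> VK" "G \<in> VK" obtains n where "n \<ge> 1" "F \<in> VKl n" "G \<in> VKl n"
proof -
  obtain i j where "i \<ge> 1" "j \<ge> 1" "F \<in> VKl i" "G \<in> VKl j" using assms by (auto simp: VK_def)
  thus ?thesis using that[of "max i j"] VKl_mono[of F i "max i j"] VKl_mono[of G j "max i j"] by simp
qed

lemma Phi_linear: assumes "F \<in> VKl n" "G \<in> VKl n"
  shows "Phi d (\<lambda>k. c * F k + G k) k = c * Phi d F k + Phi d G k"
proof (cases "K k")
  case True
  have "(\<lambda>x. psi' (- bt d * x) * (c * F (nb x \<cdot> k) + G (nb x \<cdot> k)))
     = (\<lambda>x. c * (psi' (- bt d * x) * F (nb x \<cdot> k)) + psi' (- bt d * x) * G (nb x \<cdot> k))"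
    by (rule ext) (simp only: distrib_left mult.left_commute)
  thus ?thesis using True avg_linear[OF VKl_lc_psi[OF assms(1) True] VKl_lc_psi[OF assms(2) True], of "lv d" c "- bt d" "- bt d"]
    by (simp only: Phi_def if_True)
qed (simp add: Phi_def)

lemma Pn_linear: assumes "F \<in> VKl n" "G \<in> VKl n"
  shows "Pn j (\<lambda>k. c * F k + G k) k = c * Pn j F k + Pn j G k"
  using avg_linear[OF VKl_lc[OF assms(1)] VKl_lc[OF assms(2)], of k k j c] by (simp add: Pn_def)

lemma Phi_zero: "Phi d (\<lambda>_. 0) k = 0" and Pn_zero: "Pn j (\<lambda>_. 0) k = 0"
  by (simp_all add: Phi_def Pn_def avg_const)

lemma Phi_sum: "(\<And>e. e \<in> D \<Longrightarrow> G e \<in> VKl n) \<Longrightarrow> Phi d (\<lambda>k. \<Sum>e\<in>D. G e k) k = (\<Sum>e\<in>D. Phi d (G e) k)"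
proof (induction D rule: infinite_finite_induct)
  case (insert e D)
  have "Phi d (\<lambda>k. 1 * G e k + (\<Sum>e\<in>D. G e k)) k = 1 * Phi d (G e) k + Phi d (\<lambda>k. \<Sum>e\<in>D. G e k) k"
    using insert by (intro Phi_linear VKl_sum) auto
  thus ?case using insert by simp
qed (simp_all add: Phi_zero)

lemma Pn_sum: "(\<And>e. e \<in> D \<Longrightarrow> G e \<in> VKl n) \<Longrightarrow> Pn j (\<lambda>k. \<Sum>e\<in>D. G e k) k = (\<Sum>e\<in>D. Pn j (G e) k)"
proof (induction D rule: infinite_finite_induct)
  case (insert e D)
  have "Pn j (\<lambda>k. 1 * G e k + (\<Sum>e\<in>D. G e k)) k = 1 * Pn j (G e) k + Pn j (\<lambda>k. \<Sum>e\<in>D. G e k) k"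
    using insert by (intro Pn_linear VKl_sum) auto
  thus ?case using insert by simp
qed (simp_all add: Pn_zero)

text \<open>Prescribed components can be realized: by the orthogonality relations the projections
  recover exactly the terms put into the sum.\<close>

lemma synthesis:
  assumes w: "w \<in> VKl 1" and D: "finite D" "\<And>d. d \<in> D \<Longrightarrow> d \<ge> 1 \<and> s d \<in> S1 d"
  defines "F \<equiv> \<lambda>k. w k + (\<Sum>d\<in>D. Psi d (s d) k)"
  shows "F \<in> VK" and "Pn 1 F = w" and "d \<ge> 1 \<Longrightarrow> Phi d F = (if d \<in> D then s d else (\<lambda>_. 0))"
proof -
  \<comment> \<open>A common level for all summands: \<open>Psi d\<close> has level d + 1 and
    \<open>w\<close> has level 1.\<close>
  define n where "n = Max (insert 1 (Suc ` D))"
  have n1: "n \<ge> 1" unfolding n_def using D by (intro Max_ge) auto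
  have "Suc d \<le> n" if "d \<in> D" for d unfolding n_def using D that by (intro Max_ge) auto
  hence G: "Psi d (s d) \<in> VKl n" if "d \<in> D" for d
    using VKl_mono[OF Psi_VKl[of "s d" d], of n] D(2)[OF that] that by simp
  have wn: "w \<in> VKl n" by (rule VKl_mono[OF w n1])
  have S: "(\<lambda>k. \<Sum>d\<in>D. Psi d (s d) k) \<in> VKl n" using G by (rule VKl_sum)
  have F1: "F = (\<lambda>k. 1 * w k + (\<Sum>d\<in>D. Psi d (s d) k))" by (simp add: F_def)
  show "F \<in> VK" unfolding F1 by (rule VKl_VK[OF VKl_linear[OF wn S] n1])
  show "Pn 1 F = w"
  proof
    fix k
    have "Pn 1 F k = 1 * Pn 1 w k + Pn 1 (\<lambda>k. \<Sum>d\<in>D. Psi d (s d) k) k"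
      unfolding F1 by (rule Pn_linear[OF wn S])
    also have "Pn 1 (\<lambda>k. \<Sum>d\<in>D. Psi d (s d) k) k = (\<Sum>d\<in>D. Pn 1 (Psi d (s d)) k)" using G by (rule Pn_sum)
    also have "\<dots> = 0" using P1_Psi D(2) by (intro sum.neutral ballI) simp
    finally show "Pn 1 F k = w k" using Pn_id[OF w order_refl] by simp
  qed
  assume d: "d \<ge> 1"
  show "Phi d F = (if d \<in> D then s d else (\<lambda>_. 0))"
  proof
    fix k
    have "Phi d F k = 1 * Phi d w k + Phi d (\<lambda>k. \<Sum>d\<in>D. Psi d (s d) k) k"
      unfolding F1 by (rule Phi_linear[OF wn S])
    also have "Phi d (\<lambda>k. \<Sum>d\<in>D. Psi d (s d) k) k = (\<Sum>e\<in>D. Phi d (Psi e (s e)) k)" using G by (rule Phi_sum)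
    also have "\<dots> = (\<Sum>e\<in>D. if e = d then s d k else 0)"
    proof (rule sum.cong[OF refl])
      fix e assume "e \<in> D"
      thus "Phi d (Psi e (s e)) k = (if e = d then s d k else 0)"
        using D(2)[of e] Phi_Psi_eq[of "s e" e] Phi_Psi_ne[of "s e" e d] d by auto
    qed
    also have "\<dots> = (if d \<in> D then s d k else 0)" using D(1) by simp
    \<comment> \<open>The level 1 part \<open>w\<close> is annihilated by every \<open>Phi d\<close>
      with d at least 1.\<close>
    finally show "Phi d F k = (if d \<in> D then s d else (\<lambda>_. 0)) k"
      using Phi_vanish[OF w, of d] d by simp
  qed
qed


section \<open>Removing the characters\<close>

text \<open>\<open>tt a\<close> multiplies the bottom row by the inverse conjugate of
  \<open>a\<close>, so taking the inverse conjugate again produces the factor \<open>chi a\<close>.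
  The value 1 off K keeps the function nowhere zero.\<close>

definition rowval :: "('f ext \<Rightarrow> complex) \<Rightarrow> 'f mat2 \<Rightarrow> complex" where
  "rowval chi k = (if K k then chi (einv eps (econj (row_unit k))) else 1)"

definition VK_rep :: "('f mat2, 'f mat2) rep" where
  "VK_rep = (VK, \<lambda>h F k. if K k then F (k \<cdot> h) else 0)"

lemma inKn_K: "inKn v eps n h \<Longrightarrow> K h" by (simp add: inKn_iff)

lemma char_mult: "char_of_Ex eps chi \<Longrightarrow> x \<noteq> (0, 0) \<Longrightarrow> y \<noteq> (0, 0) \<Longrightarrow> chi (x \<odot> y) = chi x * chi y"
  and char_nz: "char_of_Ex eps chi \<Longrightarrow> x \<noteq> (0, 0) \<Longrightarrow> chi x \<noteq> 0"
  unfolding char_of_Ex_def by blast+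

context
  fixes chi :: "'f ext \<Rightarrow> complex" and m :: nat
  assumes chi: "char_of_Ex eps chi" and m: "m \<ge> 1"
    and chi_m: "\<And>a. esub a (1, 0) \<in> OE (int m) \<Longrightarrow> chi a = 1"
begin

lemmas chi_mult = char_mult[OF chi] and chi_nz = char_nz[OF chi]

lemma chi_one: "chi (1, 0) = 1" by (rule chi_m) (simp add: esub_def)

lemma rowval_nz: "rowval chi k \<noteq> 0"
  using row_unit_UE[of k] UE_nz chi_nz by (auto simp: rowval_def)

lemma chi_cong: assumes "x \<in> UE" "y \<in> UE" "esub x y \<in> OE (int m)"
  shows "chi (einv eps (econj x)) = chi (einv eps (econj y))"
proof -
  have u: "econj y \<odot> einv eps (econj x) \<in> UE" using assms by simp
  have "econj (esub y x) \<odot> einv eps (econj x) \<in> OE (int m)"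
    using assms by (intro OE_multr) (simp_all add: UE_OE OE_sub_commute)
  also have "econj (esub y x) \<odot> einv eps (econj x) = esub (econj y \<odot> einv eps (econj x)) (econj x \<odot> einv eps (econj x))"
    by (simp add: ext_defs algebra_simps)
  also have "econj x \<odot> einv eps (econj x) = (1, 0)" using emul_inv(1)[of "econj x"] UE_nz[OF assms(1)] by simp
  finally have 1: "chi (econj y \<odot> einv eps (econj x)) = 1" by (rule chi_m)
  have "econj y \<odot> einv eps (econj y) = (1, 0)" using emul_inv(1)[of "econj y"] UE_nz[OF assms(2)] by simp
  hence e: "einv eps (econj x) = (econj y \<odot> einv eps (econj x)) \<odot> einv eps (econj y)"
    by (metis emul_assoc emul_commute emul_one(1))
  show ?thesis
    using chi_mult[OF UE_nz[OF u], of "einv eps (econj y)"] 1 UE_nz[OF assms(2)] e by simp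
qed

lemma rowval_tt: assumes a: "a \<in> UE" and k: "K k" shows "rowval chi (tt a \<cdot> k) = chi a * rowval chi k"
proof -
  have u: "einv eps (econj a) \<in> UE" using a by simp
  have "row_unit (tt a \<cdot> k) = einv eps (econj a) \<odot> row_unit k"
    using UE_mult_iff[OF u] by (simp add: row_unit_def bottom_row)
  moreover have "einv eps (econj (einv eps (econj a) \<odot> row_unit k)) = a \<odot> einv eps (econj (row_unit k))"
    using UE_nz[OF a] UE_nz[OF row_unit_UE[OF k]] by (simp add: econj_einv einv_mult)
  ultimately show ?thesis using a k UE_nz[OF a] UE_nz[OF row_unit_UE[OF k]]
    by (simp add: rowval_def K_tt chi_mult)
qed

lemma rowval_ub: "x \<in> P 0 \<Longrightarrow> K k \<Longrightarrow> rowval chi (ub x \<cdot> k) = rowval chi k"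
  by (simp add: rowval_def K_ub row_unit_def bottom_row)

lemma rowval_cong: assumes "row_cong (int m) (1, 0) k' k" "K k" "K k'"
  shows "rowval chi k' = rowval chi k"
proof -
  have "esub (row_unit k') (row_unit k) \<in> OE (int m)" using row_unit_cong[OF assms(1)] m by simp
  thus ?thesis using chi_cong[OF row_unit_UE[OF assms(3)] row_unit_UE[OF assms(2)]] assms by (simp add: rowval_def)
qed

lemma rowval_right: "K k \<Longrightarrow> inKn v eps m h \<Longrightarrow> rowval chi (k \<cdot> h) = rowval chi k"
  using rowval_cong[OF row_cong_right] inK_mult inKn_K by blast

lemma rowval_nb: "K k \<Longrightarrow> c \<in> P (int m) \<Longrightarrow> rowval chi (nb c \<cdot> k) = rowval chi k"
  using rowval_cong[OF row_cong_nb] K_nb by blast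

section \<open>Restriction of the principal series to the compact group\<close>

abbreviation PS :: "('f mat2 \<Rightarrow> complex) set" where "PS \<equiv> fst (principal_series v eps chi)"

lemma borel_elements: "a \<noteq> (0, 0) \<Longrightarrow> inB eps (tt a \<cdot> ub x)" "m11 (tt a \<cdot> ub x) = a"
  by (simp_all add: inB_def inG_mult) (simp_all add: tmat_def ub_def mmul_def)

lemma PS_borel: assumes "f \<in> PS" "a \<noteq> (0, 0)" "inG eps g" shows "f (tt a \<cdot> ub x \<cdot> g) = chi a * f g"
  using assms borel_elements[of a x] by (simp add: principal_series_def)

lemma PS_off: "f \<in> PS \<Longrightarrow> \<not> inG eps g \<Longrightarrow> f g = 0"
  by (simp add: principal_series_def)

definition restr :: "('f mat2 \<Rightarrow> complex) \<Rightarrow> 'f mat2 \<Rightarrow> complex" where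
  "restr f k = (if K k then f k / rowval chi k else 0)"

lemma restr_VK: assumes f: "f \<in> PS" shows "restr f \<in> VK"
proof -
  obtain n where n: "n \<ge> 1" "\<And>g k. inG eps g \<Longrightarrow> inKn v eps n k \<Longrightarrow> f (g \<cdot> k) = f g"
    using f by (auto simp: principal_series_def)
  have "restr f \<in> VKl (max n m)"
    unfolding VKl_def
  proof (intro CollectI conjI allI impI)
    fix k assume "\<not> K k" thus "restr f k = 0" by (simp add: restr_def)
  next
    fix a k assume ak: "a \<in> UE" "K k"
    have "f (tt a \<cdot> k) = chi a * f k" using PS_borel[OF f UE_nz[OF ak(1)] inK_G[OF ak(2)], of 0] by simp
    thus "restr f (tt a \<cdot> k) = restr f k"
      using ak rowval_tt[OF ak] chi_nz[OF UE_nz[OF ak(1)]] by (simp add: restr_def K_tt)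
  next
    fix x k assume xk: "x \<in> P 0" "K k"
    have "f (ub x \<cdot> k) = f k" using PS_borel[OF f _ inK_G[OF xk(2)], of "(1, 0)" x] chi_one by simp
    thus "restr f (ub x \<cdot> k) = restr f k" using xk rowval_ub[OF xk] by (simp add: restr_def K_ub)
  next
    fix c k assume c: "c \<in> P (int (max n m))" and k: "K k"
    have G: "inG eps k" using k by (rule inK_G)
    \<comment> \<open>Smoothness is right invariance; normality of the congruence subgroup converts
      it to left invariance under small lower unipotents.\<close>
    have "nb c \<cdot> k = k \<cdot> (minv k \<cdot> nb c \<cdot> k)" by (simp add: mm_assoc minv_cancel[OF G])
    moreover have "inKn v eps n (minv k \<cdot> nb c \<cdot> k)"
      by (rule inKn_mono[OF inKn_conj'[OF k inKn_nb[OF c]]]) simp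
    ultimately have "f (nb c \<cdot> k) = f k" using n(2)[OF G] by simp
    moreover have "c \<in> P (int m)" using c by (rule P_mono) simp
    ultimately show "restr f (nb c \<cdot> k) = restr f k"
      using k rowval_nb[OF k] K_nb[OF c k] by (simp add: restr_def)
  qed
  thus ?thesis by (rule VKl_VK) (use n(1) in simp)
qed

lemma restr_inj: assumes f: "f \<in> PS" "f' \<in> PS" and e: "restr f = restr f'" shows "f = f'"
proof
  fix g
  show "f g = f' g"
  proof (cases "inG eps g")
    case True
    then obtain a x k where d: "a \<noteq> (0, 0)" "K k" "g = tt a \<cdot> ub x \<cdot> k" by (rule iwasawa)
    have "f k = f' k" using fun_cong[OF e, of k] d(2) rowval_nz by (simp add: restr_def)
    thus ?thesis
      using PS_borel[OF f(1) d(1) inK_G[OF d(2)]] PS_borel[OF f(2) d(1) inK_G[OF d(2)]] d(3) by simp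
  qed (simp add: PS_off[OF f(1)] PS_off[OF f(2)])
qed

text \<open>Iwasawa factorizations are not unique, so the value is taken from some factorization;
  independence is \<open>extend_well_defined\<close>.\<close>

definition extend :: "('f mat2 \<Rightarrow> complex) \<Rightarrow> 'f mat2 \<Rightarrow> complex" where
  "extend F g = (if inG eps g then
     (SOME y. \<exists>a x k. a \<noteq> (0, 0) \<and> K k \<and> g = tt a \<cdot> ub x \<cdot> k \<and> y = chi a * rowval chi k * F k) else 0)"

lemma K_borel: assumes k: "K b" and z: "m21 b = (0, 0)"
  obtains a x where "a \<in> UE" "x \<in> P 0" "b = tt a \<cdot> ub x"
proof -
  have "m22 b \<in> UE" using inK_cases[OF k] z UE_nz by auto
  then obtain a x c where d: "a \<in> UE" "x \<in> P 0" "b = tt a \<cdot> ub x \<cdot> nb c" "\<And>n. c \<in> P n \<longleftrightarrow> m21 b \<in> OE n"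
    using big_cell_K[of b] k unfolding inK_def by metis
  have "c = 0" using d(4) z by (intro P_eq_zero) simp
  thus ?thesis using that d by simp
qed

text \<open>Two factorizations differ by an element of the Borel subgroup lying in K. On such
  elements \<open>rowval\<close> transforms by \<open>chi\<close> and \<open>F\<close> is
  invariant.\<close>

lemma extend_well_defined:
  assumes F: "F \<in> VKl n" and a: "a \<noteq> (0, 0)" "a' \<noteq> (0, 0)" and k: "K k" "K k'"
    and e: "tt a \<cdot> ub x \<cdot> k = tt a' \<cdot> ub x' \<cdot> k'"
  shows "chi a * rowval chi k * F k = chi a' * rowval chi k' * F k'"
proof -
  define b b' where "b = tt a \<cdot> ub x" and "b' = tt a' \<cdot> ub x'"
  have G: "inG eps b" "inG eps b'" using a by (simp_all add: b_def b'_def inG_mult)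
  define c where "c = minv b' \<cdot> b"
  have "minv b' \<cdot> (b \<cdot> k) = k'" using e minv_cancel(1)[OF G(2)] by (simp add: b_def b'_def)
  hence k': "k' = c \<cdot> k" by (simp add: c_def mm_assoc)
  \<comment> \<open>\<open>c\<close> is a quotient of Borel elements by definition and a quotient of
    elements of K by this identity.\<close>
  have "c = k' \<cdot> minv k" unfolding k' using minv_right[OF inK_G[OF k(1)]] by (simp add: mm_assoc)
  hence cK: "K c" using k by (simp add: inK_mult inK_minv)
  have "m21 b = (0, 0)" "m21 b' = (0, 0)" using borel_elements(1)[OF a(1)] borel_elements(1)[OF a(2)]
    by (simp_all add: b_def b'_def inB_def)
  hence "m21 c = (0, 0)" by (simp add: c_def mmul_def minv_def)
  then obtain t y where t: "t \<in> UE" "y \<in> P 0" "c = tt t \<cdot> ub y" using K_borel[OF cK] by blast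
  have "b = b' \<cdot> c" by (simp add: c_def minv_cancel[OF G(2)])
  hence "m11 b = m11 b' \<odot> m11 c" using t(3) by (simp add: mmul_def tmat_def ub_def)
  hence at: "a = a' \<odot> t" by (simp add: b_def b'_def t(3) borel_elements)
  have kt: "k' = tt t \<cdot> (ub y \<cdot> k)" by (simp add: k' t(3) mm_assoc)
  have yk: "K (ub y \<cdot> k)" using K_ub t k by blast
  have "rowval chi k' = chi t * rowval chi k"
    unfolding kt using rowval_tt[OF t(1) yk] rowval_ub[OF t(2) k(1)] by simp
  moreover have "F k' = F k" unfolding kt by (simp only: VKl_tt[OF F t(1) yk] VKl_ub[OF F t(2) k(1)])
  ultimately show ?thesis using chi_mult[OF a(2) UE_nz[OF t(1)]] by (simp add: at)
qed

lemma extend_eq: assumes F: "F \<in> VKl n" and a: "a \<noteq> (0, 0)" and k: "K k"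
  shows "extend F (tt a \<cdot> ub x \<cdot> k) = chi a * rowval chi k * F k"
proof -
  let ?g = "tt a \<cdot> ub x \<cdot> k"
  let ?Q = "\<lambda>y. \<exists>a x k. a \<noteq> (0, 0) \<and> K k \<and> ?g = tt a \<cdot> ub x \<cdot> k \<and> y = chi a * rowval chi k * F k"
  have "?Q (chi a * rowval chi k * F k)" using a k by blast
  hence "?Q (SOME y. ?Q y)" by (rule someI)
  then obtain a' x' k' where d: "a' \<noteq> (0, 0)" "K k'" "?g = tt a' \<cdot> ub x' \<cdot> k'" "(SOME y. ?Q y) = chi a' * rowval chi k' * F k'" by blast
  moreover have "inG eps ?g" using a inK_G[OF k] by (simp add: inG_mult)
  ultimately show ?thesis using extend_well_defined[OF F a d(1) k d(2,3)] by (simp add: extend_def)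
qed

lemma extend_PS: assumes F: "F \<in> VKl n" and n: "n \<ge> 1" shows "extend F \<in> PS"
  unfolding principal_series_def fst_conv
proof (intro CollectI conjI allI impI)
  fix g assume "\<not> inG eps g" thus "extend F g = 0" by (simp add: extend_def)
next
  fix b g assume b: "inB eps b" and g: "inG eps g"
  obtain t y where t: "t \<noteq> (0, 0)" "b = tt t \<cdot> ub y" "m11 b = t" using b by (rule borel_decomp)
  obtain a x k where d: "a \<noteq> (0, 0)" "K k" "g = tt a \<cdot> ub x \<cdot> k" using g by (rule iwasawa)
  have "ub y \<cdot> tt a = tt a \<cdot> ub (y / N a)" using tt_ub[OF d(1), of "y / N a"] d(1) by simp
  hence "ub y \<cdot> (tt a \<cdot> (ub x \<cdot> k)) = tt a \<cdot> (ub (y / N a) \<cdot> (ub x \<cdot> k))" by (simp flip: mm_assoc)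
  hence "b \<cdot> g = tt t \<cdot> (tt a \<cdot> (ub (y / N a) \<cdot> (ub x \<cdot> k)))" by (simp add: t(2) d(3) mm_assoc)
  also have "\<dots> = tt (t \<odot> a) \<cdot> ub (y / N a + x) \<cdot> k" by (simp add: tt_mult[OF t(1) d(1)] ub_add flip: mm_assoc)
  finally have "b \<cdot> g = tt (t \<odot> a) \<cdot> ub (y / N a + x) \<cdot> k" .
  moreover have "t \<odot> a \<noteq> (0, 0)" using t d by (simp add: emul_eq_zero)
  ultimately show "extend F (b \<cdot> g) = chi (m11 b) * extend F g"
    using extend_eq[OF F] d t(1,3) by (simp add: chi_mult)
next
  show "\<exists>n\<ge>1. \<forall>g k. inG eps g \<longrightarrow> inKn v eps n k \<longrightarrow> extend F (g \<cdot> k) = extend F g"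
  proof (intro exI[of _ "max n m"] conjI allI impI)
    fix g h assume g: "inG eps g" and h: "inKn v eps (max n m) h"
    obtain a x k where d: "a \<noteq> (0, 0)" "K k" "g = tt a \<cdot> ub x \<cdot> k" using g by (rule iwasawa)
    have hn: "inKn v eps n h" "inKn v eps m h" using h by (auto intro: inKn_mono)
    have "g \<cdot> h = tt a \<cdot> ub x \<cdot> (k \<cdot> h)" by (simp add: d(3) mm_assoc)
    moreover have "K (k \<cdot> h)" using d(2) inKn_K[OF h] by (rule inK_mult)
    ultimately show "extend F (g \<cdot> h) = extend F g"
      using extend_eq[OF F d(1)] d rowval_right[OF d(2) hn(2)] VKl_right[OF F n d(2) hn(1)] by simp
  qed (use n in simp)
qed

lemma restr_extend: assumes F: "F \<in> VKl n" shows "restr (extend F) = F"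
proof
  fix k
  show "restr (extend F) k = F k"
  proof (cases "K k")
    case True
    have "extend F k = rowval chi k * F k" using extend_eq[OF F _ True, of "(1, 0)" 0] chi_one by simp
    thus ?thesis using True rowval_nz by (simp add: restr_def)
  qed (simp add: restr_def VKl_off[OF F])
qed

text \<open>Restriction to K and division by \<open>rowval\<close> commute with right translation by
  \<open>h\<close> precisely when \<open>rowval\<close> is fixed by \<open>h\<close>, which K_m
  guarantees.\<close>

lemma principal_series_restriction:
  "rep_iso (inKn v eps m) (principal_series v eps chi) VK_rep"
  unfolding rep_iso_def
proof (intro exI[of _ restr] conjI ballI allI impI)
  show "bij_betw restr PS (fst VK_rep)"
    unfolding bij_betw_def VK_rep_def fst_conv
  proof (intro conjI inj_onI subset_antisym subsetI)
    fix F assume "F \<in> VK"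
    then obtain n where "n \<ge> 1" "F \<in> VKl n" by (auto simp: VK_def)
    thus "F \<in> restr ` PS" using extend_PS restr_extend by (metis imageI)
  qed (use restr_inj restr_VK in auto)
next
  fix f g c show "restr (\<lambda>x. c * f x + g x) = (\<lambda>y. c * restr f y + restr g y)"
    by (rule ext) (simp add: restr_def add_divide_distrib)
next
  fix h f assume h: "inKn v eps m h" and f: "f \<in> PS"
  show "restr (snd (principal_series v eps chi) h f) = snd VK_rep h (restr f)"
    using rowval_right[OF _ h] inKn_K[OF h] inK_G
    by (intro ext) (simp add: restr_def VK_rep_def principal_series_def inK_mult)
qed

end


section \<open>The centre and its character\<close>

lemma norm_one_UE: "N z = 1 \<Longrightarrow> z \<in> UE" by (simp add: UE_norm)

lemma norm_one_inv: assumes "N z = 1" shows "einv eps (econj z) = z"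
  unfolding einv_econj assms by simp

lemma central_eq: "N z = 1 \<Longrightarrow> mk z (0, 0) (0, 0) z = tt z"
  by (simp add: tmat_def norm_one_inv)

lemma inZ_iff: "inZ eps g \<longleftrightarrow> (\<exists>z. N z = 1 \<and> g = tt z)"
proof
  assume "inZ eps g"
  then obtain z where z: "inG eps g" "g = mk z (0, 0) (0, 0) z" by (auto simp: inZ_def)
  have "econj z \<odot> z = (1, 0)" using minv_left[OF z(1)] unfolding z(2) by (simp add: mat_eq_iff mmul_def minv_def mI_def)
  hence "N z = 1" by (simp add: ext_defs enorm_def power2_eq_square mult_ac)
  thus "\<exists>z. N z = 1 \<and> g = tt z" using z(2) central_eq by (intro exI[of _ z]) simp
next
  assume "\<exists>z. N z = 1 \<and> g = tt z"
  then obtain z where z: "N z = 1" "g = tt z" by blast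
  thus "inZ eps g" using inG_tt[OF UE_nz[OF norm_one_UE[OF z(1)]]] central_eq[OF z(1)] unfolding inZ_def by metis
qed

text \<open>Only \<open>m21\<close> survives in the trace. The factor \<open>eps\<close> in
  \<open>bt\<close> is the product of sqrt eps from X with sqrt eps from the lower left
  entry.\<close>

lemma PsiJ_eq: "PsiJ eps w0 psi' d j = psi' (bt d * snd (m21 j))"
proof -
  let ?x = "eps * inverse w0 ^ d * snd (m21 j)"
  have "(?x + ?x) / 2 = ?x" by (simp flip: mult_2)
  thus ?thesis
    by (simp add: PsiJ_def psiE_def mtr_def Xd_def msub_def mI_def mmul_def ext_defs bt_def) (simp add: mult_ac)
qed

lemma norm_near_one: assumes "esub a (1, 0) \<in> OE n" "n \<ge> 0" shows "N a - 1 \<in> P n"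
proof -
  have f: "fst a - 1 \<in> P n" and s: "snd a \<in> P n" using assms by (auto simp: pE_iff esub_def)
  have "fst a \<in> P 0" using P_add[of "fst a - 1" 0 1] P_mono[OF f assms(2)] by simp
  hence "(fst a - 1) * (fst a + 1) \<in> P n" using f by (intro P_multr P_add) simp_all
  moreover have "eps * (snd a * snd a) \<in> P n" using s P_mono[OF s assms(2)] by (simp add: P_multl)
  moreover have "N a - 1 = (fst a - 1) * (fst a + 1) - eps * (snd a * snd a)"
    by (simp add: enorm_def power2_eq_square algebra_simps)
  ultimately show ?thesis by (simp only: P_diff)
qed

text \<open>The norm has a square root s in F close to 1, and a / s has norm one: a central factor
  times a torus element of J_d.\<close>

lemma norm_decomp: assumes a: "a \<in> UE" and n: "N a - 1 \<in> P n" "n \<ge> 1"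
  obtains z s where "N z = 1" "unit s" "s - 1 \<in> P n" "a = z \<odot> (s, 0)"
proof -
  obtain s where s: "s * s = N a" "s - 1 \<in> P n" by (rule sqrt_one_plus[OF n])
  have us: "unit s" by (rule unit_one_plus[OF s(2) n(2)])
  have "N (a \<odot> (inverse s, 0)) = N a * (inverse s * inverse s)" unfolding N_mult by (simp add: enorm_def power2_eq_square)
  also have "\<dots> = 1" unfolding s(1)[symmetric] using unit_nz[OF us] by (simp add: field_simps)
  finally have 1: "N (a \<odot> (inverse s, 0)) = 1" .
  have "(inverse s, 0) \<odot> (s, 0) = (1, 0)" using us by (simp add: emul_def)
  hence "a = a \<odot> (inverse s, 0) \<odot> (s, 0)" by (simp only: emul_assoc emul_one)
  thus ?thesis using that[OF 1 us s(2)] by blast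
qed

text \<open>Extends \<open>chi\<close> on norm-one elements to a function on units modulo \<open>1 + \<pp>\<^sub>E\<close>, equivariant under the
  norm-one elements, by choosing a representative in every orbit.\<close>

definition central_rel :: "'f ext \<Rightarrow> 'f ext \<Rightarrow> bool" where
  "central_rel a b \<longleftrightarrow> (\<exists>z. N z = 1 \<and> esub a (z \<odot> b) \<in> OE 1)"

definition central_rep :: "'f ext \<Rightarrow> 'f ext" where
  "central_rep a = (SOME b. b \<in> UE \<and> central_rel a b)"

definition central_val :: "('f ext \<Rightarrow> complex) \<Rightarrow> 'f ext \<Rightarrow> complex" where
  "central_val chi a = chi (SOME z. N z = 1 \<and> esub a (z \<odot> central_rep a) \<in> OE 1)"

text \<open>The counterpart of \<open>rowval\<close> for the spaces S_d. It must be fixed by all of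
  K_1, including torus elements near 1 on which \<open>chi\<close> itself can be nontrivial.\<close>

definition rowcentral :: "('f ext \<Rightarrow> complex) \<Rightarrow> 'f mat2 \<Rightarrow> complex" where
  "rowcentral chi k = (if K k then central_val chi (row_unit k) else 1)"

lemma central_rel_trans: assumes "esub a' (w \<odot> a) \<in> OE 1" "N w = 1" shows "central_rel a' b \<longleftrightarrow> central_rel a b"
proof -
  have step: "central_rel a' b" if h: "esub a' (w \<odot> a) \<in> OE 1" "N w = 1" "central_rel a b" for a a' w
  proof -
    obtain z where z: "N z = 1" "esub a (z \<odot> b) \<in> OE 1" using h(3) by (auto simp: central_rel_def)
    have "eadd (esub a' (w \<odot> a)) (w \<odot> esub a (z \<odot> b)) \<in> OE 1"
      using h z by (intro OE_add) (simp_all add: OE_unit_mult norm_one_UE)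
    moreover have "eadd (esub a' (w \<odot> a)) (w \<odot> esub a (z \<odot> b)) = esub a' ((w \<odot> z) \<odot> b)"
      by (simp add: ext_defs algebra_simps)
    ultimately show ?thesis using h z unfolding central_rel_def by (intro exI[of _ "w \<odot> z"]) (simp add: N_mult)
  qed
  have "esub a (econj w \<odot> a') = esub (0, 0) (econj w \<odot> esub a' (w \<odot> a))"
  proof -
    have e: "econj w \<odot> w = (1, 0)" using assms(2) by (simp add: ext_defs enorm_def power2_eq_square mult_ac)
    have "esub (0, 0) (econj w \<odot> esub a' (w \<odot> a)) = esub ((econj w \<odot> w) \<odot> a) (econj w \<odot> a')"
      by (simp add: ext_defs algebra_simps)
    thus ?thesis unfolding e by simp
  qed
  also have "\<dots> \<in> OE 1" using assms by (intro OE_sub) (simp_all add: OE_unit_mult norm_one_UE)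
  finally have "esub a (econj w \<odot> a') \<in> OE 1" .
  thus ?thesis using step[OF assms] step[of a "econj w" a'] assms(2) by auto
qed

lemma central_rep: assumes "a \<in> UE" shows "central_rep a \<in> UE \<and> central_rel a (central_rep a)"
  unfolding central_rep_def
proof (rule someI[of _ a])
  have "esub a ((1, 0) \<odot> a) \<in> OE 1" by (simp add: esub_def)
  thus "a \<in> UE \<and> central_rel a a" using assms unfolding central_rel_def by (intro conjI exI[of _ "(1, 0)"]) simp_all
qed

context
  fixes chi :: "'f ext \<Rightarrow> complex"
  assumes chi: "char_of_Ex eps chi"
    and central: "\<And>z. N z = 1 \<Longrightarrow> esub z (1, 0) \<in> OE 1 \<Longrightarrow> chi z = 1"
begin

text \<open>The quotient of the two norm-one elements has norm one and is 1 modulo p_E, where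
  \<open>chi\<close> is trivial; thus the value of \<open>central_val\<close> is independent of the
  chosen \<open>z\<close>.\<close>

lemma central_cong: assumes "N z = 1" "N w = 1" "b \<in> UE" "esub (z \<odot> b) (w \<odot> b) \<in> OE 1" shows "chi z = chi w"
proof -
  have "b \<odot> (esub z w) = esub (z \<odot> b) (w \<odot> b)" by (simp add: ext_defs algebra_simps)
  hence "esub z w \<in> OE 1" using assms OE_unit_mult[of b "esub z w" 1] by simp
  hence "econj w \<odot> esub z w \<in> OE 1" using assms by (simp add: OE_unit_mult norm_one_UE)
  also have "econj w \<odot> esub z w = esub (econj w \<odot> z) (econj w \<odot> w)" by (simp add: ext_defs algebra_simps)
  also have e: "econj w \<odot> w = (1, 0)" using assms(2) by (simp add: ext_defs enorm_def power2_eq_square mult_ac)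
  finally have "chi (econj w \<odot> z) = 1" using assms by (intro central) (simp_all add: N_mult)
  hence "chi (w \<odot> (econj w \<odot> z)) = chi w"
    using char_mult[OF chi UE_nz[OF norm_one_UE[OF assms(2)]], of "econj w \<odot> z"]
      UE_nz[OF norm_one_UE[OF assms(1)]] UE_nz[OF norm_one_UE[OF assms(2)]] by (simp add: emul_eq_zero)
  moreover have "w \<odot> (econj w \<odot> z) = z" using e by (metis emul_assoc emul_commute emul_one(2))
  ultimately show ?thesis by simp
qed

lemma central_val: assumes a: "a \<in> UE" and z: "N z = 1" "esub a (z \<odot> central_rep a) \<in> OE 1"
  shows "central_val chi a = chi z"
proof -
  define w where "w = (SOME z. N z = 1 \<and> esub a (z \<odot> central_rep a) \<in> OE 1)"
  have "N w = 1 \<and> esub a (w \<odot> central_rep a) \<in> OE 1" unfolding w_def by (rule someI[of _ z]) (use z in simp)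
  hence w: "N w = 1" "esub a (w \<odot> central_rep a) \<in> OE 1" by auto
  have "esub (esub a (z \<odot> central_rep a)) (esub a (w \<odot> central_rep a)) \<in> OE 1" by (rule OE_sub[OF z(2) w(2)])
  moreover have "esub (esub a x) (esub a y) = esub y x" for x y :: "'f ext" by (simp add: esub_def)
  ultimately have "esub (w \<odot> central_rep a) (z \<odot> central_rep a) \<in> OE 1" by simp
  hence "chi w = chi z" using central_rep[OF a] by (intro central_cong[OF w(1) z(1)]) auto
  thus ?thesis by (simp add: central_val_def w_def)
qed

lemma central_val_nz: assumes a: "a \<in> UE" shows "central_val chi a \<noteq> 0"
proof -
  obtain z where z: "N z = 1" "esub a (z \<odot> central_rep a) \<in> OE 1"
    using central_rep[OF a] by (auto simp: central_rel_def)
  show ?thesis unfolding central_val[OF a z] by (rule char_nz[OF chi UE_nz[OF norm_one_UE[OF z(1)]]])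
qed

lemma central_val_cong: assumes a: "a \<in> UE" "a' \<in> UE" and w: "N w = 1" "esub a' (w \<odot> a) \<in> OE 1"
  shows "central_val chi a' = chi w * central_val chi a"
proof -
  \<comment> \<open>The choice is made from a predicate depending only on the orbit, so both units
    receive the same representative.\<close>
  have r: "central_rep a' = central_rep a" unfolding central_rep_def central_rel_trans[OF w(2,1)] ..
  obtain z where z: "N z = 1" "esub a (z \<odot> central_rep a) \<in> OE 1"
    using central_rep[OF a(1)] by (auto simp: central_rel_def)
  have "eadd (esub a' (w \<odot> a)) (w \<odot> esub a (z \<odot> central_rep a)) \<in> OE 1"
    using w z by (intro OE_add) (simp_all add: OE_unit_mult norm_one_UE)
  moreover have "eadd (esub a' (w \<odot> a)) (w \<odot> esub a (z \<odot> b)) = esub a' ((w \<odot> z) \<odot> b)" for b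
    by (simp add: ext_defs algebra_simps)
  ultimately have "esub a' ((w \<odot> z) \<odot> central_rep a') \<in> OE 1" by (simp add: r)
  hence "central_val chi a' = chi (w \<odot> z)" using w z by (intro central_val[OF a(2)]) (simp_all add: N_mult)
  thus ?thesis
    using central_val[OF a(1) z] char_mult[OF chi, of w z] UE_nz[OF norm_one_UE[OF w(1)]] UE_nz[OF norm_one_UE[OF z(1)]] by simp
qed

lemma chi_1: "chi (1, 0) = 1" by (rule central) (simp_all add: esub_def)

abbreviation yy where "yy \<equiv> rowcentral chi"

lemma yy_nz: "yy k \<noteq> 0"
  using central_val_nz[OF row_unit_UE] by (simp add: rowcentral_def)

lemma yy_cong: assumes r: "row_cong 1 w k' k" and k: "K k" "K k'" and w: "N w = 1" shows "yy k' = chi w * yy k"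
  using central_val_cong[OF row_unit_UE[OF k(1)] row_unit_UE[OF k(2)] w row_unit_cong[OF r norm_one_UE[OF w]]] k
  by (simp add: rowcentral_def)

lemma yy_cong1: assumes "row_cong 1 (1, 0) k' k" "K k" "K k'" shows "yy k' = yy k"
  using yy_cong[OF assms] chi_1 by simp

lemma yy_right: "K k \<Longrightarrow> inKn v eps 1 h \<Longrightarrow> yy (k \<cdot> h) = yy k"
  using yy_cong1[of "k \<cdot> h" k] row_cong_right[of k 1 h] inK_mult inKn_K by simp

lemma yy_ub: "K k \<Longrightarrow> x \<in> P 0 \<Longrightarrow> yy (ub x \<cdot> k) = yy k"
  by (rule yy_cong1[OF row_cong_ub]) (simp_all add: K_ub)

lemma yy_nb: "K k \<Longrightarrow> c \<in> P (int n) \<Longrightarrow> n \<ge> 1 \<Longrightarrow> yy (nb c \<cdot> k) = yy k"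
  using P_mono[of c "int n" 1] by (intro yy_cong1 row_cong_nb K_nb) simp_all

lemma yy_central: assumes "N z = 1" "K k" shows "yy (tt z \<cdot> k) = chi z * yy k"
  using yy_cong[OF row_cong_tt assms(2) K_tt] assms norm_one_UE by (simp add: norm_one_inv)

lemma yy_tt_near_one: assumes a: "esub a (1, 0) \<in> OE n" "n \<ge> 1" and k: "K k" shows "yy (tt a \<cdot> k) = yy k"
proof -
  have aU: "a \<in> UE" by (rule UE_near_one[OF a])
  have "inKn v eps 1 (tt a)"
  proof -
    have a1: "esub a (1, 0) \<in> OE 1" using a by (rule OE_mono)
    have u: "einv eps (econj a) \<in> UE" using aU by simp
    have "einv eps (econj a) \<odot> esub (econj (1, 0)) (econj a) = esub (einv eps (econj a)) (einv eps (econj a) \<odot> econj a)"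
      by (simp add: ext_defs algebra_simps)
    also have "einv eps (econj a) \<odot> econj a = (1, 0)" using emul_inv(2)[of "econj a"] UE_nz[OF aU] by simp
    finally have "esub (einv eps (econj a)) (1, 0) = einv eps (econj a) \<odot> esub (econj (1, 0)) (econj a)" by simp
    also have "esub (econj (1, 0)) (econj a) = econj (esub (1, 0) a)" by (simp add: ext_defs)
    finally have "esub (einv eps (econj a)) (1, 0) \<in> OE 1"
      using a1 u by (simp add: OE_unit_mult OE_sub_commute)
    thus ?thesis using aU a1 by (simp add: inKn_iff congr_def) (simp add: tmat_def mI_def)
  qed
  hence h: "inKn v eps 1 (minv k \<cdot> tt a \<cdot> k)" by (rule inKn_conj'[OF k])
  have "tt a \<cdot> k = k \<cdot> (minv k \<cdot> tt a \<cdot> k)" by (simp add: mm_assoc minv_cancel[OF inK_G[OF k]])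
  thus ?thesis using yy_right[OF k h] by simp
qed

text \<open>The inducing subgroup is generated by the centre, the upper unipotents in K and the
  three factors of J_d. Testing on these generators and dividing by \<open>yy\<close> gives exactly
  the conditions of \<open>S1 d\<close>.\<close>

lemma S_space_iff: assumes d: "d \<ge> 1"
  shows "f \<in> S_space v eps w0 psi' chi d \<longleftrightarrow> (\<lambda>k. f k / yy k) \<in> S1 d"
proof
  assume f: "f \<in> S_space v eps w0 psi' chi d"
  have off: "f k = 0" if "\<not> K k" for k using f that by (simp add: S_space_def)
  have eq: "f (tt z \<cdot> u \<cdot> j \<cdot> k) = chi z * psi' (bt d * snd (m21 j)) * f k"
    if "N z = 1" "inU u" "K u" "inJ v eps d j" "K k" for z u j k
  proof -
    have "inZ eps (tt z)" using that(1) inZ_iff by blast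
    hence "f (tt z \<cdot> u \<cdot> j \<cdot> k) = chi (m11 (tt z)) * PsiJ eps w0 psi' d j * f k"
      using f that unfolding S_space_def by blast
    thus ?thesis by (simp add: PsiJ_eq tmat_def)
  qed
  have U: "inU (ub x)" for x by (auto simp: inU_def ub_def)
  have m0: "m21 (mI :: 'f mat2) = (0, 0)" by (simp add: mI_def)
  have U1: "inU (mI :: 'f mat2)" using U[of 0] by simp
  have J1: "inJ v eps d mI" unfolding inJ_def using inG_mI by (simp add: mI_def esub_def)
  show "(\<lambda>k. f k / yy k) \<in> S1 d"
    unfolding S1_def
  proof (intro CollectI conjI allI impI)
    fix k assume "\<not> K k" thus "f k / yy k = 0" by (simp add: off)
  next
    fix a k assume a: "a \<in> UE" and n: "N a - 1 \<in> P (int (dp d))" and k: "K k"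
    \<comment> \<open>The factor \<open>z\<close> is central and contributes \<open>chi z\<close>,
      which \<open>yy\<close> cancels; the factor \<open>s\<close> lies in J_d, where its character
      value is 1.\<close>
    obtain z s where z: "N z = 1" "unit s" "s - 1 \<in> P (int (dp d))" "a = z \<odot> (s, 0)"
      using norm_decomp[OF a n] dp_pos[OF d] by auto
    have sU: "(s, 0) \<in> UE" using z(2) by (simp add: UE_norm enorm_def power2_eq_square)
    have sn: "esub (s, 0) (1, 0) \<in> OE (int (dp d))" using z(3) by (simp add: pE_iff esub_def)
    have inv: "einv eps (econj (s, 0)) = (inverse s, 0)" using z(2) unfolding einv_econj
      by (simp add: enorm_def power2_eq_square field_simps)
    have "inverse s - 1 = - ((s - 1) * inverse s)" using z(2) by (simp add: field_simps)
    hence "inverse s - 1 \<in> P (int (dp d))" using z(2,3) by (simp add: P_unit_mult_right)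
    hence J: "inJ v eps d (tt (s, 0))"
      using z(3) inG_tt[OF UE_nz[OF sU]] unfolding inJ_def dp_def[symmetric]
      by (simp add: tmat_def inv pE_iff esub_def)
    have e: "tt a = tt z \<cdot> mI \<cdot> tt (s, 0)"
      using tt_mult UE_nz[OF norm_one_UE[OF z(1)]] UE_nz[OF sU] z(4) by simp
    have "f (tt a \<cdot> k) = chi z * f k" unfolding e eq[OF z(1) U1 inK_simps(2) J k] by (simp add: tmat_def)
    moreover have "yy (tt a \<cdot> k) = chi z * yy k"
    proof -
      have "tt a \<cdot> k = tt z \<cdot> (tt (s, 0) \<cdot> k)" unfolding e by (simp add: mm_assoc)
      thus ?thesis using yy_central[OF z(1) K_tt[OF sU k]] yy_tt_near_one[OF sn _ k] dp_pos[OF d] by simp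
    qed
    moreover have "chi z \<noteq> 0" by (rule char_nz[OF chi UE_nz[OF norm_one_UE[OF z(1)]]])
    ultimately show "f (tt a \<cdot> k) / yy (tt a \<cdot> k) = f k / yy k" by simp
  next
    fix x k assume x: "x \<in> P 0" and k: "K k"
    have "f (tt (1, 0) \<cdot> ub x \<cdot> mI \<cdot> k) = chi (1, 0) * psi' (bt d * snd (m21 (mI::'f mat2))) * f k"
      using x by (intro eq[OF _ U _ J1 k]) simp_all
    thus "f (ub x \<cdot> k) / yy (ub x \<cdot> k) = f k / yy k" using yy_ub[OF k x] chi_1 m0 by simp
  next
    fix c k assume c: "c \<in> P (int (lv d))" and k: "K k"
    have "inJ v eps d (nb c)"
      unfolding inJ_def dp_def[symmetric] lv_def[symmetric] using c by simp (simp add: nb_def esub_def)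
    hence "f (tt (1, 0) \<cdot> mI \<cdot> nb c \<cdot> k) = chi (1, 0) * psi' (bt d * snd (m21 (nb c))) * f k"
      by (intro eq[OF _ U1 _ _ k]) simp_all
    thus "f (nb c \<cdot> k) / yy (nb c \<cdot> k) = psi' (bt d * c) * (f k / yy k)"
      using yy_nb[OF k c lv_pos] chi_1 by (simp add: nb_def)
  qed
next
  let ?s = "\<lambda>k. f k / yy k"
  assume s: "?s \<in> S1 d"
  show "f \<in> S_space v eps w0 psi' chi d"
    unfolding S_space_def
  proof (intro CollectI conjI allI impI)
    fix k assume "\<not> K k" thus "f k = 0" using S1_off[OF s, of k] yy_nz by simp
  next
    fix zz u j k assume zz: "inZ eps zz" and u: "inU u" "K u" and j: "inJ v eps d j" and k: "K k"
    obtain z where z: "N z = 1" "zz = tt z" using zz inZ_iff by blast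
    obtain b where b: "u = ub b" using u(1) by (auto simp: inU_def ub_def)
    have b0: "b \<in> P 0" using u(2) by (simp add: b)
    have je: "inG eps j" "esub (m22 j) (1, 0) \<in> OE (int (dp d))" "m12 j \<in> OE (int (dp d))" "m21 j \<in> OE (int (lv d))"
      using j by (simp_all add: inJ_def dp_def lv_def)
    have j22: "m22 j \<in> UE" using UE_near_one[OF je(2)] dp_pos[OF d] by simp
    have j0: "m21 j \<in> OE 0" "m12 j \<in> OE 0" using je(3,4) by (auto elim: OE_mono)
    obtain a x c where a: "a \<in> UE" "x \<in> P 0" "c \<in> P (int (lv d))" "j = tt a \<cdot> ub x \<cdot> nb c" "esub a (1, 0) \<in> OE (int (dp d))"
      using big_cell_K[OF je(1) j22 j0] je by metis
    have k1: "K (nb c \<cdot> k)" and k2: "K (ub x \<cdot> (nb c \<cdot> k))" and k3: "K (tt a \<cdot> (ub x \<cdot> (nb c \<cdot> k)))"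
      and k4: "K (ub b \<cdot> (tt a \<cdot> (ub x \<cdot> (nb c \<cdot> k))))"
      using a b0 k K_nb K_ub K_tt by blast+
    let ?g = "tt z \<cdot> (ub b \<cdot> (tt a \<cdot> (ub x \<cdot> (nb c \<cdot> k))))"
    have g: "zz \<cdot> u \<cdot> j \<cdot> k = ?g" by (simp add: z b a(4) mm_assoc)
    have "?s ?g = ?s (ub b \<cdot> (tt a \<cdot> (ub x \<cdot> (nb c \<cdot> k))))"
      by (rule S1_tt[OF s norm_one_UE[OF z(1)] _ k4]) (simp add: z)
    also have "\<dots> = ?s (tt a \<cdot> (ub x \<cdot> (nb c \<cdot> k)))" by (rule S1_ub[OF s b0 k3])
    also have "\<dots> = ?s (ub x \<cdot> (nb c \<cdot> k))"
      by (rule S1_tt[OF s a(1) norm_near_one[OF a(5)] k2]) simp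
    also have "\<dots> = ?s (nb c \<cdot> k)" by (rule S1_ub[OF s a(2) k1])
    also have "\<dots> = psi' (bt d * c) * ?s k" by (rule S1_nb[OF s a(3) k])
    finally have 1: "?s ?g = psi' (bt d * c) * ?s k" .
    have dp1: "int (dp d) \<ge> 1" using dp_pos[OF d] by simp
    have "yy ?g = chi z * yy k"
      by (simp only: yy_central[OF z(1) k4] yy_ub[OF k3 b0] yy_tt_near_one[OF a(5) dp1 k2] yy_ub[OF k1 a(2)] yy_nb[OF k a(3) lv_pos])
    hence "f ?g = chi z * psi' (bt d * c) * f k" using 1 yy_nz[of ?g] yy_nz[of k] by (simp add: field_simps)
    moreover have "psi' (bt d * c) = PsiJ eps w0 psi' d j"
    proof -
      have "m21 j = einv eps (econj a) \<odot> (0, c)" unfolding a(4) by (rule prod_entries)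
      hence m: "snd (m21 j) = fst (m22 j) * c" unfolding a(4) prod_entries(1) by (simp add: emul_def)
      \<comment> \<open>The lower left entry of \<open>j\<close> differs from the coordinate
        \<open>c\<close> by a unit factor close to 1; the error lies in p^(d + 1), where the
        character is trivial.\<close>
      have "(fst (m22 j) - 1) * c \<in> P (1 + int d)"
        using je(2) a(3) lv_dp[of d] by (intro P_mult'[of _ "int (dp d)" _ "int (lv d)"]) (auto simp: pE_iff esub_def)
      hence "bt d * ((fst (m22 j) - 1) * c) \<in> P 1" by (simp only: bt_mult)
      hence "psi' (bt d * (fst (m22 j) * c)) = psi' (bt d * c)" by (intro psi_cong) (simp add: algebra_simps)
      thus ?thesis by (simp add: PsiJ_eq m)
    qed
    ultimately show "f (zz \<cdot> u \<cdot> j \<cdot> k) = chi (m11 zz) * PsiJ eps w0 psi' d j * f k"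
      unfolding g by (simp add: z tmat_def)
  qed
qed

section \<open>Decomposition of the functions on the compact group\<close>

definition component :: "nat set \<Rightarrow> ('f mat2 \<Rightarrow> complex) \<Rightarrow> nat \<times> 'f mat2 \<Rightarrow> complex" where
  "component D F x = (if fst x \<in> D then yy (snd x) * Phi (fst x) F (snd x) else 0)"

abbreviation tau where "tau \<equiv> tau_rep v eps w0 psi' chi"

lemma component_tau: assumes F: "F \<in> VK" and D: "D \<subseteq> {1..}" shows "component D F \<in> fst (tau D)"
proof -
  obtain n where n: "n \<ge> 1" "F \<in> VKl n" using F by (auto simp: VK_def)
  have "(\<lambda>g. component D F (d, g)) \<in> S_space v eps w0 psi' chi d" if "d \<in> D" for d
  proof -
    have d: "d \<ge> 1" using that D by auto
    have "(\<lambda>g. component D F (d, g) / yy g) = Phi d F" using that yy_nz by (auto simp: component_def)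
    thus ?thesis using S_space_iff[OF d] Phi_S1[OF n(2) d] by simp
  qed
  moreover have "{d. \<exists>g. component D F (d, g) \<noteq> 0} \<subseteq> {..<n}"
  proof
    fix d assume "d \<in> {d. \<exists>g. component D F (d, g) \<noteq> 0}"
    then obtain g where "d \<in> D" "Phi d F g \<noteq> 0" by (auto simp: component_def split: if_splits)
    thus "d \<in> {..<n}" using Phi_vanish[OF n(2), of d] D by (cases "n \<le> d") auto
  qed
  hence "finite {d. \<exists>g. component D F (d, g) \<noteq> 0}" by (rule finite_subset) simp
  ultimately show ?thesis by (simp add: tau_rep_def component_def)
qed

lemma tau_component: assumes "h \<in> fst (tau D)" "d \<in> D" "d \<ge> 1" shows "(\<lambda>g. h (d, g) / yy g) \<in> S1 d"
  using assms S_space_iff[of d "\<lambda>g. h (d, g)"] by (auto simp: tau_rep_def)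

text \<open>\<open>Phi\<close> averages on the left and so commutes with right translation; the
  multiplier is invariant under K_1.\<close>

lemma component_action: assumes h: "inKn v eps 1 h" shows "component D (snd VK_rep h F) = snd (tau D) h (component D F)"
proof (rule ext)
  fix x :: "nat \<times> 'f mat2"
  obtain d g where x: "x = (d, g)" by force
  show "component D (snd VK_rep h F) x = snd (tau D) h (component D F) x"
  proof (cases "K g")
    case True
    have "Phi d (snd VK_rep h F) g = Phi d F (g \<cdot> h)"
      using True inK_mult[OF True inKn_K[OF h]] K_nb[OF _ True]
      by (auto simp: Phi_def VK_rep_def mm_assoc intro!: avg_cong)
    thus ?thesis using True yy_right[OF True h] by (simp add: x component_def tau_rep_def)
  qed (simp add: x component_def tau_rep_def Phi_def)
qed

text \<open>Stated for an arbitrary splitting of the positive integers into two sets; the two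
  parities are one instance.\<close>

lemma VK_rep_decomposition:
  assumes D: "D1 \<inter> D2 = {}" "D1 \<union> D2 = {1..}"
  shows "rep_iso (inKn v eps 1) VK_rep (rep_sum (triv_rep (q + 1)) (rep_sum (tau D1) (tau D2)))"
proof -
  \<comment> \<open>The trivial summand is indexed by numbers below q + 1, so the points of the
    projective line are enumerated and each is given a representative in K.\<close>
  have "card {..<q + 1} = card cls_range" using card_cls_range by simp
  then obtain \<iota> where \<iota>: "bij_betw \<iota> {..<q + 1} cls_range"
    using finite_same_card_bij[of "{..<q + 1}" cls_range] card_cls_range(2) by blast
  define \<kappa> where "\<kappa> = (\<lambda>i. SOME k. K k \<and> cls k = \<iota> i)"
  have \<kappa>: "K (\<kappa> i) \<and> cls (\<kappa> i) = \<iota> i" if "i < q + 1" for i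
    unfolding \<kappa>_def by (rule someI_ex[OF cls_surj]) (use \<iota> that in \<open>auto simp: bij_betw_def\<close>)
  define co where "co = (\<lambda>F i. if i < q + 1 then Pn 1 F (\<kappa> i) else 0)"
  define \<phi> where "\<phi> = (\<lambda>F. case_sum (co F) (case_sum (component D1 F) (component D2 F)))"
  define R where "R = rep_sum (triv_rep (q + 1) :: ('f mat2, nat) rep) (rep_sum (tau D1) (tau D2))"
  have D12: "D1 \<subseteq> {1..}" "D2 \<subseteq> {1..}" using D by auto
  have R: "h \<in> fst R \<longleftrightarrow> h \<circ> Inl \<in> fst (triv_rep (q + 1) :: ('f mat2, nat) rep) \<and> (h \<circ> Inr) \<circ> Inl \<in> fst (tau D1) \<and> (h \<circ> Inr) \<circ> Inr \<in> fst (tau D2)" for h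
    by (simp add: R_def rep_sum_def)
  have \<phi>_in: "\<phi> F \<in> fst R" if "F \<in> VK" for F
    unfolding R \<phi>_def case_sum_o_inj using component_tau[OF that D12(1)] component_tau[OF that D12(2)]
    by (simp add: triv_rep_def co_def)
  have inj: "F = F'" if F: "F \<in> VK" "F' \<in> VK" and e: "\<phi> F = \<phi> F'" for F F'
  proof -
    obtain n where n: "n \<ge> 1" "F \<in> VKl n" "F' \<in> VKl n" using VK_linear[OF F] by blast
    have coE: "co F i = co F' i" for i using fun_cong[OF e, of "Inl i"] by (simp add: \<phi>_def)
    hence cF: "Pn 1 F (\<kappa> i) = Pn 1 F' (\<kappa> i)" if "i < q + 1" for i using coE[of i] that unfolding co_def by (simp only: if_True)
    have P1: "Pn 1 F k = Pn 1 F' k" for k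
    proof (cases "K k")
      case True
      obtain i where i: "i < q + 1" "\<iota> i = cls k"
        using cls_in_range[OF True] \<iota> unfolding bij_betw_def by (metis imageE lessThan_iff)
      have c: "cls k = cls (\<kappa> i)" "K (\<kappa> i)" using \<kappa>[OF i(1)] i(2) by simp_all
      show ?thesis
        using VKl_cls[OF Pn_1[OF n(2)] True c(2,1)] VKl_cls[OF Pn_1[OF n(3)] True c(2,1)] cF[OF i(1)] by simp
    qed (simp add: Pn_def)
    have Ph: "Phi d F = Phi d F'" if "d \<ge> 1" for d
    proof
      fix g
      have "component D1 F (d, g) = component D1 F' (d, g)" "component D2 F (d, g) = component D2 F' (d, g)"
        using fun_cong[OF e, of "Inr (Inl (d, g))"] fun_cong[OF e, of "Inr (Inr (d, g))"] by (simp_all add: \<phi>_def)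
      moreover have "d \<in> D1 \<or> d \<in> D2" using D that by auto
      ultimately show "Phi d F g = Phi d F' g" using yy_nz[of g] by (auto simp: component_def split: if_splits)
    qed
    show ?thesis
    proof
      fix k show "F k = F' k" unfolding VK_decomp[OF n(2,1), of k] VK_decomp[OF n(3,1), of k] P1 using Ph by simp
    qed
  qed
  have surj: "\<exists>F\<in>VK. \<phi> F = h" if h: "h \<in> fst R" for h
  proof -
    define s where "s = (\<lambda>d g. (if d \<in> D1 then h (Inr (Inl (d, g))) else h (Inr (Inr (d, g)))) / yy g)"
    \<comment> \<open>The degrees that occur in \<open>h\<close>; there are finitely many by the
      direct sum condition in \<open>tau_rep\<close>.\<close>
    define D where "D = {d. d \<in> D1 \<union> D2 \<and> (\<exists>g. s d g \<noteq> 0)}"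
    define val where "val = (\<lambda>C. h (Inl (the_inv_into {..<q + 1} \<iota> C)))"
    define w where "w = (\<lambda>k. if K k then val (cls k) else 0)"
    have w: "w \<in> VKl 1" unfolding w_def by (rule cls_VKl)
    have hR: "(\<lambda>i. h (Inl i)) \<in> fst (triv_rep (q + 1) :: ('f mat2, nat) rep)" "(\<lambda>x. h (Inr (Inl x))) \<in> fst (tau D1)" "(\<lambda>x. h (Inr (Inr x))) \<in> fst (tau D2)"
      using h unfolding R by (simp_all add: component_def[symmetric] o_def)
    have sS: "s d \<in> S1 d" if "d \<in> D1 \<union> D2" for d
    proof (cases "d \<in> D1")
      case True
      thus ?thesis using tau_component[OF hR(2) True] D12 unfolding s_def by auto
    next
      case False
      hence "d \<in> D2" using that by simp
      thus ?thesis using tau_component[OF hR(3), of d] D12 False unfolding s_def by auto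
    qed
    have "D \<subseteq> {d. \<exists>g. h (Inr (Inl (d, g))) \<noteq> 0} \<union> {d. \<exists>g. h (Inr (Inr (d, g))) \<noteq> 0}"
      by (auto simp: D_def s_def split: if_splits)
    moreover have "finite {d. \<exists>g. h (Inr (Inl (d, g))) \<noteq> 0}" "finite {d. \<exists>g. h (Inr (Inr (d, g))) \<noteq> 0}"
      using hR(2,3) by (simp_all add: tau_rep_def)
    ultimately have fD: "finite D" by (meson finite_UnI finite_subset)
    define F where "F = (\<lambda>k. w k + (\<Sum>d\<in>D. Psi d (s d) k))"
    have DS: "d \<ge> 1 \<and> s d \<in> S1 d" if "d \<in> D" for d using that sS[of d] D12 by (auto simp: D_def)
    note syn = synthesis[OF w fD DS, folded F_def]
    have Ph: "Phi d F = s d" if "d \<in> D1 \<union> D2" for d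
    proof -
      have "d \<ge> 1" using that D12 by auto
      moreover have "s d = (\<lambda>_. 0)" if "d \<notin> D" using that \<open>d \<in> D1 \<union> D2\<close> by (auto simp: D_def)
      ultimately show ?thesis using syn(3)[of d] by auto
    qed
    have "\<phi> F = h"
    proof
      fix x :: "nat + nat \<times> 'f mat2 + nat \<times> 'f mat2"
      consider (l) i where "x = Inl i" | (m) d g where "x = Inr (Inl (d, g))" | (r) d g where "x = Inr (Inr (d, g))"
        by (metis old.sum.exhaust surj_pair)
      thus "\<phi> F x = h x"
      proof cases
        case l
        show ?thesis
        proof (cases "i < q + 1")
          case True
          have "the_inv_into {..<q + 1} \<iota> (\<iota> i) = i"
            using True \<iota> by (intro the_inv_into_f_f) (auto simp: bij_betw_def)
          moreover have "Pn 1 F (\<kappa> i) = w (\<kappa> i)" by (rule fun_cong[OF syn(2)])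
          ultimately have "Pn 1 F (\<kappa> i) = h (Inl i)" using \<kappa>[OF True] by (simp only: w_def val_def if_True)
          thus ?thesis using True by (simp add: l \<phi>_def co_def)
        next
          case False
          thus ?thesis using hR(1) by (simp add: l \<phi>_def co_def triv_rep_def)
        qed
      next
        case m
        show ?thesis
        proof (cases "d \<in> D1")
          case True
          thus ?thesis using Ph[of d] yy_nz[of g] by (simp add: m \<phi>_def component_def s_def)
        next
          case False
          thus ?thesis using hR(2) by (simp add: m \<phi>_def component_def tau_rep_def)
        qed
      next
        case r
        show ?thesis
        proof (cases "d \<in> D2")
          case True
          hence "d \<notin> D1" using assms by auto
          thus ?thesis using True Ph[of d] yy_nz[of g] by (simp add: r \<phi>_def component_def s_def)
        next
          case False
          thus ?thesis using hR(3) by (simp add: r \<phi>_def component_def tau_rep_def)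
        qed
      qed
    qed
    thus ?thesis using syn(1) by blast
  qed
  have bij: "bij_betw \<phi> VK (fst R)"
    unfolding bij_betw_def using inj surj \<phi>_in by (auto simp: inj_on_def image_iff) metis
  have lin: "\<phi> (\<lambda>x. c * f x + g x) = (\<lambda>y. c * \<phi> f y + \<phi> g y)" if fg: "f \<in> VK" "g \<in> VK" for f g c
  proof
    fix y
    obtain n where n: "f \<in> VKl n" "g \<in> VKl n" using VK_linear[OF fg] by blast
    show "\<phi> (\<lambda>x. c * f x + g x) y = c * \<phi> f y + \<phi> g y"
      by (auto simp: \<phi>_def co_def component_def Pn_linear[OF n] Phi_linear[OF n] distrib_left mult.left_commute
          simp del: One_nat_def split: sum.splits)
  qed
  have act: "\<phi> (snd VK_rep h f) = snd R h (\<phi> f)" if h: "inKn v eps 1 h" and f: "f \<in> VK" for h f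
  proof -
    obtain n where n: "n \<ge> 1" "f \<in> VKl n" using f by (auto simp: VK_def)
    have "co (snd VK_rep h f) = co f"
    proof
      fix i
      show "co (snd VK_rep h f) i = co f i"
      proof (cases "i < q + 1")
        case True
        hence k: "K (\<kappa> i)" using \<kappa> by blast
        have "avg 1 (\<lambda>c. snd VK_rep h f (nb c \<cdot> \<kappa> i)) = avg 1 (\<lambda>c. f (nb c \<cdot> (\<kappa> i \<cdot> h)))"
        proof (rule avg_cong)
          fix c assume "c \<in> P (int 1)"
          hence "K (nb c \<cdot> \<kappa> i)" using k by (rule K_nb)
          thus "snd VK_rep h f (nb c \<cdot> \<kappa> i) = f (nb c \<cdot> (\<kappa> i \<cdot> h))"
            by (simp add: VK_rep_def mm_assoc)
        qed
        hence "Pn 1 (snd VK_rep h f) (\<kappa> i) = Pn 1 f (\<kappa> i \<cdot> h)"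
          using k inK_mult[OF k inKn_K[OF h]] by (simp add: Pn_def)
        \<comment> \<open>The level 1 part is right invariant under K_1, which is why it contributes
          a trivial representation.\<close>
        also have "\<dots> = Pn 1 f (\<kappa> i)" by (rule VKl_right[OF Pn_1[OF n(2)] order_refl k h])
        finally show ?thesis by (simp add: co_def)
      qed (simp add: co_def)
    qed
    thus ?thesis
      unfolding \<phi>_def R_def rep_sum_def component_action[OF h] by (simp add: triv_rep_def case_sum_o_inj)
  qed
  have "rep_iso (inKn v eps 1) VK_rep R"
    unfolding rep_iso_def using bij lin act by (intro exI[of _ \<phi>]) (simp add: VK_rep_def)
  thus ?thesis by (simp add: R_def)
qed

end

end

section \<open>Composing the two isomorphisms\<close>

lemma rep_iso_trans:
  assumes "rep_iso H R S" "rep_iso H S T" shows "rep_iso H R T"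
proof -
  obtain f where f: "bij_betw f (fst R) (fst S)"
    "\<And>x y c. x \<in> fst R \<Longrightarrow> y \<in> fst R \<Longrightarrow> f (\<lambda>t. c * x t + y t) = (\<lambda>t. c * f x t + f y t)"
    "\<And>h x. H h \<Longrightarrow> x \<in> fst R \<Longrightarrow> f (snd R h x) = snd S h (f x)"
    using assms(1) by (auto simp: rep_iso_def)
  obtain g where g: "bij_betw g (fst S) (fst T)"
    "\<And>x y c. x \<in> fst S \<Longrightarrow> y \<in> fst S \<Longrightarrow> g (\<lambda>t. c * x t + y t) = (\<lambda>t. c * g x t + g y t)"
    "\<And>h x. H h \<Longrightarrow> x \<in> fst S \<Longrightarrow> g (snd S h x) = snd T h (g x)"
    using assms(2) by (auto simp: rep_iso_def)
  have "f x \<in> fst S" if "x \<in> fst R" for x using f(1) that by (auto simp: bij_betw_def)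
  thus ?thesis unfolding rep_iso_def
    using bij_betw_trans[OF f(1) g(1)] f(2,3) g(2,3) by (intro exI[of _ "g \<circ> f"]) simp
qed

lemma rep_iso_mono: "rep_iso H R S \<Longrightarrow> (\<And>h. H' h \<Longrightarrow> H h) \<Longrightarrow> rep_iso H' R S"
  unfolding rep_iso_def by (elim exE conjE, intro exI conjI) (assumption+, blast)

theorem theorem7p4:
  fixes v :: "'f::field \<Rightarrow> int" and w0 eps :: 'f and psi' :: "'f \<Rightarrow> complex"
    and chi :: "'f ext \<Rightarrow> complex" and r :: nat
  assumes "nonarch_local_field v w0"
    and "odd_residual_char v"
    and "eps \<noteq> 0" and "v eps = 0" and "\<not> (\<exists>y. y * y = eps)"
    and "additive_char_cond v psi'"
    and "char_of_Ex eps chi"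
    and "minimal_depth v eps chi r"
    and "\<forall>z. inZ eps (mk z (0, 0) (0, 0) z) \<and> inKn v eps 1 (mk z (0, 0) (0, 0) z) \<longrightarrow> chi z = 1"
  shows "rep_iso (inKn v eps (2 * r + 1)) (principal_series v eps chi)
           (rep_sum (triv_rep (residue_card v + 1))
              (rep_sum (tau_rep v eps w0 psi' chi {d. d > 0 \<and> even d})
                       (tau_rep v eps w0 psi' chi {d. odd d})))"
proof -
  interpret unramified_setup v w0 eps psi' using assms(1-6) by unfold_locales
  have depth: "chi a = 1" if a: "esub a (1, 0) \<in> OE (int (2 * r + 1))" for a
  proof -
    have "esub a (1, 0) \<in> OE (int (r + 1))" using a by (rule OE_mono) simp
    hence l: "levT v eps (r + 1) a" by (simp add: levT_def)
    \<comment> \<open>Covers the alternative in \<open>has_depth\<close> where r = 0 and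
      \<open>chi\<close> is trivial on all units, for which level r + 1 is not mentioned.\<close>
    have "a \<in> UE" by (rule UE_near_one[OF a]) simp
    hence "levT v eps 0 a" by (simp add: levT_def)
    moreover have "has_depth (levT v eps) chi r" using assms(8) by (simp add: minimal_depth_def)
    ultimately show ?thesis using l unfolding has_depth_def by blast
  qed
  \<comment> \<open>The condition on scalar matrices in K_1, restated for elements of norm
    one.\<close>
  have central: "chi z = 1" if z: "N z = 1" "esub z (1, 0) \<in> OE 1" for z
  proof -
    have "inZ eps (mk z (0, 0) (0, 0) z)" using z(1) inZ_iff central_eq by metis
    moreover have "inKn v eps 1 (mk z (0, 0) (0, 0) z)"
      using inK_tt[OF norm_one_UE[OF z(1)]] z(2) unfolding central_eq[OF z(1), symmetric]
      by (simp add: inKn_iff congr_def mI_def esub_def)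
    ultimately show ?thesis using assms(9) by blast
  qed
  have 1: "rep_iso (inKn v eps (2 * r + 1)) (principal_series v eps chi) VK_rep"
    by (rule principal_series_restriction[OF assms(7) _ depth]) simp_all
  have disj: "{d. d > 0 \<and> even d} \<inter> {d::nat. odd d} = {}" by blast
  have "d \<in> {d. d > 0 \<and> even d} \<union> {d. odd d} \<longleftrightarrow> d \<in> {1..}" for d :: nat
    by (cases "d = 0") auto
  hence cover: "{d. d > 0 \<and> even d} \<union> {d::nat. odd d} = {1..}" by blast
  have 2: "rep_iso (inKn v eps 1) VK_rep (rep_sum (triv_rep (residue_card v + 1))
              (rep_sum (tau_rep v eps w0 psi' chi {d. d > 0 \<and> even d})
                       (tau_rep v eps w0 psi' chi {d. odd d})))"
    by (rule VK_rep_decomposition[OF assms(7) central disj cover])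
  have "rep_iso (inKn v eps (2 * r + 1)) VK_rep (rep_sum (triv_rep (residue_card v + 1))
              (rep_sum (tau_rep v eps w0 psi' chi {d. d > 0 \<and> even d})
                       (tau_rep v eps w0 psi' chi {d. odd d})))"
    by (rule rep_iso_mono[OF 2]) (erule inKn_mono, simp)
  with 1 show ?thesis by (rule rep_iso_trans)
qed

end
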